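(* Let the integers $a(n)$, $n\ge 1$, be defined by $\sum_{n=1}^\infty a(n)q^n=\phi(q)$. Then, for any nonnegative integer $n$, $$a(50n+19)\equiv a(50n+39)\equiv a(50n+49)\equiv 0 \pmod{25}.$$
   Context: Notation, for $|q|<1$: $(a;q)_0:=1$ and $(a;q)_n:=\prod_{k=0}^{n-1}(1-aq^k)$ for $n\ge 1$. The function $\phi$ is $$\phi(q):=\sum_{n=0}^\infty \frac{(-q;q)_{2n}\,q^{n+1}}{(q;q^2)_{n+1}^2},$$ and $a(n)$ is the coefficient of $q^n$ in its power series expansion. *)

theory Defs
  imports "HOL-Analysis.Analysis" "HOL-Number_Theory.Cong"
begin

text \<open>The finite $q$-shifted factorial $(a;q)_n$; the case $n = 0$ is the empty product.\<close>

definition qpoch :: "'a::comm_ring_1 \<Rightarrow> 'a \<Rightarrow> nat \<Rightarrow> 'a" where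
  "qpoch a q n = (\<Prod>k<n. 1 - a * q ^ k)"

text \<open>Only meaningful for \<open>norm q < 1\<close>, where the series converges and no denominator vanishes.\<close>

definition phi :: "complex \<Rightarrow> complex" where
  "phi q = (\<Sum>n. qpoch (- q) q (2 * n) * q ^ (n + 1) / (qpoch q (q\<^sup>2) (n + 1))\<^sup>2)"

end

theory Submission
  imports Defs
begin

text \<open>A Bailey pair turns \<open>phi\<close> into the Appell sum \<open>\<Sum>r. (-1) ^ r * q ^ ((r + 1)\<^sup>2) / (1 - q ^ (2 * r + 1))\<close> divided
  by \<open>theta4 q\<close>. Its odd part is a theta quotient: with \<open>F = (\<Sum>n. a (2 * n + 1) * q ^ n)\<close> one gets
  \<open>F * theta4\<^sup>2 = psi ^ 3\<close>. By Jacobi's identities \<open>J(q) = theta4\<^sup>2 * psi\<close> and \<open>J(q\<^sup>2) = theta4 * psi\<^sup>2\<close> for the series \<open>J\<close> of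
  cubes of Euler's product, \<open>F * theta4 ^ 5 = J(q) * J(q\<^sup>2)\<close>, and the coefficients of the right-hand side at exponents
  \<open>5 * n + 4\<close> are divisible by 25. Hence those of \<open>F\<close> are divisible by 5, and the quotients are determined
  modulo 5 by the fifth of the difference between \<open>theta4(q) ^ 5\<close> and \<open>theta4(q ^ 5)\<close>. Modulo 5 all logarithmic derivatives are polynomials
  in an Eisenstein series \<open>e\<close> with \<open>q e' = 1 - e ^ 4\<close>, and a computation with polynomials in \<open>e\<close> shows
  that the quotients are the coefficients of \<open>J(q\<^sup>2)\<close> times a series in \<open>q ^ 5\<close>. The exponents of \<open>J(q\<^sup>2)\<close> are twice
  triangular numbers, so they are 0 or 2 modulo 5 unless the coefficient is divisible by 5.\<close>

text \<open>The three progressions are the numbers 2(5k + 4) + 1 with k congruent to 1, 3 or 4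
  modulo 5, so only the odd part of \<open>phi\<close> matters. Multiplying the relation for
  \<open>F\<close> by \<open>theta4 ^ 3\<close> does two things at once: the factor beside
  \<open>F\<close> becomes a fifth power, which modulo 5 is a series in q^5 and passes through the
  extraction of the exponents 5n + 4; and the other side becomes a product of two Jacobi series,
  whose coefficients 4n + 1 supply both factors 5. The obstacle is the modulus 25, where a fifth
  power is no longer a series in q^5. The correction W = (theta4(q)^5 - theta4(q^5)) / 5 enters, and
  what is accessible modulo 5 is its derivative, because both terms acquire a factor 5 under q d/dq.
  This determines W modulo 5 up to a series in q^5. That ambiguity is harmless: it multiplies
  \<open>theta4 ^ 3 * psi ^ 3\<close>, whose coefficients at exponents 5n + 4 vanish modulo 5. Hence
  the detour through logarithmic derivatives and an antiderivative that is a polynomial in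
  \<open>e\<close>.\<close>

unbundle no vec_syntax
unbundle fps_syntax

subsection \<open>Bailey pairs\<close>

lemma qpoch_0 [simp]: "qpoch a q 0 = 1"
  by (simp add: qpoch_def)

lemma qpoch_Suc: "qpoch a q (Suc n) = qpoch a q n * (1 - a * q ^ n)"
  by (simp add: qpoch_def)

locale nome =
  fixes q :: complex
  assumes nz [simp]: "q \<noteq> 0" and lt: "norm q < 1"
begin

text \<open>The value 0 at negative indices makes \<open>inv_poch_step\<close> true for all integers, so that the sums below
  need no boundary terms.\<close>

definition inv_poch :: "int \<Rightarrow> complex" where
  "inv_poch k = (if k < 0 then 0 else 1 / qpoch (q\<^sup>2) (q\<^sup>2) (nat k))"

lemma norm_pow_lt: "norm (q ^ Suc n) < 1"
  using lt by (simp add: norm_power power_Suc_less_one norm_mult del: power_Suc)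

lemma pow_neq_1: "n > 0 \<Longrightarrow> q ^ n \<noteq> 1"
  using norm_pow_lt[of "n - 1"] by (cases n) auto

lemma pow_neq_minus_1: "n > 0 \<Longrightarrow> q ^ n \<noteq> - 1"
  using norm_pow_lt[of "n - 1"] by (cases n) auto

lemma powi_neq_1:
  assumes "k \<noteq> 0" shows "q powi k \<noteq> 1" "q powi k \<noteq> -1"
proof -
  have "q powi k \<noteq> 1 \<and> q powi k \<noteq> -1"
  proof (cases "k \<ge> 0")
    case True
    then show ?thesis using assms pow_neq_1[of "nat k"] pow_neq_minus_1[of "nat k"]
      by (auto simp: power_int_def)
  next
    case False
    then have "q powi k = inverse (q ^ nat (-k))" by (simp add: power_int_def power_inverse)
    then show ?thesis using False pow_neq_1[of "nat (-k)"] pow_neq_minus_1[of "nat (-k)"]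
      by (metis inverse_1 inverse_inverse_eq inverse_minus_eq neg_less_0_iff_less neg_0_less_iff_less
          not_le zero_less_nat_eq)
  qed
  then show "q powi k \<noteq> 1" "q powi k \<noteq> -1" by auto
qed

lemma qpoch_qq_nz: "qpoch (q\<^sup>2) (q\<^sup>2) n \<noteq> 0"
proof -
  have "q\<^sup>2 * (q\<^sup>2) ^ k \<noteq> 1" for k
    using pow_neq_1[of "2 * Suc k"] by (simp add: power_mult power2_eq_square mult.assoc)
  then show ?thesis by (auto simp: qpoch_def)
qed

lemma inv_poch_step: "inv_poch k = inv_poch (k + 1) * (1 - q powi (2 * k + 2))"
proof (cases "k \<ge> 0")
  case True
  then have "nat (k + 1) = Suc (nat k)" by simp
  moreover have "q powi (2 * k + 2) = q\<^sup>2 * (q\<^sup>2) ^ nat k"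
    using True by (simp add: power_int_def nat_add_distrib nat_mult_distrib power_add power_mult power2_eq_square)
  moreover have "qpoch (q\<^sup>2) (q\<^sup>2) (Suc (nat k)) \<noteq> 0" by (rule qpoch_qq_nz)
  ultimately show ?thesis using True
    by (simp add: inv_poch_def qpoch_Suc)
next
  case False
  then consider "k = -1" | "k < -1" by linarith
  then show ?thesis by cases (auto simp: inv_poch_def)
qed

lemma inv_poch_neg: "k < 0 \<Longrightarrow> inv_poch k = 0"
  by (simp add: inv_poch_def)

text \<open>The weights of Bailey pairs relative to \<open>a = q\<^sup>2\<close> in base \<open>q\<^sup>2\<close>.\<close>

definition bailey_coeff :: "int \<Rightarrow> int \<Rightarrow> complex" where
  "bailey_coeff n r = inv_poch (n - r) * inv_poch (n + r + 1)"

text \<open>This is the alpha-sequence of the unit Bailey pair. Its usual normalising factor 1/(1 -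
  q^2) is absorbed by \<open>bailey_coeff\<close>, whose second factor starts at 1 - q^2 instead of
  1 - q^4.\<close>

definition unit_alpha :: "int \<Rightarrow> complex" where
  "unit_alpha r = (-1) powi r * q powi (r * r - r) * (1 - q powi (4 * r + 2))"

lemma powi_split:
  "q powi (a + b) = q powi a * q powi b" "q powi (a - b) = q powi a / q powi b"
  "q powi (2 * a) = (q powi a)\<^sup>2" "q powi (numeral w) = q ^ numeral w" "q powi a \<noteq> 0"
   apply (simp_all add: power_int_add power_int_diff)
  by (metis mult.commute power_int_mult power_int_numeral)

lemma inv_poch_step': "k' = k + 1 \<Longrightarrow> inv_poch k = inv_poch k' * (1 - (q powi k')\<^sup>2)"
  using inv_poch_step[of k] by (simp add: powi_split(3)[symmetric] algebra_simps)

text \<open>The partial sums have a closed form once multiplied by 1 - q^(2n). The factor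
  \<open>inv_poch (n - int R)\<close> vanishes as soon as R exceeds n, so the complete sum is zero
  whenever 1 - q^(2n) is not.\<close>

lemma unit_telescope:
  "(1 - q powi (2 * n)) * (\<Sum>r<R. unit_alpha (int r) * bailey_coeff n (int r)) =
   - ((-1) ^ R) * q powi (int R * int R - int R) * (1 - q powi (2 * int R)) * inv_poch (n - int R) * inv_poch (n + int R)"
proof (induction R)
  case 0
  then show ?case by simp
next
  case (Suc R)
  let ?r = "int R"
  define y z w where "y = q powi n" and "z = q powi ?r" and "w = q powi (?r * ?r)"
  have nz': "y \<noteq> 0" "z \<noteq> 0" "w \<noteq> 0" by (simp_all add: y_def z_def w_def)
  have e1: "inv_poch (n - int R) = inv_poch (n - ?r)" ..
  have s1: "inv_poch (n - int (Suc R)) = inv_poch (n - ?r) * (1 - y\<^sup>2 / z\<^sup>2)"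
    using inv_poch_step'[of "n - ?r" "n - int (Suc R)"] by (simp add: y_def z_def powi_split power_mult_distrib power_divide)
  have s2: "inv_poch (n + ?r) = inv_poch (n + ?r + 1) * (1 - q\<^sup>2 * y\<^sup>2 * z\<^sup>2)"
    using inv_poch_step'[of "n + ?r + 1" "n + ?r"] by (simp add: y_def z_def powi_split power_mult_distrib power_divide)
  have s3: "inv_poch (n + int (Suc R)) = inv_poch (n + ?r + 1)" by (simp add: algebra_simps)
  have "int (Suc R) * int (Suc R) - int (Suc R) = ?r * ?r + ?r" by (simp add: algebra_simps)
  then have s4: "q powi (int (Suc R) * int (Suc R) - int (Suc R)) = w * z"
    by (simp only: powi_split w_def z_def)
  have s5: "q powi (?r * ?r - ?r) = w / z" by (simp add: powi_split w_def z_def)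
  have "q powi (4 * ?r + 2) = (q powi (2 * (2 * ?r))) * q^2" by (simp add: powi_split)
  also have "\<dots> = z^4 * q^2" unfolding powi_split z_def by (simp add: power_mult[symmetric] mult.commute)
  finally have s6: "q powi (4 * ?r + 2) = z^4 * q^2" .
  have "2 * int (Suc R) = 2 * ?r + 2" by simp
  then have s7: "q powi (2 * int (Suc R)) = z^2 * q^2" by (simp only: powi_split z_def)
  have s8: "q powi (2 * ?r) = z^2" "q powi (2 * n) = y^2" by (simp_all add: powi_split z_def y_def)
  define a1 b1 x where "a1 = 1 - y\<^sup>2 / z\<^sup>2" and "b1 = 1 - q\<^sup>2 * y\<^sup>2 * z\<^sup>2" and "x = w / z"
  note a = this
  have w: "w = x * z" using nz' by (simp add: a)
  \<comment> \<open>With the common factors removed, the induction step is this identity in y = q^n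
    and z = q^R.\<close>
  have *: "- (1 - z^2) * b1 + (1 - y^2) * (1 - z^4 * q^2) = z^2 * (1 - z^2 * q^2) * a1"
    unfolding a using nz' by (simp add: divide_simps) algebra
  define s where "s = (- 1 :: complex) ^ R"
  have m1: "(- 1 :: complex) powi ?r = s" "(- 1 :: complex) ^ Suc R = - s" "(- 1) ^ R = s"
    by (simp_all add: s_def)
  have sp: "(1 - q powi (2 * n)) * (\<Sum>r<Suc R. unit_alpha (int r) * bailey_coeff n (int r)) =
     (1 - q powi (2 * n)) * (\<Sum>r<R. unit_alpha (int r) * bailey_coeff n (int r)) + (1 - q powi (2 * n)) * (unit_alpha ?r * bailey_coeff n ?r)"
    by (simp add: distrib_left)
  show ?case unfolding sp Suc.IH unfolding unit_alpha_def bailey_coeff_def s1 s2 s3 s4 s5 s6 s7 s8 m1 a[symmetric] unfolding w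
    using * by algebra
qed

lemma unit_pair: "(\<Sum>r\<le>n. unit_alpha (int r) * bailey_coeff (int n) (int r)) = (if n = 0 then 1 else 0)"
proof (cases "n = 0")
  case True
  have "qpoch (q\<^sup>2) (q\<^sup>2) (Suc 0) \<noteq> 0" by (rule qpoch_qq_nz)
  with True show ?thesis by (simp add: unit_alpha_def bailey_coeff_def inv_poch_def qpoch_def powi_split)
next
  case False
  have "(1 - q powi (2 * int n)) * (\<Sum>r<Suc n. unit_alpha (int r) * bailey_coeff (int n) (int r)) = 0"
    unfolding unit_telescope by (simp add: inv_poch_neg)
  with False powi_neq_1[of "2 * int n"] show ?thesis by (simp add: lessThan_Suc_atMost)
qed

text \<open>Chosen so that the associated beta-sequence consists of the reciprocals
  1/(q;q^2)_(n+1)^2 in the series of \<open>phi\<close>.\<close>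

definition lambert_alpha :: "int \<Rightarrow> complex" where
  "lambert_alpha r = (-1) powi r * q powi (r * r + r) * (1 + q powi (2 * r + 1)) / (1 - q powi (2 * r + 1))"

text \<open>1 - q^(2n+3) is the factor by which (q;q^2)_(n+1) grows, so the left side is the
  termwise defect in the recurrence expected of the beta-sequence. The defect is a multiple of a
  term of the unit pair at n + 1, and those terms sum to zero.\<close>

lemma lambert_alpha_step:
  "(1 - q powi (2 * n + 3))\<^sup>2 * (lambert_alpha r * bailey_coeff (n + 1) r) - lambert_alpha r * bailey_coeff n r =
     q powi (2 * n + 2) * (unit_alpha r * bailey_coeff (n + 1) r)"
proof -
  define y z w where "y = q powi n" and "z = q powi r" and "w = q powi (r * r)"
  have nz': "y \<noteq> 0" "z \<noteq> 0" "w \<noteq> 0" by (simp_all add: y_def z_def w_def)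
  have s1: "inv_poch (n - r) = inv_poch (n + 1 - r) * (1 - q\<^sup>2 * y\<^sup>2 / z\<^sup>2)"
    using inv_poch_step'[of "n + 1 - r" "n - r"] by (simp add: y_def z_def powi_split power_mult_distrib power_divide)
  have s2: "inv_poch (n + r + 1) = inv_poch (n + 1 + r + 1) * (1 - q^4 * y\<^sup>2 * z\<^sup>2)"
    using inv_poch_step'[of "n + 1 + r + 1" "n + r + 1"]
    by (simp add: y_def z_def powi_split power_mult_distrib power_divide)
  have s3: "q powi (2 * r + 1) = q * z^2"  by (simp add: powi_split z_def)
  have "2 * r + 1 \<noteq> 0" by presburger
  from powi_neq_1[OF this] have s3': "1 - q * z^2 \<noteq> 0" unfolding s3 by auto
  have "q powi (4 * r + 2) = (q powi (2 * (2 * r))) * q^2" by (simp add: powi_split)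
  also have "\<dots> = z^4 * q^2" unfolding powi_split z_def by (simp add: power_mult[symmetric] mult.commute)
  finally have s6: "q powi (4 * r + 2) = z^4 * q^2" .
  have s8: "q powi (2 * n + 3) = y^2 * q^3" "q powi (2 * n + 2) = y^2 * q^2"
     "q powi (r * r + r) = w * z" "q powi (r * r - r) = w / z"
    by (simp_all add: powi_split z_def y_def w_def)
  have "(1 - y^2 * q^3)\<^sup>2 * (1 + q * z^2) * z / (1 - q * z^2)
      - (1 + q * z^2) * z / (1 - q * z^2) * (1 - q\<^sup>2 * y\<^sup>2 / z\<^sup>2) * (1 - q^4 * y\<^sup>2 * z\<^sup>2)
      = y^2 * q^2 * (1 - z^4 * q^2) / z"
    using nz' s3' by (simp add: divide_simps) algebra
  then have "((1 - y^2 * q^3)\<^sup>2 * (1 + q * z^2) * z / (1 - q * z^2)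
      - (1 + q * z^2) * z / (1 - q * z^2) * (1 - q\<^sup>2 * y\<^sup>2 / z\<^sup>2) * (1 - q^4 * y\<^sup>2 * z\<^sup>2)) *
       ((-1) powi r * w * inv_poch (n + 1 - r) * inv_poch (n + 1 + r + 1))
      = y^2 * q^2 * (1 - z^4 * q^2) / z * ((-1) powi r * w * inv_poch (n + 1 - r) * inv_poch (n + 1 + r + 1))"
    by simp
  then show ?thesis unfolding lambert_alpha_def unit_alpha_def bailey_coeff_def s1 s2 s3 s6 s8 by (simp add: field_simps)
qed

lemma odd_poch_nz: "qpoch q (q\<^sup>2) n \<noteq> 0"
proof -
  have "q * (q\<^sup>2) ^ k \<noteq> 1" for k
    using pow_neq_1[of "2 * k + 1"] by (simp add: power_mult)
  then show ?thesis by (auto simp: qpoch_def)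
qed

lemma bailey_coeff_eq_0: "r > n \<Longrightarrow> bailey_coeff n r = 0"
  by (simp add: bailey_coeff_def inv_poch_neg)

lemma lambert_alpha_pair: "(\<Sum>r\<le>n. lambert_alpha (int r) * bailey_coeff (int n) (int r)) = 1 / (qpoch q (q\<^sup>2) (Suc n))\<^sup>2"
proof (induction n)
  case 0
  have "qpoch q (q\<^sup>2) (Suc 0) \<noteq> 0" "qpoch (q\<^sup>2) (q\<^sup>2) (Suc 0) \<noteq> 0"
    using qpoch_qq_nz odd_poch_nz by blast+
  then have "1 - q \<noteq> 0" "1 - q\<^sup>2 \<noteq> 0" by (simp_all add: qpoch_def)
  then show ?case
    by (simp add: lambert_alpha_def bailey_coeff_def inv_poch_def qpoch_def powi_split divide_simps) algebra
next
  case (Suc n)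
  let ?q = "1 - q powi (2 * int n + 3)"
  have "?q = 1 - q * (q\<^sup>2) ^ Suc n"
    by (simp add: powi_split power_mult_distrib power2_eq_square power3_eq_cube)
  then have 1: "qpoch q (q\<^sup>2) (Suc (Suc n)) = qpoch q (q\<^sup>2) (Suc n) * ?q"
    by (simp add: qpoch_Suc)
  have "?q\<^sup>2 * (\<Sum>r\<le>Suc n. lambert_alpha (int r) * bailey_coeff (int n + 1) (int r)) - (\<Sum>r\<le>Suc n. lambert_alpha (int r) * bailey_coeff (int n) (int r))
     = q powi (2 * int n + 2) * (\<Sum>r\<le>Suc n. unit_alpha (int r) * bailey_coeff (int n + 1) (int r))"
    unfolding sum_distrib_left sum_subtractf[symmetric] lambert_alpha_step ..
  also have "(\<Sum>r\<le>Suc n. unit_alpha (int r) * bailey_coeff (int n + 1) (int r)) = 0"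
    using unit_pair[of "Suc n"] by (simp add: add.commute)
  also have "(\<Sum>r\<le>Suc n. lambert_alpha (int r) * bailey_coeff (int n) (int r)) = (\<Sum>r\<le>n. lambert_alpha (int r) * bailey_coeff (int n) (int r))"
    by (simp add: bailey_coeff_eq_0)
  finally have "?q\<^sup>2 * (\<Sum>r\<le>Suc n. lambert_alpha (int r) * bailey_coeff (int (Suc n)) (int r)) = 1 / (qpoch q (q\<^sup>2) (Suc n))\<^sup>2"
    using Suc.IH by (simp add: add.commute)
  moreover have "qpoch q (q\<^sup>2) (Suc (Suc n)) \<noteq> 0" by (rule odd_poch_nz)
  then have "?q \<noteq> 0" "qpoch q (q\<^sup>2) (Suc n) \<noteq> 0" unfolding 1 by auto
  moreover have "s = 1 / (p * x)\<^sup>2" if "x\<^sup>2 * s = 1 / p\<^sup>2" "x \<noteq> 0" "p \<noteq> 0" for s x p :: complex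
    using that by (simp add: power_mult_distrib field_simps)
  ultimately show ?case unfolding 1 by blast
qed

section \<open>Finite forms of the triple product\<close>

definition triple_coeff :: "int \<Rightarrow> int \<Rightarrow> complex" where
  "triple_coeff n r = (-1) powi r * q powi (r * r + r) * bailey_coeff n r"

text \<open>The right side involves r only through the two neighbouring shifts. Summed against an
  eigenvector of the sum of these shifts, the relation becomes a first-order recurrence in
  n.\<close>

lemma triple_coeff_step:
  "(1 - q powi (4 * n + 4)) * (1 - q powi (4 * n + 6)) * triple_coeff (n + 1) r =
     (1 + q powi (4 * n + 4)) * triple_coeff n r - q powi (2 * n + 2) * (triple_coeff n (r - 1) + triple_coeff n (r + 1))"
proof -
  define y z w where "y = q powi n" and "z = q powi r" and "w = q powi (r * r)"
  have nz': "y \<noteq> 0" "z \<noteq> 0" "w \<noteq> 0" by (simp_all add: y_def z_def w_def)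
  have s1: "inv_poch (n - r) = inv_poch (n + 1 - r) * (1 - q\<^sup>2 * y\<^sup>2 / z\<^sup>2)"
    using inv_poch_step'[of "n + 1 - r" "n - r"] by (simp add: y_def z_def powi_split power_mult_distrib power_divide)
  have s2: "inv_poch (n + r + 1) = inv_poch (n + 1 + r + 1) * (1 - q^4 * y\<^sup>2 * z\<^sup>2)"
    using inv_poch_step'[of "n + 1 + r + 1" "n + r + 1"]
    by (simp add: y_def z_def powi_split power_mult_distrib power_divide)
  have s3: "inv_poch (n - (r + 1)) = inv_poch (n + 1 - r) * (1 - q\<^sup>2 * y\<^sup>2 / z\<^sup>2) * (1 - y\<^sup>2 / z\<^sup>2)"
    using inv_poch_step'[of "n - r" "n - (r + 1)"] by (simp add: s1[unfolded y_def z_def] y_def z_def powi_split power_mult_distrib power_divide)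
  have s4: "inv_poch (n + (r - 1) + 1) = inv_poch (n + 1 + r + 1) * (1 - q^4 * y\<^sup>2 * z\<^sup>2) * (1 - q^2 * y\<^sup>2 * z\<^sup>2)"
    using inv_poch_step'[of "n + r + 1" "n + (r - 1) + 1"] by (simp add: s2[unfolded y_def z_def] y_def z_def powi_split power_mult_distrib power_divide)
  have s4': "inv_poch (n - (r - 1)) = inv_poch (n + 1 - r)" "inv_poch (n + (r + 1) + 1) = inv_poch (n + 1 + r + 1)"
    by (simp_all add: algebra_simps)
  have "(r + 1) * (r + 1) + (r + 1) = r * r + 2 * r + r + 2" "(r - 1) * (r - 1) + (r - 1) = r * r - r"
    by (simp_all add: algebra_simps)
  then have s5: "q powi ((r + 1) * (r + 1) + (r + 1)) = w * z^3 * q^2"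
     "q powi ((r - 1) * (r - 1) + (r - 1)) = w / z"
    by (simp_all only: powi_split w_def z_def) (simp add: power3_eq_cube power2_eq_square)
  have "q powi (4 * n + 4) = (q powi (2 * (2 * n))) * q^4"
       "q powi (4 * n + 6) = (q powi (2 * (2 * n))) * q^6" by (simp_all add: powi_split)
  then have s6: "q powi (4 * n + 4) = y^4 * q^4" "q powi (4 * n + 6) = y^4 * q^6"
    unfolding powi_split(3) y_def by (simp_all add: power_mult[symmetric])
  have s8: "q powi (2 * n + 2) = y^2 * q^2"  "q powi (r * r + r) = w * z"
    by (simp_all add: powi_split z_def y_def w_def)
  have s9: "(-1) powi (r + 1) = - ((-1) powi r :: complex)" "(-1) powi (r - 1) = - ((-1) powi r :: complex)"
    by (simp_all add: power_int_add power_int_diff)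
  define a1 a2 a3 a4 x where "a1 = 1 - q\<^sup>2 * y\<^sup>2 / z\<^sup>2" and "a2 = 1 - q^4 * y\<^sup>2 * z\<^sup>2"
    and "a3 = 1 - y\<^sup>2 / z\<^sup>2" and "a4 = 1 - q^2 * y\<^sup>2 * z\<^sup>2" and "x = w / z"
  note a = this
  have w: "w = x * z" using nz' by (simp add: a)
  have "(1 - y^4 * q^4) * (1 - y^4 * q^6) * z\<^sup>2
     = (1 + y^4 * q^4) * z\<^sup>2 * a1 * a2 + y^2 * q^2 * (a2 * a4 + z^4 * q^2 * a1 * a3)"
    using nz' unfolding a by (simp add: divide_simps) algebra
  then have "(-1) powi r * x * inv_poch (n + 1 - r) * inv_poch (n + 1 + r + 1) * ((1 - y^4 * q^4) * (1 - y^4 * q^6) * z\<^sup>2)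
     = (-1) powi r * x * inv_poch (n + 1 - r) * inv_poch (n + 1 + r + 1) *
       ((1 + y^4 * q^4) * z\<^sup>2 * a1 * a2 + y^2 * q^2 * (a2 * a4 + z^4 * q^2 * a1 * a3))"
    by (simp only:)
  then show ?thesis unfolding triple_coeff_def bailey_coeff_def s1 s2 s3 s4 s4' s5 s6 s8 s9 a(1-5)[symmetric] unfolding w
    by algebra
qed

end

subsection \<open>Limits of Bailey sums\<close>

text \<open>The limit must be known to be nonzero because later formulas divide by it; an absolutely
  convergent product without a zero factor has this property.\<close>

lemma qpoch_tendsto:
  fixes a x :: complex
  assumes "norm x < 1" "\<And>k. a * x ^ k \<noteq> 1"
  shows "\<exists>l. l \<noteq> 0 \<and> qpoch a x \<longlonglongrightarrow> l"
proof -
  have "summable (\<lambda>k. norm ((1 - a * x ^ k) - 1))"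
    using assms(1) by (simp add: norm_mult norm_power summable_geometric)
  then have "convergent_prod (\<lambda>k. 1 - a * x ^ k)"
    using abs_convergent_prod_conv_summable abs_convergent_prod_imp_convergent_prod by blast
  then obtain l where "l \<noteq> 0" "(\<lambda>n. \<Prod>k\<le>n. 1 - a * x ^ k) \<longlonglongrightarrow> l"
    using assms(2) by (subst (asm) convergent_prod_iff_nz_lim) auto
  then show ?thesis
    by (intro exI[of _ l]) (auto simp: qpoch_def[abs_def] lessThan_Suc_atMost LIMSEQ_lessThan_iff_atMost)
qed

context nome
begin

lemma triple_coeff_eq_0: "r > n \<or> r < - n - 1 \<Longrightarrow> triple_coeff n r = 0"
  by (auto simp: triple_coeff_def bailey_coeff_def inv_poch_neg)

text \<open>For \<open>\<tau>\<close> = x + 1/x the factor on the right is (1 - x y)(1 - y/x) with y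
  = q^(2n+2): these are the two factors that a triple product gains at step n.\<close>

lemma weighted_step:
  fixes w :: "int \<Rightarrow> complex" and n :: int
  assumes w: "\<And>r. w (r - 1) + w (r + 1) = \<tau> * w r"
  shows "(1 - q powi (4 * n + 4)) * (1 - q powi (4 * n + 6)) * (\<Sum>r=-n-2..n+1. triple_coeff (n + 1) r * w r)
       = (1 + q powi (4 * n + 4) - \<tau> * q powi (2 * n + 2)) * (\<Sum>r=-n-1..n. triple_coeff n r * w r)"
proof -
  let ?N = "{-n-2..n+1}" and ?S = "\<Sum>r=-n-1..n. triple_coeff n r * w r"
  have ext: "sum (\<lambda>r. triple_coeff n r * f r) {-n-1..n} = sum (\<lambda>r. triple_coeff n r * f r) A"
    if "finite A" "{-n-1..n} \<subseteq> A" for A f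
    using that by (intro sum.mono_neutral_left) (auto simp: triple_coeff_eq_0)
  have s1: "(\<Sum>r\<in>?N. triple_coeff n r * w r) = ?S"
    by (rule ext[symmetric]) auto
  have "(\<Sum>r\<in>?N. triple_coeff n (r - 1) * w r) = (\<Sum>r=-n-3..n. triple_coeff n r * w (r + 1))"
    by (rule sum.reindex_bij_witness[of _ "\<lambda>r. r + 1" "\<lambda>r. r - 1"]) auto
  also have "\<dots> = (\<Sum>r=-n-1..n. triple_coeff n r * w (r + 1))" by (rule ext[symmetric]) auto
  finally have s2: "(\<Sum>r\<in>?N. triple_coeff n (r - 1) * w r) = (\<Sum>r=-n-1..n. triple_coeff n r * w (r + 1))" .
  have "(\<Sum>r\<in>?N. triple_coeff n (r + 1) * w r) = (\<Sum>r=-n-1..n+2. triple_coeff n r * w (r - 1))"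
    by (rule sum.reindex_bij_witness[of _ "\<lambda>r. r - 1" "\<lambda>r. r + 1"]) auto
  also have "\<dots> = (\<Sum>r=-n-1..n. triple_coeff n r * w (r - 1))" by (rule ext[symmetric]) auto
  finally have s3: "(\<Sum>r\<in>?N. triple_coeff n (r + 1) * w r) = (\<Sum>r=-n-1..n. triple_coeff n r * w (r - 1))" .
  have "(\<Sum>r=-n-1..n. triple_coeff n r * w (r + 1)) + (\<Sum>r=-n-1..n. triple_coeff n r * w (r - 1)) =
      (\<Sum>r=-n-1..n. triple_coeff n r * (w (r - 1) + w (r + 1)))"
    by (simp add: sum.distrib algebra_simps)
  also have "\<dots> = \<tau> * ?S" unfolding w by (simp add: sum_distrib_left algebra_simps)
  finally have s4: "(\<Sum>r=-n-1..n. triple_coeff n r * w (r + 1)) + (\<Sum>r=-n-1..n. triple_coeff n r * w (r - 1)) = \<tau> * ?S" .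
  have "(1 - q powi (4 * n + 4)) * (1 - q powi (4 * n + 6)) * (\<Sum>r\<in>?N. triple_coeff (n + 1) r * w r) =
      (\<Sum>r\<in>?N. ((1 - q powi (4 * n + 4)) * (1 - q powi (4 * n + 6)) * triple_coeff (n + 1) r) * w r)"
    by (simp add: sum_distrib_left mult.assoc)
  also have "\<dots> = (1 + q powi (4 * n + 4)) * (\<Sum>r\<in>?N. triple_coeff n r * w r) -
      q powi (2 * n + 2) * ((\<Sum>r\<in>?N. triple_coeff n (r - 1) * w r) + (\<Sum>r\<in>?N. triple_coeff n (r + 1) * w r))"
    unfolding triple_coeff_step by (simp add: sum_distrib_left sum.distrib sum_subtractf algebra_simps)
  finally show ?thesis unfolding s1 s2 s3 s4 by (simp add: algebra_simps)
qed

text \<open>The support -n-1..n is symmetric under r -> -1 - r. Antisymmetry therefore turns the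
  two-sided sum into a one-sided one, the form in which Bailey pairs are stated, with the weight
  replaced by w r - w (-1 - r).\<close>

lemma triple_coeff_reflect: "triple_coeff n (- 1 - r) = - triple_coeff n r"
proof -
  have "(- 1 - r) * (- 1 - r) + (- 1 - r) = r * r + r" by (simp add: algebra_simps)
  moreover have "bailey_coeff n (- 1 - r) = bailey_coeff n r" by (simp add: bailey_coeff_def algebra_simps)
  moreover have "(- 1) powi (- 1 - r) = - ((- 1) powi r :: complex)"
    by (simp add: power_int_minus_left)
  ultimately show ?thesis unfolding triple_coeff_def by (simp only: mult_minus_left)
qed

lemma weighted_fold:
  "(\<Sum>r=-int n-1..int n. triple_coeff (int n) r * w r) = (\<Sum>r\<le>n. triple_coeff (int n) (int r) * (w (int r) - w (- 1 - int r)))"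
proof -
  have "{-int n-1..int n} = {-int n-1..-1} \<union> {0..int n}" by auto
  then have "(\<Sum>r=-int n-1..int n. triple_coeff (int n) r * w r) =
    (\<Sum>r=-int n-1..-1. triple_coeff (int n) r * w r) + (\<Sum>r=0..int n. triple_coeff (int n) r * w r)"
    by (simp add: sum.union_disjoint)
  also have "(\<Sum>r=0..int n. triple_coeff (int n) r * w r) = (\<Sum>r\<le>n. triple_coeff (int n) (int r) * w (int r))"
    by (rule sum.reindex_bij_witness[of _ int nat]) auto
  also have "(\<Sum>r=-int n-1..-1. triple_coeff (int n) r * w r) = (\<Sum>r\<le>n. triple_coeff (int n) (- 1 - int r) * w (- 1 - int r))"
    by (rule sum.reindex_bij_witness[of _ "\<lambda>r. - 1 - int r" "\<lambda>r. nat (- 1 - r)"]) auto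
  finally show ?thesis by (simp add: triple_coeff_reflect sum.distrib[symmetric] algebra_simps)
qed

lemma qpoch_qq_step: "qpoch (q\<^sup>2) (q\<^sup>2) (Suc (Suc (Suc (2 * n)))) =
    qpoch (q\<^sup>2) (q\<^sup>2) (Suc (2 * n)) * ((1 - q powi (4 * int n + 4)) * (1 - q powi (4 * int n + 6)))"
proof -
  have 1: "q powi (4 * int n + 4) = q ^ (4 * n + 4)" "q powi (4 * int n + 6) = q ^ (4 * n + 6)"
    by (simp_all add: power_int_def nat_add_distrib nat_mult_distrib)
  have "4 * n + 4 = 2 * Suc (Suc (2 * n))" "4 * n + 6 = 2 * Suc (Suc (Suc (2 * n)))" by simp_all
  moreover have "q\<^sup>2 * (q\<^sup>2) ^ k = q ^ (2 * Suc k)" for k by (simp only: power_mult power_Suc)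
  ultimately have "q\<^sup>2 * (q\<^sup>2) ^ Suc (2 * n) = q ^ (4 * n + 4)" "q\<^sup>2 * (q\<^sup>2) ^ Suc (Suc (2 * n)) = q ^ (4 * n + 6)"
    by (simp_all only:)
  then show ?thesis by (simp only: qpoch_Suc mult.assoc 1)
qed

text \<open>A finite form of the Jacobi triple product: the weights \<open>r\<close>, \<open>q powi (- r)\<close> and \<open>(-1) powi r\<close>
  yield \<open>jac\<close>, \<open>theta4\<close> and \<open>theta2\<close> in the limit.\<close>

lemma weighted_pair:
  fixes w :: "int \<Rightarrow> complex"
  assumes w: "\<And>r. w (r - 1) + w (r + 1) = \<tau> * w r"
    and P0: "P 0 = w 0 - w (- 1)"
    and P: "\<And>n. P (Suc n) = (1 + q powi (4 * int n + 4) - \<tau> * q powi (2 * int n + 2)) * P n"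
  shows "(\<Sum>r\<le>n. triple_coeff (int n) (int r) * (w (int r) - w (- 1 - int r))) = P n / qpoch (q\<^sup>2) (q\<^sup>2) (Suc (2 * n))"
  unfolding weighted_fold[symmetric]
proof (induction n)
  case 0
  have "{-1..0::int} = {-1,0}" by auto
  then show ?case using triple_coeff_reflect[of 0 0]
    by (simp add: P0) (simp add: triple_coeff_def bailey_coeff_def inv_poch_def algebra_simps diff_divide_distrib)
next
  case (Suc n)
  let ?e = "(1 - q powi (4 * int n + 4)) * (1 - q powi (4 * int n + 6))"
  have eq: "{-int (Suc n)-1..int (Suc n)} = {-int n-2..int n+1}" "int (Suc n) = int n + 1" by auto
  have ws: "?e * (\<Sum>r=-int n-2..int n+1. triple_coeff (int n + 1) r * w r) =
      (1 + q powi (4 * int n + 4) - \<tau> * q powi (2 * int n + 2)) * (P n / qpoch (q\<^sup>2) (q\<^sup>2) (Suc (2 * n)))"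
    unfolding weighted_step[of w \<tau> "int n", OF w] Suc.IH ..
  have *: "?e * (\<Sum>r=-int (Suc n)-1..int (Suc n). triple_coeff (int (Suc n)) r * w r) =
     P (Suc n) / qpoch (q\<^sup>2) (q\<^sup>2) (Suc (2 * n))"
    unfolding eq(1) unfolding eq(2) ws P by (rule times_divide_eq_right)
  have key: "b = d / a" if "a * b = d" "a \<noteq> 0" for a b d :: complex
    using that by auto
  have "qpoch (q\<^sup>2) (q\<^sup>2) (Suc (Suc (Suc (2 * n)))) \<noteq> 0" by (rule qpoch_qq_nz)
  then have "?e \<noteq> 0" unfolding qpoch_qq_step by auto
  with * have "(\<Sum>r=-int (Suc n)-1..int (Suc n). triple_coeff (int (Suc n)) r * w r) =
      P (Suc n) / qpoch (q\<^sup>2) (q\<^sup>2) (Suc (2 * n)) / ?e"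
    by (rule key)
  moreover have "Suc (2 * Suc n) = Suc (Suc (Suc (2 * n)))" by simp
  ultimately show ?case unfolding qpoch_qq_step by (simp only: divide_divide_eq_left qpoch_qq_step)
qed

text \<open>As (-q;q)_(2n) = (-q;q^2)_n (-q^2;q^2)_n, this is the summand of Bailey's conjugate pair
  with the two parameters -q and -q^2; the power q^n is the quotient q^4/(q * q^2) to the n.\<close>

definition gauss_term :: "nat \<Rightarrow> nat \<Rightarrow> complex" where
  "gauss_term r n = qpoch (- q) q (2 * n) * q ^ n * bailey_coeff (int n) (int r)"

text \<open>The recurrence in \<open>r\<close> of a q-Gauss sum, with the telescoping certificate on the right.\<close>

lemma gauss_term_telescope:
  "(\<Sum>n<N. (1 + q ^ (2 * r + 3)) * gauss_term (Suc r) n - q * (1 + q ^ (2 * r + 1)) * gauss_term r n) =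
   - (1 - q ^ (2 * r + 2)) * q ^ N * qpoch (- q) q (2 * N) * inv_poch (int N - 1 - int r) * inv_poch (int N + int r + 1)"
proof (induction N)
  case 0
  then show ?case by (simp add: inv_poch_neg)
next
  case (Suc n)
  define y z where "y = q ^ n" and "z = q ^ r"
  have nz': "y \<noteq> 0" "z \<noteq> 0" by (simp_all add: y_def z_def)
  define a b where "a = inv_poch (int n - int r)" and "b = inv_poch (int n + int r + 2)"
  define a1 b1 where "a1 = 1 - y\<^sup>2 / z\<^sup>2" and "b1 = 1 - q^4 * y\<^sup>2 * z\<^sup>2"
  have s1: "inv_poch (int n - 1 - int r) = a * a1" "inv_poch (int n - int (Suc r)) = a * a1"
    using inv_poch_step'[of "int n - int r" "int n - 1 - int r"]
    by (simp_all add: a_def a1_def y_def z_def powi_split power_mult_distrib power_divide algebra_simps)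
  have s2: "inv_poch (int n + int r + 1) = b * b1"
    using inv_poch_step'[of "int n + int r + 2" "int n + int r + 1"]
    by (simp add: b_def b1_def y_def z_def powi_split power_mult_distrib power_divide algebra_simps)
  have s3: "inv_poch (int (Suc n) - 1 - int r) = a" "inv_poch (int (Suc n) + int r + 1) = b"
     "inv_poch (int n + int (Suc r) + 1) = b" "inv_poch (int n - int r) = a"
    by (simp_all add: a_def b_def algebra_simps)
  have zz: "q ^ (2 * r) = z^2" by (simp only: z_def power_mult[symmetric] mult.commute)
  have s4: "q ^ (2 * r + 3) = z^2 * q^3" "q ^ (2 * r + 1) = z^2 * q" "q ^ (2 * r + 2) = z^2 * q^2"
     "q ^ n = y" "q ^ Suc n = y * q"
    by (simp_all add: y_def power_add zz power2_eq_square)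
  define w where "w = qpoch (- q) q (2 * n)"
  have "q ^ Suc (2 * n) = q * y^2" "q * q ^ (2 * n) = q * y^2"
     by (simp_all add: y_def power_mult[symmetric] mult.commute)
  then have s5: "qpoch (- q) q (2 * Suc n) = w * (1 + q * y^2) * (1 + q^2 * y^2)"
    by (simp add: qpoch_Suc w_def power2_eq_square mult.assoc)
  have "(1 + z^2 * q^3) * a1 - q * (1 + z^2 * q) * b1 - (1 - z^2 * q^2) * a1 * b1
     = - (1 - z^2 * q^2) * q * (1 + q * y^2) * (1 + q^2 * y^2)"
    unfolding a1_def b1_def using nz' by (simp add: divide_simps) algebra
  then have "w * y * a * b * ((1 + z^2 * q^3) * a1 - q * (1 + z^2 * q) * b1 - (1 - z^2 * q^2) * a1 * b1)
     = w * y * a * b * (- (1 - z^2 * q^2) * q * (1 + q * y^2) * (1 + q^2 * y^2))"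
    by (simp only:)
  then show ?case
    unfolding sum.lessThan_Suc Suc.IH unfolding gauss_term_def bailey_coeff_def s1 s2 s3 s4 s5 w_def[symmetric]
    by algebra
qed

section \<open>Convergence of Bailey sums as n tends to infinity\<close>

lemma qpoch_qq_tendsto: "\<exists>l. l \<noteq> 0 \<and> qpoch (q\<^sup>2) (q\<^sup>2) \<longlonglongrightarrow> l"
proof (rule qpoch_tendsto)
  show "norm (q\<^sup>2) < 1" using lt by (simp add: norm_power abs_square_less_1)
  show "q\<^sup>2 * (q\<^sup>2) ^ k \<noteq> 1" for k
    using qpoch_qq_nz[of "Suc k"] by (auto simp: qpoch_Suc)
qed

definition euler_limit :: complex where "euler_limit = lim (qpoch (q\<^sup>2) (q\<^sup>2))"

lemma euler_limit: "euler_limit \<noteq> 0" "qpoch (q\<^sup>2) (q\<^sup>2) \<longlonglongrightarrow> euler_limit"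
  using qpoch_qq_tendsto by (auto simp: euler_limit_def limI)

lemma inv_poch_tendsto: "(\<lambda>n. inv_poch (int n)) \<longlonglongrightarrow> 1 / euler_limit"
proof -
  have "(\<lambda>n. 1 / qpoch (q\<^sup>2) (q\<^sup>2) n) \<longlonglongrightarrow> 1 / euler_limit"
    by (intro tendsto_intros euler_limit)
  then show ?thesis by (simp add: inv_poch_def[abs_def])
qed

lemma inv_poch_bounded: "\<exists>M. \<forall>k. norm (inv_poch k) \<le> M"
proof -
  obtain M where M: "\<And>n. norm (inv_poch (int n)) \<le> M"
    using convergent_imp_Bseq[OF convergentI[OF inv_poch_tendsto]] by (auto simp: Bseq_def)
  then have "M \<ge> 0" using norm_ge_zero order_trans by blast
  have "norm (inv_poch k) \<le> M" for k
    using M[of "nat k"] \<open>M \<ge> 0\<close> by (cases "k < 0") (auto simp: inv_poch_neg)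
  then show ?thesis by blast
qed

lemma bailey_coeff_bounded: "\<exists>M. \<forall>n r. norm (bailey_coeff n r) \<le> M"
proof -
  obtain M where "\<forall>k. norm (inv_poch k) \<le> M" using inv_poch_bounded by blast
  then have "norm (bailey_coeff n r) \<le> M * M" for n r
    unfolding bailey_coeff_def norm_mult by (intro mult_mono) (auto intro: order_trans[OF norm_ge_zero])
  then show ?thesis by blast
qed

lemma bailey_coeff_tendsto: "(\<lambda>n. bailey_coeff (int n) (int r)) \<longlonglongrightarrow> 1 / euler_limit\<^sup>2"
proof -
  have "(\<lambda>n. bailey_coeff (int (n + r)) (int r)) \<longlonglongrightarrow> 1 / euler_limit * (1 / euler_limit)"
    unfolding bailey_coeff_def
  proof (intro tendsto_mult)
    show "(\<lambda>n. inv_poch (int (n + r) - int r)) \<longlonglongrightarrow> 1 / euler_limit" using inv_poch_tendsto by simp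
    show "(\<lambda>n. inv_poch (int (n + r) + int r + 1)) \<longlonglongrightarrow> 1 / euler_limit"
      using LIMSEQ_ignore_initial_segment[OF inv_poch_tendsto, of "2 * r + 1"]
      by (simp add: algebra_simps)
  qed
  then have "(\<lambda>n. bailey_coeff (int n) (int r)) \<longlonglongrightarrow> 1 / euler_limit * (1 / euler_limit)" by (rule LIMSEQ_offset)
  then show ?thesis by (simp add: power2_eq_square)
qed

lemma pair_tendsto:
  assumes "summable (\<lambda>r. norm (\<alpha> r))"
  shows "(\<lambda>n. \<Sum>r\<le>n. \<alpha> r * bailey_coeff (int n) (int r)) \<longlonglongrightarrow> suminf \<alpha> / euler_limit\<^sup>2"
proof -
  obtain M where M: "\<And>n r. norm (bailey_coeff n r) \<le> M" using bailey_coeff_bounded by blast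
  have "(\<lambda>n. \<Sum>r. \<alpha> r * bailey_coeff (int n) (int r)) \<longlonglongrightarrow> (\<Sum>r. \<alpha> r * (1 / euler_limit\<^sup>2))"
  proof (rule tannerys_theorem[THEN conjunct2, THEN conjunct2])
    show "(\<lambda>n. \<alpha> r * bailey_coeff (int n) (int r)) \<longlonglongrightarrow> \<alpha> r * (1 / euler_limit\<^sup>2)" for r
      by (intro tendsto_intros bailey_coeff_tendsto)
    show "\<forall>\<^sub>F (k, n) in at_top \<times>\<^sub>F sequentially. norm (\<alpha> k * bailey_coeff (int n) (int k)) \<le> norm (\<alpha> k) * M"
      by (rule always_eventually) (auto simp: norm_mult intro!: mult_left_mono M)
    show "summable (\<lambda>k. norm (\<alpha> k) * M)" using assms by (rule summable_mult2)
  qed simp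
  also have "(\<lambda>n. \<Sum>r. \<alpha> r * bailey_coeff (int n) (int r)) = (\<lambda>n. \<Sum>r\<le>n. \<alpha> r * bailey_coeff (int n) (int r))"
    by (intro ext suminf_finite) (auto simp: bailey_coeff_eq_0)
  also have "(\<Sum>r. \<alpha> r * (1 / euler_limit\<^sup>2)) = suminf \<alpha> * (1 / euler_limit\<^sup>2)"
    using summable_norm_cancel[OF assms] by (rule suminf_mult2[symmetric])
  finally show ?thesis by simp
qed

end

subsection \<open>Sums over the integers\<close>

text \<open>The reflection n -> -1 - n has no fixed point and preserves n^2 + n, so folding along it
  needs no exceptional term at 0.\<close>

lemma int_eq_nat_union: "(UNIV :: int set) = range int \<union> range (\<lambda>n::nat. - 1 - int n)"
proof (intro equalityI subsetI)
  fix x :: int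
  show "x \<in> range int \<union> range (\<lambda>n::nat. - 1 - int n)"
    by (cases "x \<ge> 0") (force intro: image_eqI[of _ _ "nat x"] image_eqI[of _ _ "nat (-1-x)"])+
qed auto

lemma abs_summable_fold_int:
  fixes f :: "int \<Rightarrow> 'a :: banach"
  shows "(\<lambda>n. norm (f n)) summable_on UNIV \<longleftrightarrow>
     (\<lambda>n::nat. norm (f (int n))) summable_on UNIV \<and> (\<lambda>n::nat. norm (f (- 1 - int n))) summable_on UNIV"
proof -
  note U = int_eq_nat_union
  have d: "range int \<inter> range (\<lambda>n::nat. - 1 - int n) = {}" by auto
  have i: "inj int" "inj (\<lambda>n::nat. - 1 - int n)" by (auto simp: inj_on_def)
  let ?g = "\<lambda>n. norm (f n)"
  have "?g summable_on UNIV \<longleftrightarrow> ?g summable_on range int \<and> ?g summable_on range (\<lambda>n::nat. - 1 - int n)"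
    using summable_on_Un_disjoint[OF _ _ d, of ?g] summable_on_subset_banach[of ?g UNIV]
    unfolding U[symmetric] by blast
  then show ?thesis by (simp add: summable_on_reindex i o_def)
qed

lemma infsum_fold_int:
  fixes f :: "int \<Rightarrow> 'a :: banach"
  assumes "(\<lambda>n. norm (f n)) summable_on UNIV"
  shows "infsum f UNIV = (\<Sum>\<^sub>\<infinity>n::nat. f (int n) + f (- 1 - int n))"
    "(\<lambda>n::nat. norm (f (int n) + f (- 1 - int n))) summable_on UNIV"
proof -
  note U = int_eq_nat_union
  have d: "range int \<inter> range (\<lambda>n::nat. - 1 - int n) = {}" by auto
  have f: "f summable_on UNIV" by (rule abs_summable_summable[OF assms])
  have i: "inj int" "inj (\<lambda>n::nat. - 1 - int n)" by (auto simp: inj_on_def)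
  have s: "f summable_on range int" "f summable_on range (\<lambda>n::nat. - 1 - int n)"
    by (rule summable_on_subset_banach[OF f]; simp)+
  have s': "(\<lambda>n. f (int n)) summable_on UNIV" "(\<lambda>n::nat. f (- 1 - int n)) summable_on UNIV"
    using s by (simp_all add: summable_on_reindex i o_def)
  have "infsum f UNIV = infsum f (range int) + infsum f (range (\<lambda>n::nat. - 1 - int n))"
    by (subst (1) U, rule infsum_Un_disjoint[OF s d])
  also have "\<dots> = (\<Sum>\<^sub>\<infinity>n. f (int n)) + (\<Sum>\<^sub>\<infinity>n::nat. f (- 1 - int n))"
    by (simp add: infsum_reindex i o_def)
  also have "\<dots> = (\<Sum>\<^sub>\<infinity>n::nat. f (int n) + f (- 1 - int n))"
    by (rule infsum_add[OF s', symmetric])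
  finally show "infsum f UNIV = (\<Sum>\<^sub>\<infinity>n::nat. f (int n) + f (- 1 - int n))" .
  have "(\<lambda>n::nat. norm (f (int n)) + norm (f (- 1 - int n))) summable_on UNIV"
    using assms unfolding abs_summable_fold_int by (auto intro: summable_on_add)
  then show "(\<lambda>n::nat. norm (f (int n) + f (- 1 - int n))) summable_on UNIV"
    by (rule Infinite_Sum.abs_summable_on_comparison_test') (rule norm_triangle_ineq)
qed

text \<open>Bounds Gaussian terms with an arbitrary linear part by geometric ones. With m = |n| and
  k' = |k| + 1 the claim follows from m^2 - k' m + k'^2 >= 0.\<close>

lemma quadratic_ge: "n * n + k * n \<ge> \<bar>n\<bar> - (\<bar>k\<bar> + 1)\<^sup>2" for n k :: int
proof -
  define m k' where "m = \<bar>n\<bar>" and "k' = \<bar>k\<bar> + 1"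
  have 0: "m \<ge> 0" "k' \<ge> 1" "n * n = m * m" by (auto simp: m_def k'_def abs_mult[symmetric])
  have 1: "k * n \<ge> - (\<bar>k\<bar> * m)"
    by (metis abs_ge_minus_self abs_mult m_def minus_le_iff)
  have "m * m + k' * k' \<ge> k' * m"
  proof (cases "m \<ge> k'")
    case True
    then have "k' * m \<le> m * m" using 0 by (intro mult_right_mono) auto
    then show ?thesis using 0 by (simp add: add_increasing2)
  next
    case False
    then have "k' * m \<le> k' * k'" using 0 by (intro mult_left_mono) auto
    then show ?thesis using 0 by (simp add: add_increasing)
  qed
  then have "m * m - \<bar>k\<bar> * m \<ge> m - k' * k'" by (simp add: k'_def algebra_simps)
  then have "m - k' * k' \<le> n * n + k * n" using 0(3) 1 by linarith
  then show ?thesis by (simp only: m_def k'_def power2_eq_square)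
qed

lemma summable_on_nat: "(f :: nat \<Rightarrow> real) summable_on UNIV" if "summable f" "\<And>n. f n \<ge> 0"
  using that by (simp add: summable_on_UNIV_nonneg_real_iff)

lemma summable_powi_abs:
  fixes r :: real
  assumes "0 < r" "r < 1"
  shows "(\<lambda>n::int. r powi \<bar>n\<bar>) summable_on UNIV"
proof -
  have "(\<lambda>n::int. norm (r powi \<bar>n\<bar>)) summable_on UNIV"
    unfolding abs_summable_fold_int
  proof (intro conjI)
    show "(\<lambda>n::nat. norm (r powi \<bar>int n\<bar>)) summable_on UNIV"
      using assms by (intro summable_on_nat) (auto simp: norm_power)
    have "r powi \<bar>- 1 - int n\<bar> = r * r ^ n" for n
      by (simp add: power_int_def nat_add_distrib)
    then show "(\<lambda>n::nat. norm (r powi \<bar>- 1 - int n\<bar>)) summable_on UNIV"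
      using assms by (intro summable_on_nat) (simp_all add: norm_power norm_mult del: of_nat_Suc)
  qed
  then show ?thesis using assms by simp
qed

lemma summable_powi_quadratic:
  fixes r :: real
  assumes "0 < r" "r < 1"
  shows "(\<lambda>n::int. r powi (n * n + k * n)) summable_on UNIV"
proof -
  have "(\<lambda>n::int. norm (r powi (n * n + k * n))) summable_on UNIV"
  proof (rule Infinite_Sum.abs_summable_on_comparison_test')
    show "(\<lambda>n::int. r powi (- ((\<bar>k\<bar> + 1)\<^sup>2)) * r powi \<bar>n\<bar>) summable_on UNIV"
      by (intro summable_on_cmult_right summable_powi_abs assms)
    fix n :: int
    have "r powi (n * n + k * n) \<le> r powi (\<bar>n\<bar> - (\<bar>k\<bar> + 1)\<^sup>2)"
      using assms by (intro power_int_decreasing quadratic_ge) auto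
    also have "\<dots> = r powi (- ((\<bar>k\<bar> + 1)\<^sup>2)) * r powi \<bar>n\<bar>"
      using assms by (simp add: power_int_diff power_int_minus divide_inverse)
    finally show "norm (r powi (n * n + k * n)) \<le> r powi (- ((\<bar>k\<bar> + 1)\<^sup>2)) * r powi \<bar>n\<bar>"
      using assms by simp
  qed
  then show ?thesis using assms by simp
qed

lemma abs_summable_times:
  fixes f :: "'a \<Rightarrow> complex" and g :: "'b \<Rightarrow> complex"
  assumes "(\<lambda>x. norm (f x)) summable_on A" "(\<lambda>x. norm (g x)) summable_on B"
  shows "(\<lambda>(x,y). norm (f x * g y)) summable_on A \<times> B"
proof (rule summable_on_SigmaI)
  show "((\<lambda>y. case (x, y) of (x, y) \<Rightarrow> norm (f x * g y)) has_sum norm (f x) * infsum (\<lambda>y. norm (g y)) B) B" for x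
    using assms(2) by (auto simp: norm_mult intro: has_sum_cmult_right)
  show "(\<lambda>x. norm (f x) * infsum (\<lambda>y. norm (g y)) B) summable_on A"
    using assms(1) by (rule summable_on_cmult_left)
qed auto

lemma convolution_int:
  fixes f g :: "int \<Rightarrow> complex"
  assumes f: "(\<lambda>x. norm (f x)) summable_on UNIV" and g: "(\<lambda>x. norm (g x)) summable_on UNIV"
  shows "(\<Sum>\<^sub>\<infinity>m. \<Sum>\<^sub>\<infinity>n. f n * g (m - n)) = infsum f UNIV * infsum g UNIV"
proof -
  let ?h = "\<lambda>(n,l). f n * g l"
  have h: "(\<lambda>p. norm (?h p)) summable_on UNIV \<times> UNIV"
    using abs_summable_times[OF assms] by (simp add: case_prod_unfold)
  then have h': "?h summable_on UNIV \<times> UNIV" by (rule abs_summable_summable)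
  have "infsum f UNIV * infsum g UNIV = (\<Sum>\<^sub>\<infinity>n. f n * infsum g UNIV)"
    by (rule infsum_cmult_left'[symmetric])
  also have "\<dots> = (\<Sum>\<^sub>\<infinity>n. \<Sum>\<^sub>\<infinity>l. f n * g l)"
    by (simp add: infsum_cmult_right')
  also have "\<dots> = infsum ?h (UNIV \<times> UNIV)"
    by (rule infsum_Sigma'_banach[OF h'])
  also have "\<dots> = infsum (\<lambda>(m,n). f n * g (m - n)) (UNIV \<times> UNIV)"
    by (rule infsum_reindex_bij_witness[of _ "\<lambda>(m,n). (n, m - n)" "\<lambda>(n,l). (n + l, n)"]) auto
  also have "\<dots> = (\<Sum>\<^sub>\<infinity>m. \<Sum>\<^sub>\<infinity>n. f n * g (m - n))"
  proof (rule infsum_Sigma'_banach[symmetric])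
    have "?h summable_on UNIV \<times> UNIV \<longleftrightarrow> (\<lambda>(m,n). f n * g (m - n)) summable_on UNIV \<times> UNIV"
      by (rule summable_on_reindex_bij_witness[of _ "\<lambda>(m,n). (n, m - n)" "\<lambda>(n,l). (n + l, n)"]) auto
    then show "(\<lambda>(m,n). f n * g (m - n)) summable_on UNIV \<times> UNIV" using h' by simp
  qed
  finally show ?thesis by simp
qed

section \<open>Theta constants and Gaussian sums with bounded coefficients\<close>

definition theta2 :: "complex \<Rightarrow> complex" where
  "theta2 q = (\<Sum>\<^sub>\<infinity>n::int. q powi (n * n + n))"
definition theta3 :: "complex \<Rightarrow> complex" where
  "theta3 q = (\<Sum>\<^sub>\<infinity>n::int. q powi (n * n))"
definition theta4 :: "complex \<Rightarrow> complex" where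
  "theta4 q = (\<Sum>\<^sub>\<infinity>n::int. (-1) powi n * q powi (n * n))"

context nome
begin

lemma summable_gauss:
  assumes "\<And>n. norm (b n) \<le> M"
  shows "(\<lambda>n::int. norm (b n * q powi (n * n + k * n))) summable_on UNIV"
proof (rule Infinite_Sum.abs_summable_on_comparison_test')
  show "(\<lambda>n. M * (norm q powi (n * n + k * n))) summable_on UNIV"
    using lt by (intro summable_on_cmult_right summable_powi_quadratic) auto
  show "norm (b n * q powi (n * n + k * n)) \<le> M * norm q powi (n * n + k * n)" for n
    using assms by (auto simp: norm_mult norm_power_int intro!: mult_right_mono)
qed

text \<open>One bound serves all n: for negative n the subtracted term has modulus at least 1/|q|,
  and 1/|q| - 1 >= 1 - |q|. The reciprocals can then be used as bounded coefficients in
  \<open>summable_gauss\<close>.\<close>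

lemma norm_odd: "norm (1 / (1 - s * q powi (2 * n + 1))) \<le> 1 / (1 - norm q)" if "norm s = 1"
proof -
  have "1 - norm q \<le> norm (1 - s * q powi (2 * n + 1))"
  proof (cases "n \<ge> 0")
    case True
    have "norm (s * q powi (2 * n + 1)) \<le> norm q powi 1"
      unfolding norm_mult that norm_power_int using lt True by (simp, intro power_int_decreasing[of 1, simplified]) auto
    then show ?thesis using norm_triangle_ineq2[of 1 "s * q powi (2 * n + 1)"] by simp
  next
    case False
    have "norm q powi (-1) \<le> norm q powi (2 * n + 1)"
      using lt False by (intro power_int_decreasing) auto
    moreover have "norm (s * q powi (2 * n + 1)) = norm q powi (2 * n + 1)"
      by (simp add: norm_mult that norm_power_int)
    moreover have "2 - norm q \<le> norm q powi (-1)"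
    proof -
      have "0 \<le> (1 - norm q)\<^sup>2" by simp
      then show ?thesis by (simp add: power_int_minus field_simps power2_eq_square)
    qed
    ultimately show ?thesis using norm_triangle_ineq2[of "s * q powi (2 * n + 1)" 1]
      by (simp add: norm_minus_commute)
  qed
  moreover have "1 - norm q > 0" using lt by simp
  ultimately show ?thesis by (simp add: norm_divide frac_le)
qed

end

subsection \<open>The Appell sum\<close>

context nome
begin

lemma minus_nome: "nome (- q)"
  by standard (use lt in auto)

definition phi_weight :: "nat \<Rightarrow> complex" where
  "phi_weight n = qpoch (- q) q (2 * n) * q ^ n"

lemma gauss_term_eq: "gauss_term r n = phi_weight n * bailey_coeff (int n) (int r)"
  by (simp add: gauss_term_def phi_weight_def)

lemma qpoch_neg_bounded: "\<exists>M. \<forall>n. norm (qpoch (- q) q n) \<le> M"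
proof -
  have "- q * q ^ k \<noteq> 1" for k
  proof
    assume *: "- q * q ^ k = 1"
    have "q ^ Suc k = - (- q * q ^ k)" by simp
    then show False unfolding * using pow_neq_minus_1[of "Suc k"] by simp
  qed
  then obtain l where "qpoch (- q) q \<longlonglongrightarrow> l"
    using qpoch_tendsto[of q "- q"] lt by blast
  then have "Bseq (qpoch (- q) q)" by (rule convergent_imp_Bseq[OF convergentI])
  then show ?thesis by (auto simp: Bseq_def)
qed

lemma phi_weight_summable: "(\<lambda>n. norm (phi_weight n)) summable_on UNIV"
proof -
  obtain M where M: "\<And>n. norm (qpoch (- q) q n) \<le> M" using qpoch_neg_bounded by blast
  show ?thesis
  proof (rule Infinite_Sum.abs_summable_on_comparison_test')
    show "(\<lambda>n. M * norm q ^ n) summable_on UNIV"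
      using lt by (intro summable_on_cmult_right summable_on_nat) auto
    show "norm (phi_weight n) \<le> M * norm q ^ n" for n
      using M by (auto simp: phi_weight_def norm_mult norm_power intro!: mult_right_mono)
  qed
qed

lemma gauss_term_summable: "(\<lambda>n. norm (gauss_term r n)) summable_on UNIV"
proof -
  obtain M where M: "\<And>n r. norm (bailey_coeff n r) \<le> M" using bailey_coeff_bounded by blast
  show ?thesis
  proof (rule Infinite_Sum.abs_summable_on_comparison_test')
    show "(\<lambda>n. norm (phi_weight n) * M) summable_on UNIV"
      by (intro summable_on_cmult_left phi_weight_summable)
    show "norm (gauss_term r n) \<le> norm (phi_weight n) * M" for n
      using M by (auto simp: gauss_term_eq norm_mult intro!: mult_left_mono)
  qed
qed

definition bailey_gamma :: "nat \<Rightarrow> complex" where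
  "bailey_gamma r = (\<Sum>\<^sub>\<infinity>n. gauss_term r n)"

lemma gauss_term_sums: "gauss_term r sums bailey_gamma r"
  unfolding bailey_gamma_def by (rule has_sum_imp_sums[OF has_sum_infsum[OF abs_summable_summable[OF gauss_term_summable]]])

lemma bailey_gamma_step: "(1 + q ^ (2 * r + 3)) * bailey_gamma (Suc r) = q * (1 + q ^ (2 * r + 1)) * bailey_gamma r"
proof -
  let ?f = "\<lambda>n. (1 + q ^ (2 * r + 3)) * gauss_term (Suc r) n - q * (1 + q ^ (2 * r + 1)) * gauss_term r n"
  have "?f sums ((1 + q ^ (2 * r + 3)) * bailey_gamma (Suc r) - q * (1 + q ^ (2 * r + 1)) * bailey_gamma r)"
    by (intro sums_diff sums_mult gauss_term_sums)
  then have 1: "(\<lambda>N. \<Sum>n<N. ?f n) \<longlonglongrightarrow> (1 + q ^ (2 * r + 3)) * bailey_gamma (Suc r) - q * (1 + q ^ (2 * r + 1)) * bailey_gamma r"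
    by (simp add: sums_def)
  obtain M where M: "\<And>k. norm (inv_poch k) \<le> M" using inv_poch_bounded by blast
  have "M \<ge> 0" by (rule order_trans[OF norm_ge_zero M[of 0]])
  have wz: "(\<lambda>N. norm (phi_weight N)) \<longlonglongrightarrow> 0"
    using phi_weight_summable summable_on_imp_summable summable_LIMSEQ_zero by blast
  \<comment> \<open>The boundary term of the certificate contains \<open>phi_weight N\<close>, which
    tends to 0, while its \<open>inv_poch\<close> factors stay bounded.\<close>
  have "(\<lambda>N. \<Sum>n<N. ?f n) \<longlonglongrightarrow> 0"
  proof (rule Lim_null_comparison)
    show "(\<lambda>N. norm (phi_weight N) * (norm (1 - q ^ (2 * r + 2)) * M * M)) \<longlonglongrightarrow> 0"
      by (intro tendsto_mult_left_zero wz)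
    have "(\<Sum>n<N. ?f n) = - (phi_weight N * ((1 - q ^ (2 * r + 2)) * inv_poch (int N - 1 - int r) * inv_poch (int N + int r + 1)))" for N
      unfolding gauss_term_telescope phi_weight_def by algebra
    then have "norm (\<Sum>n<N. ?f n) = norm (phi_weight N) * (norm (1 - q ^ (2 * r + 2)) * norm (inv_poch (int N - 1 - int r)) * norm (inv_poch (int N + int r + 1)))" for N
      by (simp only: norm_minus_cancel norm_mult)
    also have "\<dots> N \<le> norm (phi_weight N) * (norm (1 - q ^ (2 * r + 2)) * M * M)" for N
      by (intro mult_left_mono mult_mono M) (use \<open>M \<ge> 0\<close> in auto)
    finally show "\<forall>\<^sub>F N in sequentially. norm (\<Sum>n<N. ?f n) \<le> norm (phi_weight N) * (norm (1 - q ^ (2 * r + 2)) * M * M)"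
      by (intro always_eventually) blast
  qed
  with 1 have "(1 + q ^ (2 * r + 3)) * bailey_gamma (Suc r) - q * (1 + q ^ (2 * r + 1)) * bailey_gamma r = 0"
    by (rule LIMSEQ_unique)
  then show ?thesis by simp
qed

lemma one_plus_nz: "1 + q ^ Suc n \<noteq> 0"
  using pow_neq_minus_1[of "Suc n"] by (metis add.commute add_eq_0_iff zero_less_Suc)

lemma bailey_gamma_eq: "bailey_gamma r = (1 + q) * bailey_gamma 0 * (q ^ r / (1 + q ^ (2 * r + 1)))"
proof (induction r)
  case 0
  then show ?case using one_plus_nz[of 0] by simp
next
  case (Suc r)
  have nz: "1 + q ^ (2 * r + 3) \<noteq> 0" "1 + q ^ (2 * r + 1) \<noteq> 0"
    using one_plus_nz[of "2 * r + 2"] one_plus_nz[of "2 * r"] by (simp_all add: numeral_3_eq_3)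
  have "bailey_gamma (Suc r) = q * (1 + q ^ (2 * r + 1)) * bailey_gamma r / (1 + q ^ (2 * r + 3))"
    using bailey_gamma_step[of r] nz by (simp add: field_simps)
  also have "\<dots> = q * ((1 + q) * bailey_gamma 0 * q ^ r) / (1 + q ^ (2 * r + 3))"
    unfolding Suc.IH using nz by simp
  also have "2 * r + 3 = 2 * Suc r + 1" by simp
  finally show ?case by (simp add: mult_ac)
qed

text \<open>The common factor \<open>(1 + q) * bailey_gamma 0\<close> never has to be evaluated: the unit pair shows below that
  it is the inverse of \<open>theta4\<close>.\<close>

lemma pair_transform:
  assumes "(\<lambda>r. norm (\<alpha> r)) summable_on UNIV"
    and \<beta>: "\<And>n. (\<Sum>r\<le>n. \<alpha> r * bailey_coeff (int n) (int r)) = \<beta> n"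
  shows "((\<lambda>n. phi_weight n * \<beta> n) has_sum (1 + q) * bailey_gamma 0 * (\<Sum>\<^sub>\<infinity>r. \<alpha> r * q ^ r / (1 + q ^ (2 * r + 1)))) UNIV"
proof -
  let ?h = "\<lambda>(n,r). phi_weight n * \<alpha> r * bailey_coeff (int n) (int r)"
  obtain M where M: "\<And>n r. norm (bailey_coeff n r) \<le> M" using bailey_coeff_bounded by blast
  have "(\<lambda>p. norm (?h p)) summable_on UNIV \<times> UNIV"
  proof (rule Infinite_Sum.abs_summable_on_comparison_test')
    have "(\<lambda>(n,r). norm (phi_weight n * \<alpha> r) * M) summable_on UNIV \<times> UNIV"
      using summable_on_cmult_left[OF abs_summable_times[OF phi_weight_summable assms(1)], of M]
      by (simp add: case_prod_unfold)
    then show "(\<lambda>(n,r). norm (phi_weight n * \<alpha> r) * M) summable_on UNIV \<times> UNIV" .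
    show "norm (?h p) \<le> (\<lambda>(n,r). norm (phi_weight n * \<alpha> r) * M) p" for p
      by (cases p) (auto simp: norm_mult intro!: mult_left_mono M)
  qed
  then have h: "?h summable_on UNIV \<times> UNIV" by (rule abs_summable_summable)
  have inner: "(\<Sum>\<^sub>\<infinity>r. ?h (n, r)) = phi_weight n * \<beta> n" for n
  proof -
    have "(\<Sum>\<^sub>\<infinity>r. ?h (n, r)) = (\<Sum>\<^sub>\<infinity>r\<in>{..n}. ?h (n, r))"
      by (rule infsum_cong_neutral) (auto simp: bailey_coeff_eq_0)
    also have "\<dots> = phi_weight n * (\<Sum>r\<le>n. \<alpha> r * bailey_coeff (int n) (int r))"
      by (simp add: sum_distrib_left mult.assoc)
    finally show ?thesis by (simp add: \<beta>)
  qed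
  have outer: "(\<Sum>\<^sub>\<infinity>n. ?h (n, r)) = \<alpha> r * bailey_gamma r" for r
  proof -
    have "(\<Sum>\<^sub>\<infinity>n. ?h (n, r)) = (\<Sum>\<^sub>\<infinity>n. \<alpha> r * gauss_term r n)"
      by (simp add: gauss_term_eq mult_ac)
    then show ?thesis by (simp add: bailey_gamma_def infsum_cmult_right')
  qed
  have "(\<lambda>n. \<Sum>\<^sub>\<infinity>r. ?h (n, r)) summable_on UNIV"
    using summable_on_Sigma_banach[of "\<lambda>n r. ?h (n, r)" UNIV "\<lambda>_. UNIV"] h by simp
  then have "((\<lambda>n. phi_weight n * \<beta> n) has_sum (\<Sum>\<^sub>\<infinity>n. \<Sum>\<^sub>\<infinity>r. ?h (n, r))) UNIV"
    unfolding inner by (rule has_sum_infsum)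
  also have "(\<Sum>\<^sub>\<infinity>n. \<Sum>\<^sub>\<infinity>r. ?h (n, r)) = (\<Sum>\<^sub>\<infinity>r. \<Sum>\<^sub>\<infinity>n. ?h (n, r))"
    using infsum_swap_banach[of "\<lambda>n r. ?h (n, r)" UNIV UNIV] h by simp
  also have "\<dots> = (\<Sum>\<^sub>\<infinity>r. ((1 + q) * bailey_gamma 0) * (\<alpha> r * q ^ r / (1 + q ^ (2 * r + 1))))"
    unfolding outer by (subst bailey_gamma_eq) (simp add: mult_ac)
  also have "\<dots> = (1 + q) * bailey_gamma 0 * (\<Sum>\<^sub>\<infinity>r. \<alpha> r * q ^ r / (1 + q ^ (2 * r + 1)))"
    by (rule infsum_cmult_right')
  finally show ?thesis .
qed

lemma summable_gauss_nat:
  assumes "\<And>n. norm (b n) \<le> M"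
  shows "(\<lambda>n::nat. norm (b (int n) * q powi (int n * int n + k * int n))) summable_on UNIV"
  using summable_gauss[of b M k] assms unfolding abs_summable_fold_int by blast

lemma norm_minus_one_powi [simp]: "norm ((- 1 :: complex) powi k) = 1"
  by (simp add: norm_power_int)

lemma unit_alpha_summable: "(\<lambda>r. norm (unit_alpha (int r))) summable_on UNIV"
proof -
  have "(\<lambda>r. norm (((- 1) powi r) * q powi (r * r + (-1) * r) - (- 1) powi r * q ^ 2 * q powi (r * r + 3 * r))) summable_on UNIV"
  proof (rule Infinite_Sum.abs_summable_on_comparison_test')
    show "(\<lambda>r. norm (((- 1) powi r) * q powi (r * r + (-1) * r)) + norm ((- 1) powi r * q ^ 2 * q powi (r * r + 3 * r))) summable_on UNIV"
      by (intro summable_on_add summable_gauss[of _ 1] summable_gauss[of _ "norm q ^ 2"]) (auto simp: norm_mult norm_power)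
  qed (rule norm_triangle_ineq4)
  moreover have "((- 1) powi r) * q powi (r * r + (-1) * r) - (- 1) powi r * q ^ 2 * q powi (r * r + 3 * r) = unit_alpha r" for r
  proof -
    have "r * r + 3 * r = (r * r - r) + 4 * r" by simp
    then have "q powi (r * r + 3 * r) = q powi (r * r - r) * q powi (4 * r)"
      by (simp only: powi_split)
    then show ?thesis unfolding unit_alpha_def by (simp add: powi_split(1,4) algebra_simps)
  qed
  ultimately have "(\<lambda>r. norm (unit_alpha r)) summable_on UNIV" by (simp only:)
  then show ?thesis unfolding abs_summable_fold_int by blast
qed

lemma lambert_alpha_summable: "(\<lambda>r. norm (lambert_alpha (int r))) summable_on UNIV"
proof -
  have "norm ((- 1) powi int n * (1 + q powi (2 * int n + 1)) * (1 / (1 - 1 * q powi (2 * int n + 1)))) \<le> 2 * (1 / (1 - norm q))" for n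
    unfolding norm_mult
  proof (intro mult_mono norm_odd)
    have e: "q powi (2 * int n + 1) = q ^ Suc (2 * n)"
      by (simp add: power_int_def nat_add_distrib nat_mult_distrib)
    have "norm (1 + q ^ Suc (2 * n)) \<le> 1 + norm (q ^ Suc (2 * n))"
      using norm_triangle_ineq[of 1 "q ^ Suc (2 * n)"] by simp
    also have "1 + norm (q ^ Suc (2 * n)) \<le> 2" using norm_pow_lt[of "2 * n"] by simp
    finally show "norm ((- 1 :: complex) powi int n) * norm (1 + q powi (2 * int n + 1)) \<le> 2"
      by (simp only: norm_minus_one_powi mult_1_left e)
  qed auto
  then have "norm ((- 1) powi int (nat n) * (1 + q powi (2 * int (nat n) + 1)) * (1 / (1 - 1 * q powi (2 * int (nat n) + 1)))) \<le> 2 * (1 / (1 - norm q))" for n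
    by blast
  from summable_gauss_nat[of "\<lambda>n. (- 1) powi int (nat n) * (1 + q powi (2 * int (nat n) + 1)) * (1 / (1 - 1 * q powi (2 * int (nat n) + 1)))", OF this, of 1] show ?thesis
    by (simp add: lambert_alpha_def mult_ac)
qed


lemma odd_powi: "q powi (2 * int r + 1) = q ^ (2 * r + 1)"
  by (simp add: power_int_def nat_add_distrib nat_mult_distrib)

lemma one_plus_odd_nz: "1 + q ^ (2 * r + 1) \<noteq> 0"
  using one_plus_nz[of "2 * r"] by simp

lemma theta4_fold:
  "theta4 q = (\<Sum>\<^sub>\<infinity>r::nat. (-1) ^ r * q ^ (r * r) * (1 - q ^ (2 * r + 1)))"
  "(\<lambda>r::nat. norm ((-1) ^ r * q ^ (r * r) * (1 - q ^ (2 * r + 1)))) summable_on UNIV"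
proof -
  have s: "(\<lambda>n::int. norm ((-1) powi n * q powi (n * n))) summable_on UNIV"
    using summable_gauss[of "\<lambda>n. (-1) powi n" 1 0] by simp
  have "(-1) powi (int r) * q powi (int r * int r) + (-1) powi (- 1 - int r) * q powi ((- 1 - int r) * (- 1 - int r))
      = (-1) ^ r * q ^ (r * r) * (1 - q ^ (2 * r + 1))" for r
  proof -
    have 1: "(- 1 - int r) * (- 1 - int r) = int r * int r + (2 * int r + 1)" by (simp add: algebra_simps)
    have 2: "(-1 :: complex) powi (- 1 - int r) = - ((-1) ^ r)" by (simp add: power_int_minus_left)
    have 3: "q powi (int r * int r) = q ^ (r * r)" by (simp flip: of_nat_mult)
    have 4: "q powi (int r * int r + (2 * int r + 1)) = q ^ (r * r) * q ^ (2 * r + 1)"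
      by (simp only: powi_split(1) odd_powi[unfolded powi_split(1)] 3)
    show ?thesis unfolding 1 2 4 3 by (simp add: algebra_simps)
  qed
  then show "theta4 q = (\<Sum>\<^sub>\<infinity>r::nat. (-1) ^ r * q ^ (r * r) * (1 - q ^ (2 * r + 1)))"
    "(\<lambda>r::nat. norm ((-1) ^ r * q ^ (r * r) * (1 - q ^ (2 * r + 1)))) summable_on UNIV"
    using infsum_fold_int[OF s] unfolding theta4_def by (simp_all only:)
qed

text \<open>The factor 1 - q^(4r+2) of the unit pair splits and cancels the denominator produced by
  \<open>bailey_gamma\<close>. What is left is the folded term of \<open>theta4\<close>, which is
  how \<open>theta4\<close> enters.\<close>

lemma unit_alpha_gam: "unit_alpha (int r) * q ^ r / (1 + q ^ (2 * r + 1)) = (-1) ^ r * q ^ (r * r) * (1 - q ^ (2 * r + 1))"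
proof -
  have "4 * int r + 2 = 2 * (2 * int r + 1)" by simp
  then have 1: "q powi (4 * int r + 2) = (q ^ (2 * r + 1))\<^sup>2"
    unfolding odd_powi[symmetric] by (simp only: powi_split(3))
  have 2: "q powi (int r * int r - int r) = q ^ (r * r) / q ^ r"
    by (simp only: powi_split(2) of_nat_mult[symmetric] power_int_of_nat)
  have 3: "1 - (q ^ (2 * r + 1))\<^sup>2 = (1 - q ^ (2 * r + 1)) * (1 + q ^ (2 * r + 1))"
    by algebra
  show ?thesis unfolding unit_alpha_def 1 2 3 power_int_of_nat using one_plus_odd_nz[of r] by (simp only: divide_simps) simp
qed

lemma bailey_gamma_theta4: "(1 + q) * bailey_gamma 0 * theta4 q = 1"
proof -
  have "((\<lambda>n. phi_weight n * (if n = 0 then 1 else 0)) has_sum (1 + q) * bailey_gamma 0 *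
        (\<Sum>\<^sub>\<infinity>r. unit_alpha (int r) * q ^ r / (1 + q ^ (2 * r + 1)))) UNIV"
    by (rule pair_transform[OF unit_alpha_summable unit_pair])
  moreover have "((\<lambda>n. phi_weight n * (if n = 0 then 1 else 0)) has_sum 1) UNIV"
    by (rule has_sum_finite_neutralI[of "{0}"]) (auto simp: phi_weight_def)
  ultimately show ?thesis unfolding unit_alpha_gam theta4_fold(1)[symmetric] using has_sum_unique by blast
qed

lemma theta4_nz: "theta4 q \<noteq> 0"
  using bailey_gamma_theta4 by auto

definition appell_sum :: complex where
  "appell_sum = (\<Sum>\<^sub>\<infinity>r::nat. (-1) ^ r * q ^ ((r + 1)\<^sup>2) / (1 - q ^ (2 * r + 1)))"

lemma phi_theta4: "phi q * theta4 q = appell_sum"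
proof -
  have *: "((\<lambda>n. phi_weight n * (1 / (qpoch q (q\<^sup>2) (Suc n))\<^sup>2)) has_sum (1 + q) * bailey_gamma 0 *
        (\<Sum>\<^sub>\<infinity>r. lambert_alpha (int r) * q ^ r / (1 + q ^ (2 * r + 1)))) UNIV"
    by (rule pair_transform[OF lambert_alpha_summable lambert_alpha_pair])
  \<comment> \<open>The numerator 1 + q^(2r+1) of \<open>lambert_alpha\<close> cancels the
    denominator contributed by \<open>bailey_gamma\<close>; only 1 - q^(2r+1) remains below.\<close>
  have u: "q * (lambert_alpha (int r) * q ^ r / (1 + q ^ (2 * r + 1))) = (-1) ^ r * q ^ ((r + 1)\<^sup>2) / (1 - q ^ (2 * r + 1))" for r
  proof -
    have 1: "q powi (int r * int r + int r) = q ^ (r * r + r)"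
      by (simp only: of_nat_mult[symmetric] of_nat_add[symmetric] power_int_of_nat)
    have 2: "(r + 1)\<^sup>2 = r * r + r + r + 1" by (simp add: power2_eq_square)
    have 3: "q ^ ((r + 1)\<^sup>2) = q * (q ^ (r * r + r) * q ^ r)" unfolding 2 by (simp add: power_add)
    show ?thesis unfolding lambert_alpha_def odd_powi 1 3 power_int_of_nat
      using one_plus_odd_nz[of r] by simp
  qed
  have qT: "q * (\<Sum>\<^sub>\<infinity>r. lambert_alpha (int r) * q ^ r / (1 + q ^ (2 * r + 1))) = appell_sum"
    unfolding appell_sum_def u[symmetric] by (rule infsum_cmult_right'[symmetric])
  have appell_sum: "q * ((1 + q) * bailey_gamma 0 * (\<Sum>\<^sub>\<infinity>r. lambert_alpha (int r) * q ^ r / (1 + q ^ (2 * r + 1)))) = (1 + q) * bailey_gamma 0 * appell_sum"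
    unfolding qT[symmetric] by (rule mult.left_commute)
  have "((\<lambda>n. q * (phi_weight n * (1 / (qpoch q (q\<^sup>2) (Suc n))\<^sup>2))) has_sum (1 + q) * bailey_gamma 0 * appell_sum) UNIV"
    using has_sum_cmult_right[OF *, of q] unfolding appell_sum .
  then have "(\<lambda>n. q * (phi_weight n * (1 / (qpoch q (q\<^sup>2) (Suc n))\<^sup>2))) sums ((1 + q) * bailey_gamma 0 * appell_sum)"
    by (rule has_sum_imp_sums)
  moreover have "q * (phi_weight n * (1 / (qpoch q (q\<^sup>2) (Suc n))\<^sup>2)) =
      qpoch (- q) q (2 * n) * q ^ (n + 1) / (qpoch q (q\<^sup>2) (n + 1))\<^sup>2" for n
    by (simp add: phi_weight_def)
  ultimately have "phi q = (1 + q) * bailey_gamma 0 * appell_sum"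
    unfolding phi_def by (simp only: sums_iff)
  then have "phi q * theta4 q = (1 + q) * bailey_gamma 0 * theta4 q * appell_sum" by (simp only: mult_ac)
  then show ?thesis by (simp only: bailey_gamma_theta4 mult_1_left)
qed

end

subsection \<open>Theta functions\<close>

text \<open>Folded over the integers, the exponents \<open>2 * n\<^sup>2 + n\<close> run through all triangular numbers, so \<open>psi q\<close> is the
  sum of \<open>q ^ (r * (r + 1) div 2)\<close> over all naturals \<open>r\<close>, and \<open>jac\<close> is Jacobi's series for the cube of Euler's
  product.\<close>

definition psi :: "complex \<Rightarrow> complex" where
  "psi q = (\<Sum>\<^sub>\<infinity>n::int. q powi (2 * (n * n) + n))"
definition jac :: "complex \<Rightarrow> complex" where
  "jac q = (\<Sum>\<^sub>\<infinity>n::int. of_int (4 * n + 1) * q powi (2 * (n * n) + n))"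

lemma infsum_suminf:
  fixes f :: "nat \<Rightarrow> 'a :: banach"
  assumes "(\<lambda>n. norm (f n)) summable_on UNIV"
  shows "infsum f UNIV = suminf f"
  using has_sum_imp_sums[OF has_sum_infsum[OF abs_summable_summable[OF assms]]] by (simp add: sums_iff)

text \<open>Reindexes r = 2n for n >= 0 and r = -2n - 1 for n < 0. In both cases r(r + 1)/2 = 2n^2 +
  n.\<close>

lemma infsum_nat_int:
  fixes f :: "nat \<Rightarrow> complex" and g :: "int \<Rightarrow> complex"
  assumes "\<And>n. n \<ge> 0 \<Longrightarrow> g n = f (nat (2 * n))" "\<And>n. n < 0 \<Longrightarrow> g n = f (nat (- 2 * n - 1))"
  shows "infsum f UNIV = infsum g UNIV"
proof (rule infsum_reindex_bij_witness[of _ "\<lambda>n. if n \<ge> 0 then nat (2 * n) else nat (- 2 * n - 1)"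
      "\<lambda>r. if even r then int (r div 2) else - int (Suc r div 2)"])
  fix r :: nat
  show "(if (if even r then int (r div 2) else - int (Suc r div 2)) \<ge> 0 then nat (2 * (if even r then int (r div 2) else - int (Suc r div 2))) else nat (- 2 * (if even r then int (r div 2) else - int (Suc r div 2)) - 1)) = r"
    by (cases "even r") (auto elim!: evenE oddE)
  show "g (if even r then int (r div 2) else - int (Suc r div 2)) = f r"
    by (cases "even r") (auto elim!: evenE oddE simp: assms nat_add_distrib nat_mult_distrib)
next
  fix n :: int
  show "(if even (if n \<ge> 0 then nat (2 * n) else nat (- 2 * n - 1)) then int ((if n \<ge> 0 then nat (2 * n) else nat (- 2 * n - 1)) div 2) else - int (Suc (if n \<ge> 0 then nat (2 * n) else nat (- 2 * n - 1)) div 2)) = n"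
  proof (cases n rule: int_cases)
    case (nonneg k)
    then have "nat (2 * n) = 2 * k" "n \<ge> 0" by simp_all
    with nonneg show ?thesis by simp
  next
    case (neg k)
    then have "nat (- 2 * n - 1) = Suc (2 * k)" "\<not> n \<ge> 0" by simp_all
    with neg show ?thesis by simp
  qed
qed auto

lemma infsum_antisym:
  fixes f :: "'a \<Rightarrow> complex"
  assumes "\<And>x. x \<in> A \<Longrightarrow> i x \<in> A" "\<And>x. x \<in> A \<Longrightarrow> i (i x) = x" "\<And>x. x \<in> A \<Longrightarrow> f (i x) = - f x"
  shows "infsum f A = 0"
proof -
  have "infsum (\<lambda>x. - f x) A = infsum f A"
    by (rule infsum_reindex_bij_witness[of _ i i]) (use assms in auto)
  then show ?thesis by (simp add: infsum_uminus)
qed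

text \<open>The substitution s = i + j, d = i - j diagonalises s^2 + d^2 into 2 i^2 + 2 j^2. It
  reaches exactly the pairs with even sum; the others are kept as a separate term, to be treated by
  a symmetry.\<close>

lemma parity_split:
  fixes h :: "int \<times> int \<Rightarrow> complex"
  assumes "h summable_on UNIV"
  shows "infsum h UNIV = (\<Sum>\<^sub>\<infinity>(i,j). h (i + j, i - j)) + infsum h {(s,d). odd (s + d)}"
    "infsum h {(s,d). even (s + d)} = (\<Sum>\<^sub>\<infinity>(i,j). h (i + j, i - j))"
proof -
  have U: "UNIV = {(s,d). even (s + d)} \<union> {(s,d). odd (s + d :: int)}" by auto
  have s: "h summable_on A" for A by (rule summable_on_subset_banach[OF assms]) auto
  have dv: "(s + d) div 2 + (s - d) div 2 = s" "(s + d) div 2 - (s - d) div 2 = d" if "even (s + d)" for s d :: int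
    using that by presburger+
  show *: "infsum h {(s,d). even (s + d)} = (\<Sum>\<^sub>\<infinity>(i,j). h (i + j, i - j))"
    by (rule infsum_reindex_bij_witness[of _ "\<lambda>(i,j). (i + j, i - j)" "\<lambda>(s,d). ((s + d) div 2, (s - d) div 2)"])
       (auto simp: dv)
  have "infsum h UNIV = infsum h {(s,d). even (s + d)} + infsum h {(s,d). odd (s + d)}"
    by (subst U, rule infsum_Un_disjoint[OF s s]) auto
  then show "infsum h UNIV = (\<Sum>\<^sub>\<infinity>(i,j). h (i + j, i - j)) + infsum h {(s,d). odd (s + d)}"
    unfolding * .
qed

lemma infsum_product:
  fixes f :: "'a \<Rightarrow> complex" and g :: "'b \<Rightarrow> complex"
  assumes "(\<lambda>x. norm (f x)) summable_on A" "(\<lambda>x. norm (g x)) summable_on B"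
  shows "infsum f A * infsum g B = (\<Sum>\<^sub>\<infinity>(x,y)\<in>A \<times> B. f x * g y)" "(\<lambda>(x,y). f x * g y) summable_on A \<times> B"
proof -
  show s: "(\<lambda>(x,y). f x * g y) summable_on A \<times> B"
    by (rule abs_summable_summable) (use abs_summable_times[OF assms] in \<open>simp add: case_prod_unfold\<close>)
  have "infsum f A * infsum g B = (\<Sum>\<^sub>\<infinity>x\<in>A. f x * infsum g B)"
    by (rule infsum_cmult_left'[symmetric])
  also have "\<dots> = (\<Sum>\<^sub>\<infinity>x\<in>A. \<Sum>\<^sub>\<infinity>y\<in>B. f x * g y)"
    by (simp add: infsum_cmult_right')
  also have "\<dots> = (\<Sum>\<^sub>\<infinity>(x,y)\<in>A \<times> B. f x * g y)"
    by (rule infsum_Sigma'_banach[OF s])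
  finally show "infsum f A * infsum g B = (\<Sum>\<^sub>\<infinity>(x,y)\<in>A \<times> B. f x * g y)" .
qed

context nome
begin

lemma nome_sq: "nome (q\<^sup>2)"
  by standard (use lt in \<open>auto simp: norm_power abs_square_less_1\<close>)

lemma odd_poch_tendsto: "\<exists>l. l \<noteq> 0 \<and> qpoch q (q\<^sup>2) \<longlonglongrightarrow> l"
proof (rule qpoch_tendsto)
  show "norm (q\<^sup>2) < 1" using nome_sq by (simp add: nome_def)
  show "q * (q\<^sup>2) ^ k \<noteq> 1" for k
    using odd_poch_nz[of "Suc k"] by (auto simp: qpoch_Suc)
qed

lemma pair_limit:
  assumes "(\<lambda>r. norm (\<alpha> r)) summable_on UNIV"
    and "\<And>n. (\<Sum>r\<le>n. \<alpha> r * bailey_coeff (int n) (int r)) = \<beta> n" "\<beta> \<longlonglongrightarrow> b"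
  shows "infsum \<alpha> UNIV = b * euler_limit\<^sup>2"
proof -
  have "(\<lambda>n. \<Sum>r\<le>n. \<alpha> r * bailey_coeff (int n) (int r)) \<longlonglongrightarrow> suminf \<alpha> / euler_limit\<^sup>2"
    by (rule pair_tendsto[OF summable_on_imp_summable[OF assms(1)]])
  then have "suminf \<alpha> / euler_limit\<^sup>2 = b"
    unfolding assms(2) using LIMSEQ_unique assms(3) by blast
  then show ?thesis using euler_limit(1) infsum_suminf[OF assms(1)] by (simp add: field_simps)
qed

lemma euler_limit_odd: "(\<lambda>n. qpoch (q\<^sup>2) (q\<^sup>2) (Suc (2 * n))) \<longlonglongrightarrow> euler_limit"
proof -
  have "strict_mono (\<lambda>n::nat. Suc (2 * n))" by (auto simp: strict_mono_def)
  then show ?thesis using LIMSEQ_subseq_LIMSEQ[OF euler_limit(2)] by (simp add: o_def)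
qed

lemma euler_limit_even: "(\<lambda>n. qpoch (q\<^sup>2) (q\<^sup>2) (2 * n)) \<longlonglongrightarrow> euler_limit"
proof -
  have "strict_mono (\<lambda>n::nat. 2 * n)" by (auto simp: strict_mono_def)
  then show ?thesis using LIMSEQ_subseq_LIMSEQ[OF euler_limit(2)] by (simp add: o_def)
qed

text \<open>The limit of \<open>bailey_coeff\<close> contributes two Euler products. One cancels
  against the denominator in \<open>weighted_pair\<close>; the other is the Euler product that
  belongs to the triple product.\<close>

lemma weighted_limit:
  fixes w :: "int \<Rightarrow> complex"
  assumes w: "\<And>r. w (r - 1) + w (r + 1) = \<tau> * w r"
    and P0: "P 0 = w 0 - w (- 1)"
    and P: "\<And>n. P (Suc n) = (1 + q powi (4 * int n + 4) - \<tau> * q powi (2 * int n + 2)) * P n"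
    and \<alpha>: "\<And>r. \<alpha> r = (-1) ^ r * q ^ (r * r + r) * (w (int r) - w (- 1 - int r))"
    and s: "(\<lambda>r. norm (\<alpha> r)) summable_on UNIV" and lim: "P \<longlonglongrightarrow> p"
  shows "infsum \<alpha> UNIV = p * euler_limit"
proof -
  have "(\<Sum>r\<le>n. \<alpha> r * bailey_coeff (int n) (int r)) = P n / qpoch (q\<^sup>2) (q\<^sup>2) (Suc (2 * n))" for n
  proof -
    have "q powi (int r * int r + int r) = q ^ (r * r + r)" for r
      by (simp only: of_nat_mult[symmetric] of_nat_add[symmetric] power_int_of_nat)
    then have "\<alpha> r * bailey_coeff (int n) (int r) = triple_coeff (int n) (int r) * (w (int r) - w (- 1 - int r))" for r
      unfolding \<alpha> triple_coeff_def by simp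
    then show ?thesis using weighted_pair[of w \<tau> P n, OF w P0 P] by simp
  qed
  moreover have "(\<lambda>n. P n / qpoch (q\<^sup>2) (q\<^sup>2) (Suc (2 * n))) \<longlonglongrightarrow> p / euler_limit"
    by (intro tendsto_divide lim euler_limit_odd euler_limit)
  ultimately have "infsum \<alpha> UNIV = p / euler_limit * euler_limit\<^sup>2" by (rule pair_limit[OF s])
  then show ?thesis using euler_limit(1) by (simp add: power2_eq_square)
qed

lemma powi_nat_exps: "q powi (4 * int n + 4) = (q\<^sup>2 * (q\<^sup>2) ^ n)\<^sup>2" "q powi (2 * int n + 2) = q\<^sup>2 * (q\<^sup>2) ^ n"
proof -
  show *: "q powi (2 * int n + 2) = q\<^sup>2 * (q\<^sup>2) ^ n"
  proof -
    have "2 * int n + 2 = int (2 * Suc n)" by simp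
    then have "q powi (2 * int n + 2) = q ^ (2 * Suc n)" by (simp only: power_int_of_nat)
    then show ?thesis by (simp only: power_mult power_Suc)
  qed
  have "4 * int n + 4 = 2 * (2 * int n + 2)" by simp
  then show "q powi (4 * int n + 4) = (q\<^sup>2 * (q\<^sup>2) ^ n)\<^sup>2"
    by (simp only: powi_split(3) *)
qed

section \<open>Product formulas for the theta constants\<close>

lemma theta4_limit:
  assumes "qpoch q (q\<^sup>2) \<longlonglongrightarrow> l"
  shows "theta4 q = l\<^sup>2 * euler_limit"
  unfolding theta4_fold(1)
\<comment> \<open>With y = q^(2n+2) the new factors are 1 - y/q and 1 - y q, that is 1 - q^(2n+1)
  and 1 - q^(2n+3). Hence \<open>P\<close> is a product of two consecutive Pochhammer symbols rather
  than a square.\<close>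
proof (rule weighted_limit[where w = "\<lambda>r. q powi (- r)" and \<tau> = "q + 1 / q"
       and P = "\<lambda>n. qpoch q (q\<^sup>2) n * qpoch q (q\<^sup>2) (Suc n)"])
  show "q powi (- (r - 1)) + q powi (- (r + 1)) = (q + 1 / q) * q powi (- r)" for r
    by (simp add: power_int_add power_int_diff power_int_minus divide_inverse algebra_simps)
  show "qpoch q (q\<^sup>2) (Suc n) * qpoch q (q\<^sup>2) (Suc (Suc n)) =
         (1 + q powi (4 * int n + 4) - (q + 1 / q) * q powi (2 * int n + 2)) *
         (qpoch q (q\<^sup>2) n * qpoch q (q\<^sup>2) (Suc n))" for n
    unfolding powi_nat_exps qpoch_Suc power_Suc by (simp add: field_simps power2_eq_square)
  show "(-1) ^ r * q ^ (r * r) * (1 - q ^ (2 * r + 1)) =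
        (-1) ^ r * q ^ (r * r + r) * (q powi (- int r) - q powi (- (- 1 - int r)))" for r
  proof -
    have "q powi (- (- 1 - int r)) = q ^ Suc r" by (simp add: power_int_add)
    moreover have "q powi (- int r) = 1 / q ^ r" by (simp add: power_int_minus divide_inverse)
    moreover have "q ^ (2 * r + 1) = q ^ r * q ^ r * q" by (simp add: mult_2 power_add)
    ultimately show ?thesis by (simp add: power_add algebra_simps)
  qed
  show "(\<lambda>n. qpoch q (q\<^sup>2) n * qpoch q (q\<^sup>2) (Suc n)) \<longlonglongrightarrow> l\<^sup>2"
    unfolding power2_eq_square[of l] by (intro tendsto_mult LIMSEQ_Suc assms)
qed (use theta4_fold(2) in \<open>auto simp: qpoch_def\<close>)

lemma theta3_minus: "theta3 q = theta4 (- q)"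
proof -
  have "(-1) powi n * (- q) powi (n * n) = q powi (n * n)" for n
    by (simp add: power_int_minus_left)
  then show ?thesis by (simp add: theta3_def theta4_def)
qed

lemma euler_limit_minus: "nome.euler_limit (- q) = euler_limit"
  using minus_nome nome_axioms by (simp add: nome.euler_limit_def)

lemma theta3_limit:
  assumes "qpoch (- q) (q\<^sup>2) \<longlonglongrightarrow> l"
  shows "theta3 q = l\<^sup>2 * euler_limit"
  using nome.theta4_limit[OF minus_nome, of l] assms euler_limit_minus by (simp add: theta3_minus)

lemma summable_gauss_0:
  assumes "\<And>n. norm (b n) \<le> M"
  shows "(\<lambda>n::int. norm (b n * q powi (n * n + n))) summable_on UNIV"
    "(\<lambda>n::int. norm (b n * q powi (n * n))) summable_on UNIV"
  using summable_gauss[of b M 1, OF assms] summable_gauss[of b M 0, OF assms] by simp_all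

lemma linear_times_power_bounded: "\<exists>K>0. \<forall>n. real n * norm q ^ n \<le> K"
proof -
  have "(\<lambda>n::nat. real n * norm q ^ n) \<longlonglongrightarrow> 0"
    using powser_times_n_limit_0[of "norm q"] lt by simp
  then have "Bseq (\<lambda>n::nat. real n * norm q ^ n)" by (rule convergent_imp_Bseq[OF convergentI])
  then show ?thesis by (auto simp: Bseq_def)
qed

lemma summable_gauss_psi:
  "(\<lambda>n::int. norm (q powi (2 * (n * n) + n))) summable_on UNIV"
  "(\<lambda>n::int. norm (of_int (4 * n + 1) * q powi (2 * (n * n) + n))) summable_on UNIV"
proof -
  obtain M where M: "norm (of_int (4 * n + 1) * q powi (n * n)) \<le> M" for n
  proof -
    obtain K where K: "K > 0" "\<And>n. real n * norm q ^ n \<le> K" using linear_times_power_bounded by blast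
    have "norm (of_int (4 * n + 1) * q powi (n * n)) \<le> 4 * K + 1" for n
    proof -
      have "norm (of_int (4 * n + 1) * q powi (n * n)) = \<bar>of_int (4 * n + 1)\<bar> * norm q powi (n * n)"
        by (simp only: norm_mult norm_of_int norm_power_int)
      also have "\<dots> \<le> (4 * real (nat \<bar>n\<bar>) + 1) * norm q powi \<bar>n\<bar>"
      proof (intro mult_mono)
        show "norm q powi (n * n) \<le> norm q powi \<bar>n\<bar>"
        proof (rule power_int_decreasing)
          show "\<bar>n\<bar> \<le> n * n"
            by (metis abs_mult_self_eq abs_ge_zero mult_cancel_right2 int_one_le_iff_zero_less less_le
                mult_le_cancel_right1 mult.commute abs_le_zero_iff linorder_not_le)
        qed (use lt in auto)
      qed auto
      also have "norm q powi \<bar>n\<bar> = norm q ^ nat \<bar>n\<bar>" by (simp add: power_int_def)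
      also have "(4 * real (nat \<bar>n\<bar>) + 1) * norm q ^ nat \<bar>n\<bar> = 4 * (real (nat \<bar>n\<bar>) * norm q ^ nat \<bar>n\<bar>) + norm q ^ nat \<bar>n\<bar>"
        by (simp add: algebra_simps)
      also have "\<dots> \<le> 4 * K + 1" using K(2)[of "nat \<bar>n\<bar>"] lt by (intro add_mono) (auto intro: power_le_one)
      finally show ?thesis .
    qed
    then show ?thesis using that by blast
  qed
  \<comment> \<open>Half of the Gaussian decay absorbs the linear factor 4n + 1; the other half
    gives summability.\<close>
  have e: "2 * (n * n) + n = n * n + (n * n + n)" for n :: int by simp
  have "(\<lambda>n. norm (of_int (4 * n + 1) * q powi (n * n) * q powi (n * n + n))) summable_on UNIV"
    by (rule summable_gauss_0(1)[of "\<lambda>n. of_int (4 * n + 1) * q powi (n * n)" M, OF M])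
  then show "(\<lambda>n::int. norm (of_int (4 * n + 1) * q powi (2 * (n * n) + n))) summable_on UNIV"
    unfolding e by (simp only: powi_split(1) mult.assoc)
  then show "(\<lambda>n::int. norm (q powi (2 * (n * n) + n))) summable_on UNIV"
  proof (rule Infinite_Sum.abs_summable_on_comparison_test)
    fix n :: int
    have "1 \<le> \<bar>4 * n + 1\<bar>" by presburger
    then have "1 \<le> norm (of_int (4 * n + 1) :: complex)" unfolding norm_of_int by linarith
    then show "norm (q powi (2 * (n * n) + n)) \<le> norm (of_int (4 * n + 1) * q powi (2 * (n * n) + n))"
      unfolding norm_mult by (intro mult_le_cancel_right1[THEN iffD2]) auto
  qed
qed


lemma theta2_limit:
  assumes "qpoch (- (q\<^sup>2)) (q\<^sup>2) \<longlonglongrightarrow> l"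
  shows "theta2 q = 2 * l\<^sup>2 * euler_limit"
proof -
  have s: "(\<lambda>n::int. norm (1 * q powi (n * n + n))) summable_on UNIV"
    by (rule summable_gauss_0(1)[of "\<lambda>_. 1" 1]) simp
  let ?\<alpha> = "\<lambda>r::nat. (-1) ^ r * q ^ (r * r + r) * ((-1) powi (int r) - (-1) powi (- 1 - int r))"
  have "1 * q powi (int r * int r + int r) + 1 * q powi ((- 1 - int r) * (- 1 - int r) + (- 1 - int r)) = ?\<alpha> r" for r
  proof -
    have 1: "(- 1 - int r) * (- 1 - int r) + (- 1 - int r) = int r * int r + int r" by (simp add: algebra_simps)
    have 2: "(-1 :: complex) powi (- 1 - int r) = - ((-1) ^ r)" by (simp add: power_int_minus_left)
    have 3: "q powi (int r * int r + int r) = q ^ (r * r + r)"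
      by (simp only: of_nat_mult[symmetric] of_nat_add[symmetric] power_int_of_nat)
    show ?thesis unfolding 1 2 3 by (simp add: power2_eq_square[symmetric] flip: power_mult mult.assoc)
  qed
  then have *: "theta2 q = infsum ?\<alpha> UNIV" "(\<lambda>r. norm (?\<alpha> r)) summable_on UNIV"
    using infsum_fold_int[OF s] unfolding theta2_def by (simp_all only: mult_1_left)
  have "infsum ?\<alpha> UNIV = (2 * l\<^sup>2) * euler_limit"
  \<comment> \<open>The new factor is (1 + q^(2n+2))^2, and the constant 2 in \<open>P\<close> is w
    0 - w (-1).\<close>
  proof (rule weighted_limit[where w = "\<lambda>r. (-1) powi r" and \<tau> = "- 2"
       and P = "\<lambda>n. 2 * (qpoch (- (q\<^sup>2)) (q\<^sup>2) n)\<^sup>2"])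
    show "(-1 :: complex) powi (r - 1) + (-1) powi (r + 1) = - 2 * (-1) powi r" for r
      by (simp add: power_int_add power_int_diff)
    show "2 * (qpoch (- (q\<^sup>2)) (q\<^sup>2) (Suc n))\<^sup>2 = (1 + q powi (4 * int n + 4) - - 2 * q powi (2 * int n + 2)) * (2 * (qpoch (- (q\<^sup>2)) (q\<^sup>2) n)\<^sup>2)" for n
      unfolding powi_nat_exps qpoch_Suc by (simp add: algebra_simps power2_eq_square)
    show "(\<lambda>n. 2 * (qpoch (- (q\<^sup>2)) (q\<^sup>2) n)\<^sup>2) \<longlonglongrightarrow> 2 * l\<^sup>2"
      by (intro tendsto_intros assms)
  qed (use *(2) in auto)
  then show ?thesis using * by simp
qed

definition jac_sum :: complex where
  "jac_sum = (\<Sum>\<^sub>\<infinity>r::nat. (-1) ^ r * q ^ (r * r + r) * (of_nat (2 * r + 1)))"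

lemma nat_int_exps:
  fixes x :: complex
  shows "n \<ge> 0 \<Longrightarrow> x ^ (nat (2 * n) * nat (2 * n) + nat (2 * n)) = (x\<^sup>2) powi (2 * (n * n) + n)"
    "n < 0 \<Longrightarrow> x ^ (nat (- 2 * n - 1) * nat (- 2 * n - 1) + nat (- 2 * n - 1)) = (x\<^sup>2) powi (2 * (n * n) + n)"
proof -
  assume "n \<ge> 0"
  then obtain k where k: "n = int k" by (metis nonneg_int_cases)
  have "nat (2 * n) = 2 * k" "2 * (n * n) + n = int (2 * (k * k) + k)" unfolding k by simp_all
  moreover have "2 * k * (2 * k) + 2 * k = 2 * (2 * (k * k) + k)" by simp
  ultimately show "x ^ (nat (2 * n) * nat (2 * n) + nat (2 * n)) = (x\<^sup>2) powi (2 * (n * n) + n)"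
    by (simp only: power_int_of_nat power_mult)
next
  assume "n < 0"
  then obtain k where k: "n = - int (Suc k)" by (metis negD int_cases not_less of_nat_0_le_iff)
  have "nat (- 2 * n - 1) = 2 * k + 1" "2 * (n * n) + n = int (2 * (k * k) + 3 * k + 1)"
    unfolding k by (simp_all add: algebra_simps nat_add_distrib nat_mult_distrib)
  moreover have "(2 * k + 1) * (2 * k + 1) + (2 * k + 1) = 2 * (2 * (k * k) + 3 * k + 1)" by (simp add: algebra_simps)
  ultimately show "x ^ (nat (- 2 * n - 1) * nat (- 2 * n - 1) + nat (- 2 * n - 1)) = (x\<^sup>2) powi (2 * (n * n) + n)"
    by (simp only: power_int_of_nat power_mult)
qed

lemma jac_sum_jac: "jac_sum = jac (q\<^sup>2)"
  unfolding jac_sum_def jac_def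
proof (rule infsum_nat_int)
  fix n :: int
  have "even (nat (2 * n))" if "n \<ge> 0" using that by (simp add: even_nat_iff)
  then show "of_int (4 * n + 1) * (q\<^sup>2) powi (2 * (n * n) + n) = (-1) ^ nat (2 * n) * q ^ (nat (2 * n) * nat (2 * n) + nat (2 * n)) * of_nat (2 * nat (2 * n) + 1)"
    if "n \<ge> 0" using that unfolding nat_int_exps(1)[OF that] by (simp add: of_nat_nat)
  have "odd (nat (- 2 * n - 1))" if "n < 0" using that by (simp add: even_nat_iff)
  then show "of_int (4 * n + 1) * (q\<^sup>2) powi (2 * (n * n) + n) = (-1) ^ nat (- 2 * n - 1) * q ^ (nat (- 2 * n - 1) * nat (- 2 * n - 1) + nat (- 2 * n - 1)) * of_nat (2 * nat (- 2 * n - 1) + 1)"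
    if "n < 0" using that unfolding nat_int_exps(2)[OF that] by (simp add: of_nat_nat algebra_simps)
qed

lemma theta2_psi: "theta2 q = 2 * psi (q\<^sup>2)"
proof -
  have s: "(\<lambda>n::int. norm (q powi (n * n + n))) summable_on UNIV"
    using summable_gauss_0(1)[of "\<lambda>_. 1" 1] by simp
  have "q powi (int r * int r + int r) + q powi ((- 1 - int r) * (- 1 - int r) + (- 1 - int r)) = 2 * q ^ (r * r + r)" for r
  proof -
    have 1: "(- 1 - int r) * (- 1 - int r) + (- 1 - int r) = int r * int r + int r" by (simp add: algebra_simps)
    have 3: "q powi (int r * int r + int r) = q ^ (r * r + r)"
      by (simp only: of_nat_mult[symmetric] of_nat_add[symmetric] power_int_of_nat)
    show ?thesis unfolding 1 3 by simp
  qed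
  then have "theta2 q = (\<Sum>\<^sub>\<infinity>r::nat. 2 * q ^ (r * r + r))"
    unfolding theta2_def infsum_fold_int(1)[OF s] by (simp only:)
  also have "\<dots> = 2 * (\<Sum>\<^sub>\<infinity>r::nat. q ^ (r * r + r))" by (rule infsum_cmult_right')
  also have "(\<Sum>\<^sub>\<infinity>r::nat. q ^ (r * r + r)) = psi (q\<^sup>2)"
    unfolding psi_def by (rule infsum_nat_int) (simp_all only: nat_int_exps)
  finally show ?thesis .
qed

lemma jac_sum_summable: "(\<lambda>r::nat. norm ((-1) ^ r * q ^ (r * r + r) * (of_nat (2 * r + 1)))) summable_on UNIV"
proof -
  obtain K where K: "K > 0" "\<And>n. real n * norm q ^ n \<le> K" using linear_times_power_bounded by blast
  show ?thesis
  proof (rule Infinite_Sum.abs_summable_on_comparison_test')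
    have "norm q ^ (r * r) = norm (q powi (int r * int r + 0 * int r))" for r
      by (simp add: norm_power flip: of_nat_mult)
    then have "(\<lambda>r. norm q ^ (r * r)) summable_on UNIV" using summable_gauss_nat[of "\<lambda>_. 1" 1 0] by simp
    then show "(\<lambda>r. norm q ^ (r * r) * (2 * K + 1)) summable_on UNIV" by (rule summable_on_cmult_left)
    show "norm ((-1) ^ r * q ^ (r * r + r) * (of_nat (2 * r + 1))) \<le> norm q ^ (r * r) * (2 * K + 1)" for r
    proof -
      have "norm ((-1) ^ r * q ^ (r * r + r) * (of_nat (2 * r + 1))) = norm q ^ (r * r) * (norm q ^ r * real (2 * r + 1))"
        unfolding norm_mult norm_power norm_of_nat by (simp add: power_add)
      also have "norm q ^ r * real (2 * r + 1) = 2 * (real r * norm q ^ r) + norm q ^ r"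
        by (simp add: algebra_simps)
      also have "\<dots> \<le> 2 * K + 1" using K(2)[of r] lt by (intro add_mono) (auto intro: power_le_one)
      finally show ?thesis by (simp add: mult_left_mono)
    qed
  qed
qed

lemma jac_sum_limit: "jac_sum = euler_limit ^ 3"
proof -
  have "jac_sum = euler_limit\<^sup>2 * euler_limit" unfolding jac_sum_def
  \<comment> \<open>For \<open>\<tau> = 2\<close> the weight equation is also solved by constants,
    but for these w r - w (-1 - r) is zero. The linear solution yields Jacobi's coefficients 2r +
    1.\<close>
  proof (rule weighted_limit[where w = "\<lambda>r. of_int r" and \<tau> = 2
       and P = "\<lambda>n. (qpoch (q\<^sup>2) (q\<^sup>2) n)\<^sup>2"])
    show "(qpoch (q\<^sup>2) (q\<^sup>2) (Suc n))\<^sup>2 = (1 + q powi (4 * int n + 4) - 2 * q powi (2 * int n + 2)) * ((qpoch (q\<^sup>2) (q\<^sup>2) n)\<^sup>2)" for n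
      unfolding powi_nat_exps qpoch_Suc by (simp add: algebra_simps power2_eq_square)
    show "(\<lambda>n. (qpoch (q\<^sup>2) (q\<^sup>2) n)\<^sup>2) \<longlonglongrightarrow> euler_limit\<^sup>2"
      by (intro tendsto_intros euler_limit)
  qed (use jac_sum_summable in auto)
  then show ?thesis by (simp add: power3_eq_cube power2_eq_square)
qed

definition lambert_sum :: complex where "lambert_sum = (\<Sum>\<^sub>\<infinity>r::nat. lambert_alpha (int r))"

lemma lambert_sum_limit:
  assumes "qpoch q (q\<^sup>2) \<longlonglongrightarrow> l" "l \<noteq> 0"
  shows "lambert_sum = euler_limit\<^sup>2 / l\<^sup>2"
proof -
  have "(\<lambda>n. 1 / (qpoch q (q\<^sup>2) (Suc n))\<^sup>2) \<longlonglongrightarrow> 1 / l\<^sup>2"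
    by (intro tendsto_intros LIMSEQ_Suc assms) (use assms in auto)
  from pair_limit[OF lambert_alpha_summable lambert_alpha_pair this] show ?thesis by (simp add: lambert_sum_def)
qed

text \<open>Its limit, divided by the Euler product, is Euler's identity that (-q;q^2), (-q^2;q^2)
  and (q;q^2) multiply to 1 at infinity.\<close>

lemma qpoch_four: "qpoch (- q) (q\<^sup>2) n * qpoch (- (q\<^sup>2)) (q\<^sup>2) n * qpoch q (q\<^sup>2) n * qpoch (q\<^sup>2) (q\<^sup>2) n
   = qpoch (q\<^sup>2) (q\<^sup>2) (2 * n)"
proof (induction n)
  case (Suc n)
  define x where "x = (q\<^sup>2) ^ n"
  have x: "(q\<^sup>2) ^ (2 * n) = x\<^sup>2" "(q\<^sup>2) ^ Suc (2 * n) = x\<^sup>2 * q\<^sup>2"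
    by (simp_all add: x_def power_mult[symmetric] mult.commute)
  have e: "2 * Suc n = Suc (Suc (2 * n))" by simp
  show ?case unfolding e qpoch_Suc x Suc.IH[symmetric] x_def[symmetric] by algebra
qed simp

lemma theta_products: "lambert_sum * theta4 q = jac (q\<^sup>2)" "theta3 q * theta2 q = 2 * lambert_sum"
proof -
  obtain l where l: "qpoch q (q\<^sup>2) \<longlonglongrightarrow> l" "l \<noteq> 0" using odd_poch_tendsto by blast
  have "lambert_sum * theta4 q = jac_sum"
    using l(2) by (simp add: jac_sum_limit lambert_sum_limit[OF l] theta4_limit[OF l(1)] power2_eq_square power3_eq_cube)
  then show "lambert_sum * theta4 q = jac (q\<^sup>2)" by (simp only: jac_sum_jac)
  obtain l' where l': "qpoch (- q) (q\<^sup>2) \<longlonglongrightarrow> l'"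
    using nome.odd_poch_tendsto[OF minus_nome] by auto
  obtain m where m: "qpoch (- (q\<^sup>2)) (q\<^sup>2) \<longlonglongrightarrow> m"
  proof -
    have "- (q\<^sup>2) * (q\<^sup>2) ^ k \<noteq> 1" for k
    proof
      assume *: "- (q\<^sup>2) * (q\<^sup>2) ^ k = 1"
      have "q ^ (2 * Suc k) = - (- (q\<^sup>2) * (q\<^sup>2) ^ k)" by (simp only: power_mult power_Suc) simp
      then show False unfolding * using pow_neq_minus_1[of "2 * Suc k"] by simp
    qed
    then show ?thesis using qpoch_tendsto[of "q\<^sup>2" "- (q\<^sup>2)"] nome_sq that by (auto simp: nome_def)
  qed
  have "(\<lambda>n. qpoch (- q) (q\<^sup>2) n * qpoch (- (q\<^sup>2)) (q\<^sup>2) n * qpoch q (q\<^sup>2) n * qpoch (q\<^sup>2) (q\<^sup>2) n)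
     \<longlonglongrightarrow> l' * m * l * euler_limit" by (intro tendsto_mult l l' m euler_limit)
  then have "l' * m * l * euler_limit = euler_limit" unfolding qpoch_four using euler_limit_even LIMSEQ_unique by blast
  then have *: "l' * m * l = 1" using euler_limit by simp
  have "theta3 q * theta2 q = 2 * (l' * m)\<^sup>2 * euler_limit\<^sup>2"
    by (simp add: theta3_limit[OF l'] theta2_limit[OF m] power2_eq_square)
  also have "l' * m = 1 / l" using * l(2) by (simp add: field_simps)
  finally show "theta3 q * theta2 q = 2 * lambert_sum" unfolding lambert_sum_limit[OF l] by (simp add: power_divide)
qed

end

subsection \<open>The odd part of phi\<close>

lemma convolution_has_sum:
  fixes f g :: "int \<Rightarrow> complex"
  assumes f: "(\<lambda>x. norm (f x)) summable_on UNIV" and g: "(\<lambda>x. norm (g x)) summable_on UNIV"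
  shows "((\<lambda>m. \<Sum>\<^sub>\<infinity>n. f n * g (m - n)) has_sum infsum f UNIV * infsum g UNIV) UNIV"
proof -
  let ?h = "\<lambda>(n,l). f n * g l"
  have "?h summable_on UNIV \<times> UNIV" by (rule infsum_product(2)[OF assms])
  also have "?h summable_on UNIV \<times> UNIV \<longleftrightarrow> (\<lambda>(m,n). f n * g (m - n)) summable_on UNIV \<times> UNIV"
    by (rule summable_on_reindex_bij_witness[of _ "\<lambda>(m,n). (n, m - n)" "\<lambda>(n,l). (n + l, n)"]) auto
  finally have "(\<lambda>m. \<Sum>\<^sub>\<infinity>n. f n * g (m - n)) summable_on UNIV"
    using summable_on_Sigma_banach[of "\<lambda>m n. f n * g (m - n)" UNIV "\<lambda>_. UNIV"] by simp
  then show ?thesis using has_sum_infsum convolution_int[OF assms] by fastforce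
qed

lemma has_sum_diff:
  fixes f g :: "'a \<Rightarrow> complex"
  assumes "(f has_sum a) A" "(g has_sum b) A"
  shows "((\<lambda>x. f x - g x) has_sum a - b) A"
  using has_sum_add[OF assms(1) has_sum_uminusI[OF assms(2)]] by simp

lemma infsum_diff:
  fixes f g :: "'a \<Rightarrow> complex"
  assumes "f summable_on A" "g summable_on A"
  shows "(\<Sum>\<^sub>\<infinity>x\<in>A. f x - g x) = infsum f A - infsum g A"
  by (rule infsumI) (intro has_sum_diff has_sum_infsum assms)

lemma int_induct_bidirectional:
  assumes "P 0" "\<And>m::int. P m \<longleftrightarrow> P (m + 1)"
  shows "P m"
proof (induction m rule: int_induct[of _ 0])
  case (step2 i)
  then show ?case using assms(2)[of "i - 1"] by simp
qed (use assms in auto)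

context nome
begin

text \<open>The values s = 1 and s = -1 correspond to q and -q, since the exponents are odd. Both
  signs of the nome are thus treated with powers of the same q.\<close>

definition geom :: "complex \<Rightarrow> int \<Rightarrow> complex" where
  "geom s n = 1 / (1 - s * q powi (2 * n + 1))"

lemma odd_powi_neq: "q powi (2 * n + 1) \<noteq> 1" "q powi (2 * n + 1) \<noteq> -1"
proof -
  have "2 * n + 1 \<noteq> 0" by presburger
  then show "q powi (2 * n + 1) \<noteq> 1" "q powi (2 * n + 1) \<noteq> -1" using powi_neq_1 by auto
qed

lemma geom_denom: "s = 1 \<or> s = -1 \<Longrightarrow> 1 - s * q powi (2 * n + 1) \<noteq> 0"
proof (elim disjE)
  assume s: "s = -1"
  show ?thesis
  proof
    assume "1 - s * q powi (2 * n + 1) = 0"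
    then have "q powi (2 * n + 1) = -1" unfolding s by algebra
    then show False using odd_powi_neq(2) by blast
  qed
qed (use odd_powi_neq(1)[of n] in auto)

lemma geom_mult: "s = 1 \<or> s = -1 \<Longrightarrow> (1 - s * q powi (2 * n + 1)) * geom s n = 1"
  using geom_denom[of s n] by (simp add: geom_def)

lemma geom_reflect:
  assumes "s = 1 \<or> s = -1"
  shows "geom s (- 1 - n) = - s * q powi (2 * n + 1) * geom s n"
proof -
  let ?x = "q powi (2 * n + 1)"
  have "2 * (- 1 - n) + 1 = - (2 * n + 1)" by simp
  then have e: "q powi (2 * (- 1 - n) + 1) = 1 / ?x" by (simp only: power_int_minus inverse_eq_divide)
  have x: "?x \<noteq> 0" "1 - s * ?x \<noteq> 0" "1 - s * (1 / ?x) \<noteq> 0"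
    using geom_denom[OF assms, of n] geom_denom[OF assms, of "- 1 - n"] unfolding e by auto
  show ?thesis unfolding geom_def e using x assms by (auto simp: field_simps)
qed

lemma norm_g: "s = 1 \<or> s = -1 \<Longrightarrow> norm (geom s n) \<le> 1 / (1 - norm q)"
  unfolding geom_def by (rule norm_odd) auto

lemma kronecker_sum_summable:
  assumes s: "s = 1 \<or> s = -1"
  shows "(\<lambda>n. norm ((-1) powi n * q powi n * geom s n)) summable_on UNIV"
  unfolding abs_summable_fold_int
proof
  show *: "(\<lambda>n. norm ((-1) powi int n * q powi int n * geom s (int n))) summable_on UNIV"
  proof (rule Infinite_Sum.abs_summable_on_comparison_test')
    show "(\<lambda>n. norm q ^ n * (1 / (1 - norm q))) summable_on UNIV"
      using lt by (intro summable_on_cmult_left summable_on_nat) auto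
    show "norm ((-1) powi int n * q powi int n * geom s (int n)) \<le> norm q ^ n * (1 / (1 - norm q))" for n
    proof -
      have "norm ((-1) powi int n * q powi int n * geom s (int n)) = norm q ^ n * norm (geom s (int n))"
        by (simp add: norm_mult norm_power)
      also have "\<dots> \<le> norm q ^ n * (1 / (1 - norm q))"
        by (intro mult_left_mono norm_g s) simp
      finally show ?thesis .
    qed
  qed
  \<comment> \<open>At negative indices \<open>q powi n\<close> grows, but \<open>geom\<close>
    decays fast enough to compensate: the reflection n -> -1 - n preserves the modulus of the
    term.\<close>
  have "norm ((-1) powi (- 1 - int n) * q powi (- 1 - int n) * geom s (- 1 - int n)) = norm ((-1) powi int n * q powi int n * geom s (int n))" for n
  proof -
    have "- 1 - int n + (2 * int n + 1) = int n" by simp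
    then have e: "q powi (- 1 - int n) * q powi (2 * int n + 1) = q powi int n"
      by (simp only: powi_split(1)[symmetric])
    have "(-1) powi (- 1 - int n) * q powi (- 1 - int n) * geom s (- 1 - int n)
        = (-1) powi (- 1 - int n) * (- s) * (q powi (- 1 - int n) * q powi (2 * int n + 1)) * geom s (int n)"
      unfolding geom_reflect[OF s] by (simp only: mult_ac)
    moreover have "norm (- s) = 1" using s by auto
    ultimately show ?thesis unfolding e by (simp only: norm_mult norm_minus_one_powi)
  qed
  with * show "(\<lambda>n. norm ((-1) powi (- 1 - int n) * q powi (- 1 - int n) * geom s (- 1 - int n))) summable_on UNIV"
    by (simp only:)
qed

definition kronecker_sum :: complex where "kronecker_sum = (\<Sum>\<^sub>\<infinity>n. (-1) powi n * q powi n * geom 1 n)"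

text \<open>Up to sign, the values at m = -1 are twice the Appell sums of q (s = 1) and of -q (s =
  -1). Letting the centre m of the Gaussian move makes a recurrence available.\<close>

definition M :: "complex \<Rightarrow> int \<Rightarrow> complex" where
  "M s m = (\<Sum>\<^sub>\<infinity>n. (- s) powi (m - n) * q powi ((m - n) * (m - n)) * geom s n)"

lemma norm_sign_powi: "s = 1 \<or> s = -1 \<Longrightarrow> norm ((- s :: complex) powi k) = 1" "s = 1 \<or> s = -1 \<Longrightarrow> norm (s powi k :: complex) = 1"
  by auto

lemma summable_shift_gauss:
  assumes "\<And>n. norm (b n) \<le> B"
  shows "(\<lambda>n. norm (b n * q powi ((m - n) * (m - n)))) summable_on UNIV"
proof -
  have "norm (b n * q powi (m * m)) \<le> B * norm (q powi (m * m))" for n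
    unfolding norm_mult using assms by (intro mult_right_mono) auto
  from summable_gauss[of "\<lambda>n. b n * q powi (m * m)" "B * norm (q powi (m * m))" "- 2 * m", OF this]
  have "(\<lambda>n. norm (b n * q powi (m * m) * q powi (n * n + - 2 * m * n))) summable_on UNIV" .
  moreover have "(m - n) * (m - n) = m * m + (n * n + - 2 * m * n)" for n by (simp add: algebra_simps)
  ultimately show ?thesis by (simp only: powi_split(1) mult.assoc)
qed

lemma M_summable:
  assumes s: "s = 1 \<or> s = -1"
  shows "(\<lambda>n. norm ((- s) powi (m - n) * q powi ((k - n) * (k - n)) * geom s n)) summable_on UNIV"
proof -
  have "norm ((- s) powi (m - n) * geom s n) \<le> 1 / (1 - norm q)" for n
    using norm_g[OF s] norm_sign_powi(1)[OF s] by (simp add: norm_mult)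
  from summable_shift_gauss[of "\<lambda>n. (- s) powi (m - n) * geom s n" "1 / (1 - norm q)", OF this] show ?thesis
    by (simp only: mult_ac)
qed

lemma infsum_int_shift: "(\<Sum>\<^sub>\<infinity>n. f (m - n :: int)) = infsum f UNIV" for f :: "int \<Rightarrow> complex"
  by (rule infsum_reindex_bij_witness[of _ "\<lambda>n. m - n" "\<lambda>n. m - n"]) auto

text \<open>After the multiplication by q^(2m+2) the two exponents differ by 2n + 1, so the sum
  produces the numerator 1 - s q^(2n+1), which cancels \<open>geom\<close>. The resulting constant
  is \<open>theta4\<close> for s = 1 and \<open>theta3\<close> for s = -1.\<close>

lemma M_step:
  assumes s: "s = 1 \<or> s = -1"
  shows "M s (m + 1) + q powi (2 * m + 2) * M s m = (\<Sum>\<^sub>\<infinity>l. (- s) powi l * q powi (l * l))"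
proof -
  let ?a = "\<lambda>n. (- s) powi (m + 1 - n) * q powi ((m + 1 - n) * (m + 1 - n)) * geom s n"
  let ?b = "\<lambda>n. q powi (2 * m + 2) * ((- s) powi (m - n) * q powi ((m - n) * (m - n)) * geom s n)"
  have sm: "?a summable_on UNIV" "?b summable_on UNIV"
    by (rule abs_summable_summable[OF M_summable[OF s]] summable_on_cmult_right[OF abs_summable_summable[OF M_summable[OF s]]])+
  have "M s (m + 1) + q powi (2 * m + 2) * M s m = (\<Sum>\<^sub>\<infinity>n. ?a n + ?b n)"
    unfolding M_def infsum_cmult_right'[symmetric] by (rule infsum_add[OF sm, symmetric])
  also have "\<dots> = (\<Sum>\<^sub>\<infinity>n. (- s) powi (m + 1 - n) * q powi ((m + 1 - n) * (m + 1 - n)))"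
  proof (rule infsum_cong)
    fix n
    have "(2 * m + 2) + (m - n) * (m - n) = (m + 1 - n) * (m + 1 - n) + (2 * n + 1)" by (simp add: algebra_simps)
    then have e: "q powi (2 * m + 2) * q powi ((m - n) * (m - n)) = q powi ((m + 1 - n) * (m + 1 - n)) * q powi (2 * n + 1)"
      by (simp only: powi_split(1)[symmetric])
    have "(- s) powi ((m - n) + 1) = (- s) powi (m - n) * (- s)"
      using s by (intro power_int_add_1) auto
    moreover have "m + 1 - n = (m - n) + 1" by simp
    ultimately have "(- s) powi (m + 1 - n) = (- s) powi (m - n) * (- s)" by (simp only:)
    moreover have "(- s) * (- s) = 1" using s by auto
    ultimately have e2: "(- s) powi (m - n) = (- s) powi (m + 1 - n) * (- s)" by (simp add: mult.assoc)
    have "?b n = (q powi (2 * m + 2) * q powi ((m - n) * (m - n))) * ((- s) powi (m - n) * geom s n)" by (simp only: mult_ac)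
    also have "\<dots> = (- s) powi (m + 1 - n) * q powi ((m + 1 - n) * (m + 1 - n)) * (- s * q powi (2 * n + 1) * geom s n)"
      unfolding e e2 by (simp only: mult_ac)
    finally have "?a n + ?b n = (- s) powi (m + 1 - n) * q powi ((m + 1 - n) * (m + 1 - n)) * ((1 - s * q powi (2 * n + 1)) * geom s n)"
      by (simp add: algebra_simps)
    then show "?a n + ?b n = (- s) powi (m + 1 - n) * q powi ((m + 1 - n) * (m + 1 - n))"
      unfolding geom_mult[OF s] by simp
  qed
  also have "\<dots> = (\<Sum>\<^sub>\<infinity>l. (- s) powi l * q powi (l * l))"
    by (rule infsum_int_shift)
  finally show ?thesis .
qed

lemma alternating_zero: "(\<Sum>\<^sub>\<infinity>l. (-1) powi l * q powi (l * l + l)) = 0"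
proof (rule infsum_antisym[of _ "\<lambda>l. - 1 - l"])
  fix l :: int
  have 1: "(- 1 - l) * (- 1 - l) + (- 1 - l) = l * l + l" by (simp add: algebra_simps)
  show "(-1) powi (- 1 - l) * q powi ((- 1 - l) * (- 1 - l) + (- 1 - l)) = - ((-1) powi l * q powi (l * l + l))"
    unfolding 1 by (simp add: power_int_minus_left)
qed auto

text \<open>As a function of m, \<open>M\<close> is a convolution, so its generating function
  factors. At -q the second factor is \<open>theta2\<close> for s = 1, while for s = -1 it vanishes
  by \<open>alternating_zero\<close>.\<close>

lemma M_generating:
  assumes s: "s = 1 \<or> s = -1"
  shows "((\<lambda>m. (- q) powi m * M s m) has_sum
     (\<Sum>\<^sub>\<infinity>n. (-1) powi n * q powi n * geom s n) * (\<Sum>\<^sub>\<infinity>l. s powi l * q powi (l * l + l))) UNIV"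
proof -
  have "(\<Sum>\<^sub>\<infinity>n. ((-1) powi n * q powi n * geom s n) * (s powi (m - n) * q powi ((m - n) * (m - n) + (m - n)))) = (- q) powi m * M s m" for m
  proof -
    have "((-1) powi n * q powi n * geom s n) * (s powi (m - n) * q powi ((m - n) * (m - n) + (m - n)))
      = (- q) powi m * ((- s) powi (m - n) * q powi ((m - n) * (m - n)) * geom s n)" for n
    proof -
      have 1: "(-1) powi n * s powi (m - n) = (-1) powi m * (- s) powi (m - n)"
        by (simp add: power_int_minus_left)
      have "n + ((m - n) * (m - n) + (m - n)) = m + (m - n) * (m - n)" by simp
      then have 2: "q powi n * q powi ((m - n) * (m - n) + (m - n)) = q powi m * q powi ((m - n) * (m - n))"
        by (simp only: powi_split(1)[symmetric])
      have 3: "(- q) powi m = (-1) powi m * q powi m" by (simp add: power_int_minus_left)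
      have "((-1) powi n * q powi n * geom s n) * (s powi (m - n) * q powi ((m - n) * (m - n) + (m - n)))
        = ((-1) powi n * s powi (m - n)) * (q powi n * q powi ((m - n) * (m - n) + (m - n))) * geom s n" by (simp only: mult_ac)
      also have "\<dots> = (- q) powi m * ((- s) powi (m - n) * q powi ((m - n) * (m - n)) * geom s n)"
        unfolding 1 2 3 by (simp only: mult_ac)
      finally show ?thesis .
    qed
    then show ?thesis unfolding M_def by (simp only: infsum_cmult_right')
  qed
  moreover have "(\<lambda>l. norm (s powi l * q powi (l * l + l))) summable_on UNIV"
    by (rule summable_gauss_0(1)[of "\<lambda>l. s powi l" 1]) (use norm_sign_powi(2)[OF s] in auto)
  ultimately show ?thesis
    using convolution_has_sum[OF kronecker_sum_summable[OF s], of "\<lambda>l. s powi l * q powi (l * l + l)"] by simp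
qed

text \<open>Both sequences \<open>M s\<close> satisfy a first-order recurrence with constant inhomogeneity; in \<open>S\<close> it cancels. The
  remaining factor \<open>S 0\<close> is read off the generating function \<open>\<Sum>m. S m * x ^ m\<close> at \<open>x = - q\<close>, where one of its two
  parts vanishes.\<close>

definition S :: "int \<Rightarrow> complex" where
  "S m = theta4 q * M (-1) m - theta3 q * M 1 m"

lemma S_step: "S (m + 1) = - (q powi (2 * m + 2)) * S m"
proof -
  have "M (-1) (m + 1) + q powi (2 * m + 2) * M (-1) m = theta3 q"
    unfolding theta3_def by (subst M_step) auto
  moreover have "M 1 (m + 1) + q powi (2 * m + 2) * M 1 m = theta4 q"
    unfolding theta4_def by (subst M_step) auto
  ultimately have e: "M (-1) (m + 1) = theta3 q - q powi (2 * m + 2) * M (-1) m"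
      "M 1 (m + 1) = theta4 q - q powi (2 * m + 2) * M 1 m" by (simp_all only: eq_diff_eq)
  show ?thesis unfolding S_def e by (simp add: algebra_simps)
qed

lemma S_eq: "S m = (-1) powi m * q powi (m * m + m) * S 0"
proof (induction m rule: int_induct_bidirectional)
  case (2 m)
  have "(m + 1) * (m + 1) + (m + 1) = (2 * m + 2) + (m * m + m)" by (simp add: algebra_simps)
  then have e: "q powi ((m + 1) * (m + 1) + (m + 1)) = q powi (2 * m + 2) * q powi (m * m + m)"
    by (simp only: powi_split(1))
  have e2: "(- 1 :: complex) powi (m + 1) = - ((- 1) powi m)" by (simp add: power_int_add)
  have "q powi (2 * m + 2) \<noteq> 0" by simp
  then show ?case unfolding S_step e e2 by (simp add: mult.assoc)
qed simp

lemma theta3_nz: "theta3 q \<noteq> 0"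
  using nome.theta4_nz[OF minus_nome] by (simp add: theta3_minus)

lemma S_0: "S 0 = - q * kronecker_sum * theta2 q"
proof -
  have 1: "((\<lambda>m. (- q) powi m * M 1 m) has_sum kronecker_sum * theta2 q) UNIV"
    using M_generating[of 1] unfolding kronecker_sum_def theta2_def by simp
  have 2: "((\<lambda>m. (- q) powi m * M (-1) m) has_sum 0) UNIV"
    using M_generating[of "-1"] unfolding alternating_zero by simp
  have "((\<lambda>m. theta4 q * ((- q) powi m * M (-1) m) - theta3 q * ((- q) powi m * M 1 m)) has_sum theta4 q * 0 - theta3 q * (kronecker_sum * theta2 q)) UNIV"
    by (intro has_sum_diff has_sum_cmult_right 1 2)
  moreover have "theta4 q * ((- q) powi m * M (-1) m) - theta3 q * ((- q) powi m * M 1 m) = (1 / q * S 0) * q powi ((m + 1) * (m + 1))" for m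
  proof -
    have "theta4 q * ((- q) powi m * M (-1) m) - theta3 q * ((- q) powi m * M 1 m) = (- q) powi m * S m"
      by (simp add: S_def algebra_simps)
    also have "\<dots> = ((-1) powi m * (-1) powi m) * (q powi m * q powi (m * m + m)) * S 0"
      by (subst S_eq) (simp add: power_int_minus_left)
    also have "(-1) powi m * (-1) powi m = (1 :: complex)" by (simp add: power_int_minus_left)
    also have "q powi m * q powi (m * m + m) = q powi ((m + 1) * (m + 1)) / q"
    proof -
      have "(m + 1) * (m + 1) = m + (m * m + m) + 1" by (simp add: algebra_simps)
      then have "q powi ((m + 1) * (m + 1)) = q powi m * q powi (m * m + m) * q"
        by (simp only: powi_split(1) power_int_1_right)
      then show ?thesis by simp
    qed
    finally show ?thesis by simp
  qed
  ultimately have "((\<lambda>m. (1 / q * S 0) * q powi ((m + 1) * (m + 1))) has_sum - (theta3 q * (kronecker_sum * theta2 q))) UNIV"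
    by simp
  then have "(\<Sum>\<^sub>\<infinity>m. (1 / q * S 0) * q powi ((m + 1) * (m + 1))) = - (theta3 q * (kronecker_sum * theta2 q))"
    by (rule infsumI)
  moreover have "(\<Sum>\<^sub>\<infinity>m. q powi ((m + 1) * (m + 1))) = theta3 q" unfolding theta3_def
    by (rule infsum_reindex_bij_witness[of _ "\<lambda>m. m - 1" "\<lambda>m. m + 1"]) auto
  ultimately have "(1 / q * S 0) * theta3 q = - (theta3 q * (kronecker_sum * theta2 q))"
    by (simp only: infsum_cmult_right')
  then have "theta3 q * S 0 = theta3 q * (- q * kronecker_sum * theta2 q)" by (simp add: field_simps)
  then show ?thesis unfolding mult_left_cancel[OF theta3_nz] .
qed

text \<open>The convolution of the terms of \<open>kronecker_sum\<close> with those of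
  \<open>theta3\<close>. Its total over m is the product of both, and its recurrence evaluates the
  same total as \<open>theta2\<close> times \<open>N 0\<close>.\<close>

definition N :: "int \<Rightarrow> complex" where
  "N m = (\<Sum>\<^sub>\<infinity>n. (-1) powi n * q powi n * geom 1 n * q powi ((m - n) * (m - n)))"

text \<open>The mechanism is that of \<open>M_step\<close>, but the inhomogeneity now carries an
  alternating sign and is antisymmetric under n -> 2m + 1 - n, so it drops out.\<close>

lemma N_step: "N (m + 1) = q powi (2 * m + 2) * N m"
proof -
  let ?a = "\<lambda>n. (-1) powi n * q powi n * geom 1 n * q powi ((m + 1 - n) * (m + 1 - n))"
  let ?b = "\<lambda>n. q powi (2 * m + 2) * ((-1) powi n * q powi n * geom 1 n * q powi ((m - n) * (m - n)))"
  have sm': "(\<lambda>n. (-1) powi n * q powi n * geom 1 n * q powi ((m - n) * (m - n))) summable_on UNIV" for m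
  proof -
    have "norm ((-1) powi n * geom 1 n * q powi (m * m)) \<le> 1 / (1 - norm q) * norm (q powi (m * m))" for n
      unfolding norm_mult by (intro mult_right_mono) (use norm_g[of 1 n] in auto)
    from summable_gauss[of "\<lambda>n. (-1) powi n * geom 1 n * q powi (m * m)" "1 / (1 - norm q) * norm (q powi (m * m))" "1 - 2 * m", OF this]
    have "(\<lambda>n. norm ((-1) powi n * geom 1 n * q powi (m * m) * q powi (n * n + (1 - 2 * m) * n))) summable_on UNIV" .
    moreover have "(-1) powi n * geom 1 n * q powi (m * m) * q powi (n * n + (1 - 2 * m) * n)
      = (-1) powi n * q powi n * geom 1 n * q powi ((m - n) * (m - n))" for n
    proof -
      have "m * m + (n * n + (1 - 2 * m) * n) = n + (m - n) * (m - n)" by (simp add: algebra_simps)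
      then have "q powi (m * m) * q powi (n * n + (1 - 2 * m) * n) = q powi n * q powi ((m - n) * (m - n))"
        by (simp only: powi_split(1)[symmetric])
      then show ?thesis by (simp add: mult_ac)
    qed
    ultimately have "(\<lambda>n. norm ((-1) powi n * q powi n * geom 1 n * q powi ((m - n) * (m - n)))) summable_on UNIV"
      by (simp only:)
    then show ?thesis by (rule abs_summable_summable)
  qed
  have sm: "?a summable_on UNIV" "?b summable_on UNIV"
    using sm'[of "m + 1"] sm'[of m] by (auto intro!: summable_on_cmult_right)
  have "N (m + 1) - q powi (2 * m + 2) * N m = (\<Sum>\<^sub>\<infinity>n. ?a n - ?b n)"
    unfolding N_def infsum_cmult_right'[symmetric] by (rule infsum_diff[OF sm, symmetric])
  also have "\<dots> = (\<Sum>\<^sub>\<infinity>n. (-1) powi n * q powi (n + (m + 1 - n) * (m + 1 - n)))"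
  proof (rule infsum_cong)
    fix n
    have "(2 * m + 2) + (m - n) * (m - n) = (m + 1 - n) * (m + 1 - n) + (2 * n + 1)" by (simp add: algebra_simps)
    then have e: "q powi (2 * m + 2) * q powi ((m - n) * (m - n)) = q powi ((m + 1 - n) * (m + 1 - n)) * q powi (2 * n + 1)"
      by (simp only: powi_split(1)[symmetric])
    have b: "?b n = (-1) powi n * q powi n * geom 1 n * (q powi (2 * m + 2) * q powi ((m - n) * (m - n)))" by (simp only: mult_ac)
    have gen: "a * p * h * y - a * p * h * (y * x) = a * (p * y) * ((1 - 1 * x) * h)" for a p h x y :: complex
      by (simp add: algebra_simps)
    have "?a n - ?b n = (-1) powi n * (q powi n * q powi ((m + 1 - n) * (m + 1 - n))) * ((1 - 1 * q powi (2 * n + 1)) * geom 1 n)"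
      unfolding b e by (rule gen)
    then show "?a n - ?b n = (-1) powi n * q powi (n + (m + 1 - n) * (m + 1 - n))"
      by (simp only: geom_mult powi_split(1)[symmetric] simp_thms mult_1_right)
  qed
  also have "\<dots> = 0"
  proof (rule infsum_antisym[of _ "\<lambda>n. 2 * m + 1 - n"])
    fix n
    have 1: "2 * m + 1 - n + (m + 1 - (2 * m + 1 - n)) * (m + 1 - (2 * m + 1 - n)) = n + (m + 1 - n) * (m + 1 - n)"
      by (simp add: algebra_simps)
    show "(-1) powi (2 * m + 1 - n) * q powi (2 * m + 1 - n + (m + 1 - (2 * m + 1 - n)) * (m + 1 - (2 * m + 1 - n)))
      = - ((-1) powi n * q powi (n + (m + 1 - n) * (m + 1 - n)))"
      unfolding 1 by (simp add: power_int_minus_left)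
  qed auto
  finally show ?thesis by simp
qed

lemma N_eq: "N m = q powi (m * m + m) * N 0"
proof (induction m rule: int_induct_bidirectional)
  case (2 m)
  have "(m + 1) * (m + 1) + (m + 1) = (2 * m + 2) + (m * m + m)" by (simp add: algebra_simps)
  then have e: "q powi ((m + 1) * (m + 1) + (m + 1)) = q powi (2 * m + 2) * q powi (m * m + m)"
    by (simp only: powi_split(1))
  have "q powi (2 * m + 2) \<noteq> 0" by simp
  then show ?case unfolding N_step e by (simp add: mult.assoc)
qed simp

lemma N_0: "N 0 = lambert_sum"
proof -
  have s: "(\<lambda>n. norm ((-1) powi n * geom 1 n * q powi (n * n + n))) summable_on UNIV"
    by (rule summable_gauss_0(1)[of _ "1 / (1 - norm q)"]) (use norm_g[of 1] in \<open>simp add: norm_mult\<close>)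
  have "N 0 = (\<Sum>\<^sub>\<infinity>n. (-1) powi n * geom 1 n * q powi (n * n + n))"
    unfolding N_def by (intro infsum_cong) (simp add: powi_split(1) mult_ac)
  also have "\<dots> = (\<Sum>\<^sub>\<infinity>r::nat. (-1) powi (int r) * geom 1 (int r) * q powi (int r * int r + int r) +
       (-1) powi (- 1 - int r) * geom 1 (- 1 - int r) * q powi ((- 1 - int r) * (- 1 - int r) + (- 1 - int r)))"
    by (rule infsum_fold_int(1)[OF s])
  also have "\<dots> = (\<Sum>\<^sub>\<infinity>r::nat. lambert_alpha (int r))"
  proof (rule infsum_cong)
    fix r :: nat
    have 1: "(- 1 - int r) * (- 1 - int r) + (- 1 - int r) = int r * int r + int r" by (simp add: algebra_simps)
    have 2: "(-1 :: complex) powi (- 1 - int r) = - ((-1) powi int r)" by (simp add: power_int_minus_left)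
    show "(-1) powi (int r) * geom 1 (int r) * q powi (int r * int r + int r) +
       (-1) powi (- 1 - int r) * geom 1 (- 1 - int r) * q powi ((- 1 - int r) * (- 1 - int r) + (- 1 - int r)) = lambert_alpha (int r)"
      unfolding 1 2 lambert_alpha_def geom_reflect[of 1, simplified]
      by (simp add: geom_def add_divide_distrib algebra_simps)
  qed
  finally show ?thesis by (simp add: lambert_sum_def)
qed

lemma kronecker_sum_theta3: "lambert_sum * theta2 q = kronecker_sum * theta3 q"
proof -
  have "(\<lambda>l. norm (q powi (l * l))) summable_on UNIV"
    using summable_gauss_0(2)[of "\<lambda>_. 1" 1] by simp
  from convolution_int[OF kronecker_sum_summable this, of 1]
  have "(\<Sum>\<^sub>\<infinity>m. N m) = kronecker_sum * theta3 q"
    unfolding N_def[symmetric] kronecker_sum_def theta3_def by simp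
  also have "(\<Sum>\<^sub>\<infinity>m. N m) = (\<Sum>\<^sub>\<infinity>m. q powi (m * m + m) * lambert_sum)"
    by (subst N_eq) (simp add: N_0)
  also have "\<dots> = theta2 q * lambert_sum" unfolding theta2_def by (rule infsum_cmult_left')
  finally show ?thesis by (simp add: mult.commute)
qed

text \<open>The indices r and -1 - r contribute equally, hence the factor 2. For -q the sign comes
  from (r + 1)^2 having the parity of r + 1.\<close>

lemma appell_sum_alt: "2 * appell_sum = (\<Sum>\<^sub>\<infinity>n::int. (-1) powi n * q powi ((n + 1) * (n + 1)) * geom 1 n)"
  "- 2 * nome.appell_sum (- q) = (\<Sum>\<^sub>\<infinity>n::int. q powi ((n + 1) * (n + 1)) * geom (-1) n)"
proof -
  have ex: "q powi ((- 1 - int r + 1) * (- 1 - int r + 1)) * q powi (2 * int r + 1) = q ^ ((r + 1)\<^sup>2)"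
     "q powi ((int r + 1) * (int r + 1)) = q ^ ((r + 1)\<^sup>2)" for r
  proof -
    have 1: "(- 1 - int r + 1) * (- 1 - int r + 1) + (2 * int r + 1) = int ((r + 1)\<^sup>2)"
      "(int r + 1) * (int r + 1) = int ((r + 1)\<^sup>2)"
      by (simp_all add: power2_eq_square algebra_simps)
    show "q powi ((- 1 - int r + 1) * (- 1 - int r + 1)) * q powi (2 * int r + 1) = q ^ ((r + 1)\<^sup>2)"
       "q powi ((int r + 1) * (int r + 1)) = q ^ ((r + 1)\<^sup>2)"
      unfolding powi_split(1)[symmetric] 1 power_int_of_nat by simp_all
  qed
  have s1: "(\<lambda>n::int. norm (((-1) powi n * q powi ((n + 1) * (n + 1)) * geom 1 n))) summable_on UNIV"
  proof -
    have "norm ((-1) powi n * geom 1 n) \<le> 1 / (1 - norm q)" for n using norm_g[of 1 n] by (simp add: norm_mult)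
    from summable_shift_gauss[of "\<lambda>n. (-1) powi n * geom 1 n" "1 / (1 - norm q)" "-1", OF this]
    show ?thesis by (simp add: algebra_simps)
  qed
  have s2: "(\<lambda>n::int. norm ((q powi ((n + 1) * (n + 1)) * geom (-1) n))) summable_on UNIV"
  proof -
    have "norm (geom (-1) n) \<le> 1 / (1 - norm q)" for n using norm_g[of "-1" n] by simp
    from summable_shift_gauss[of "\<lambda>n. geom (-1) n" "1 / (1 - norm q)" "-1", OF this]
    show ?thesis by (simp add: algebra_simps)
  qed
  have "(\<Sum>\<^sub>\<infinity>n::int. (-1) powi n * q powi ((n + 1) * (n + 1)) * geom 1 n) = (\<Sum>\<^sub>\<infinity>r::nat. 2 * ((-1) ^ r * q ^ ((r + 1)\<^sup>2) / (1 - q ^ (2 * r + 1))))"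
    unfolding infsum_fold_int(1)[OF s1]
  proof (rule infsum_cong)
    fix r :: nat
    have 2: "(-1 :: complex) powi (- 1 - int r) = - ((-1) ^ r)" by (simp add: power_int_minus_left)
    have "(-1) powi (- 1 - int r) * q powi ((- 1 - int r + 1) * (- 1 - int r + 1)) * geom 1 (- 1 - int r) =
       (-1) ^ r * (q powi ((- 1 - int r + 1) * (- 1 - int r + 1)) * q powi (2 * int r + 1)) * geom 1 (int r)"
      unfolding 2 by (subst geom_reflect) simp_all
    then show "(-1) powi (int r) * q powi ((int r + 1) * (int r + 1)) * geom 1 (int r) +
       (-1) powi (- 1 - int r) * q powi ((- 1 - int r + 1) * (- 1 - int r + 1)) * geom 1 (- 1 - int r) = 2 * ((-1) ^ r * q ^ ((r + 1)\<^sup>2) / (1 - q ^ (2 * r + 1)))"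
      unfolding ex by (simp add: geom_def odd_powi)
  qed
  also have "\<dots> = 2 * appell_sum" unfolding appell_sum_def by (rule infsum_cmult_right')
  finally show "2 * appell_sum = (\<Sum>\<^sub>\<infinity>n::int. (-1) powi n * q powi ((n + 1) * (n + 1)) * geom 1 n)" by simp
  have "(\<Sum>\<^sub>\<infinity>n::int. q powi ((n + 1) * (n + 1)) * geom (-1) n) = (\<Sum>\<^sub>\<infinity>r::nat. (- 2) * ((-1) ^ r * (- q) ^ ((r + 1)\<^sup>2) / (1 - (- q) ^ (2 * r + 1))))"
    unfolding infsum_fold_int(1)[OF s2]
  proof (rule infsum_cong)
    fix r :: nat
    have "q powi ((- 1 - int r + 1) * (- 1 - int r + 1)) * geom (-1) (- 1 - int r) =
       (q powi ((- 1 - int r + 1) * (- 1 - int r + 1)) * q powi (2 * int r + 1)) * geom (-1) (int r)"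
      by (subst geom_reflect) simp_all
    moreover have "(-1) ^ r * (- q) ^ ((r + 1)\<^sup>2) = - (q ^ ((r + 1)\<^sup>2))"
      by (cases "even r") (simp_all add: uminus_power_if)
    moreover have "(- q) ^ (2 * r + 1) = - (q ^ (2 * r + 1))" by simp
    ultimately show "q powi ((int r + 1) * (int r + 1)) * geom (-1) (int r) +
       q powi ((- 1 - int r + 1) * (- 1 - int r + 1)) * geom (-1) (- 1 - int r) = (- 2) * ((-1) ^ r * (- q) ^ ((r + 1)\<^sup>2) / (1 - (- q) ^ (2 * r + 1)))"
      unfolding ex by (simp only: geom_def odd_powi) simp
  qed
  also have "\<dots> = - 2 * nome.appell_sum (- q)" unfolding nome.appell_sum_def[OF minus_nome] by (rule infsum_cmult_right')
  finally show "- 2 * nome.appell_sum (- q) = (\<Sum>\<^sub>\<infinity>n::int. q powi ((n + 1) * (n + 1)) * geom (-1) n)" by simp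
qed

text \<open>\<open>S (-1)\<close> consists of the two Appell sums, \<open>S 0\<close> is evaluated
  by \<open>S_0\<close>, and one step of the recurrence, with factor -1, joins them.
  \<open>kronecker_sum\<close> is then eliminated through
  \<open>kronecker_sum_theta3\<close>.\<close>

lemma odd_part_aux: "4 * (theta3 q * appell_sum - theta4 q * nome.appell_sum (- q)) = q * theta2 q ^ 3"
proof -
  have "S (-1) = - S 0" using S_step[of "-1"] by simp
  then have 1: "S (-1) = q * kronecker_sum * theta2 q" unfolding S_0 by simp
  have 2: "M (-1) (-1) = - 2 * nome.appell_sum (- q)"
    unfolding M_def appell_sum_alt by (intro infsum_cong) (simp add: algebra_simps)
  have 3: "M 1 (-1) = - (2 * appell_sum)"
    unfolding M_def appell_sum_alt infsum_uminus[symmetric]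
    by (intro infsum_cong) (simp add: power_int_minus_left algebra_simps)
  have "theta4 q * (- 2 * nome.appell_sum (- q)) - theta3 q * (- (2 * appell_sum)) = q * kronecker_sum * theta2 q"
    using 1 unfolding S_def 2 3 .
  then have "2 * theta3 q * (2 * (theta3 q * appell_sum - theta4 q * nome.appell_sum (- q))) = q * theta2 q * (2 * (kronecker_sum * theta3 q))"
    by algebra
  also have "2 * (kronecker_sum * theta3 q) = theta3 q * theta2 q * theta2 q"
    unfolding kronecker_sum_theta3[symmetric] theta_products(2) by simp
  finally show ?thesis using theta3_nz by (simp add: power3_eq_cube)
qed

section \<open>Products of two theta series\<close>

lemma theta3_theta4: "theta3 q * theta4 q = (theta4 (q\<^sup>2))\<^sup>2"
proof -
  let ?h = "\<lambda>(s,d). q powi (s * s) * ((-1) powi d * q powi (d * d))"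
  have s: "(\<lambda>l. norm (q powi (l * l))) summable_on UNIV" "(\<lambda>l. norm ((-1) powi l * q powi (l * l))) summable_on UNIV"
    using summable_gauss_0(2)[of "\<lambda>_. 1" 1] summable_gauss_0(2)[of "\<lambda>l. (-1) powi l" 1] by simp_all
  have h: "theta3 q * theta4 q = infsum ?h UNIV" "?h summable_on UNIV"
    using infsum_product[OF s] unfolding theta3_def theta4_def by simp_all
  \<comment> \<open>When s + d is odd, exchanging s and d changes the sign of the term.\<close>
  have 0: "infsum ?h {(s,d). odd (s + d)} = 0"
    by (rule infsum_antisym[of _ "\<lambda>(s,d). (d, s)"]) (auto simp: power_int_minus_left)
  interpret sq: nome "q\<^sup>2" by (rule nome_sq)
  have s': "(\<lambda>l. norm ((-1) powi l * (q\<^sup>2) powi (l * l))) summable_on UNIV"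
    using sq.summable_gauss_0(2)[of "\<lambda>l. (-1) powi l" 1] by simp
  have "(theta4 (q\<^sup>2))\<^sup>2 = (\<Sum>\<^sub>\<infinity>(i,j). ((-1) powi i * (q\<^sup>2) powi (i * i)) * ((-1) powi j * (q\<^sup>2) powi (j * j)))"
    using infsum_product(1)[OF s' s'] unfolding theta4_def power2_eq_square[of "infsum _ _"] by simp
  also have "\<dots> = (\<Sum>\<^sub>\<infinity>(i,j). ?h (i + j, i - j))"
  proof (rule infsum_cong, clarify)
    fix i j :: int
    have "(i + j) * (i + j) + (i - j) * (i - j) = 2 * (i * i) + 2 * (j * j)" by (simp add: algebra_simps)
    then have e: "q powi ((i + j) * (i + j)) * q powi ((i - j) * (i - j)) = q powi (2 * (i * i)) * q powi (2 * (j * j))"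
      by (simp only: powi_split(1)[symmetric])
    have e2: "(q\<^sup>2) powi k = q powi (2 * k)" for k by (simp add: power_int_mult)
    have "((-1) powi i * (q\<^sup>2) powi (i * i)) * ((-1) powi j * (q\<^sup>2) powi (j * j)) =
       ((-1) powi i * (-1) powi j) * (q powi ((i + j) * (i + j)) * q powi ((i - j) * (i - j)))"
      unfolding e e2 by (simp only: mult_ac)
    also have "(-1) powi i * (-1) powi j = ((-1) powi (i - j) :: complex)" by (simp add: power_int_minus_left)
    finally show "((-1) powi i * (q\<^sup>2) powi (i * i)) * ((-1) powi j * (q\<^sup>2) powi (j * j)) =
       q powi ((i + j) * (i + j)) * ((-1) powi (i - j) * q powi ((i - j) * (i - j)))"
      by (simp only: mult_ac)
  qed
  finally show ?thesis unfolding h(1) parity_split(1)[OF h(2)] 0 by simp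
qed

lemma psi_squared: "(psi q)\<^sup>2 = lambert_sum"
proof -
  let ?h = "\<lambda>(s,d). q powi (s * s + s) * q powi (d * d)"
  have s: "(\<lambda>l. norm (q powi (l * l + l))) summable_on UNIV" "(\<lambda>l. norm (q powi (l * l))) summable_on UNIV"
    using summable_gauss_0[of "\<lambda>_. 1" 1] by simp_all
  have h: "theta2 q * theta3 q = infsum ?h UNIV" "?h summable_on UNIV"
    using infsum_product[OF s] unfolding theta3_def theta2_def by simp_all
  \<comment> \<open>The reflection s -> -1 - s keeps s^2 + s and reverses the parity of s + d, so
    both classes contribute the same amount.\<close>
  have 0: "infsum ?h {(s,d). odd (s + d)} = infsum ?h {(s,d). even (s + d)}"
  proof (rule infsum_reindex_bij_witness[of _ "\<lambda>(s,d). (- 1 - s, d)" "\<lambda>(s,d). (- 1 - s, d)"]; clarify)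
    fix s d :: int
    have "(- 1 - s) * (- 1 - s) + (- 1 - s) = s * s + s" by (simp add: algebra_simps)
    then show "q powi ((- 1 - s) * (- 1 - s) + (- 1 - s)) * q powi (d * d) = q powi (s * s + s) * q powi (d * d)"
      by (simp only:)
  qed auto
  have "(psi q)\<^sup>2 = (\<Sum>\<^sub>\<infinity>(i,j). q powi (2 * (i * i) + i) * q powi (2 * (j * j) + j))"
    using infsum_product(1)[OF summable_gauss_psi(1) summable_gauss_psi(1)]
    unfolding psi_def power2_eq_square[of "infsum _ _"] by simp
  also have "\<dots> = (\<Sum>\<^sub>\<infinity>(i,j). ?h (i + j, i - j))"
  proof (rule infsum_cong, clarify)
    fix i j :: int
    have "(i + j) * (i + j) + (i + j) + (i - j) * (i - j) = 2 * (i * i) + i + (2 * (j * j) + j)" by (simp add: algebra_simps)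
    then show "q powi (2 * (i * i) + i) * q powi (2 * (j * j) + j) = q powi ((i + j) * (i + j) + (i + j)) * q powi ((i - j) * (i - j))"
      by (simp only: powi_split(1)[symmetric])
  qed
  finally have "theta2 q * theta3 q = 2 * (psi q)\<^sup>2"
    unfolding h(1) parity_split(1)[OF h(2)] 0 parity_split(2)[OF h(2)] by simp
  then show ?thesis using theta_products(2) by (simp add: mult.commute)
qed

theorem phi_odd_part: "(phi q - phi (- q)) * (theta4 (q\<^sup>2))\<^sup>2 = 2 * q * psi (q\<^sup>2) ^ 3"
proof -
  have *: "phi (- q) * theta3 q = nome.appell_sum (- q)"
    using nome.phi_theta4[OF minus_nome] by (simp add: theta3_minus)
  have "4 * ((phi q - phi (- q)) * (theta3 q * theta4 q)) =
      4 * (theta3 q * (phi q * theta4 q) - theta4 q * (phi (- q) * theta3 q))"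
    by (simp add: algebra_simps)
  then have "4 * ((phi q - phi (- q)) * (theta3 q * theta4 q)) = q * theta2 q ^ 3"
    unfolding phi_theta4 * odd_part_aux .
  then show ?thesis unfolding theta3_theta4 theta2_psi by (simp add: power_mult_distrib)
qed

theorem jac_square: "jac (q\<^sup>2) = theta4 q * (psi q)\<^sup>2" "jac (q\<^sup>2) = (theta4 (q\<^sup>2))\<^sup>2 * psi (q\<^sup>2)"
proof -
  show "jac (q\<^sup>2) = theta4 q * (psi q)\<^sup>2"
    using theta_products(1) psi_squared by (simp add: mult.commute)
  have "2 * jac (q\<^sup>2) = theta3 q * theta2 q * theta4 q"
    unfolding theta_products(2) using theta_products(1) by simp
  then show "jac (q\<^sup>2) = (theta4 (q\<^sup>2))\<^sup>2 * psi (q\<^sup>2)"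
    unfolding theta2_psi theta3_theta4[symmetric] by simp
qed

end

subsection \<open>Power series modulo 5\<close>

text \<open>The numeral type \<open>5\<close> is only an instance of \<open>comm_ring_1\<close>; the copy below is an integral domain.\<close>

typedef gf5 = "UNIV :: 5 set" ..

setup_lifting type_definition_gf5

lemma cases_5:
  fixes x :: 5
  shows "x \<in> {0, 1, 2, 3, 4}"
proof (cases x rule: bit1_cases)
  case (of_int z)
  then have "z \<in> {0,1,2,3,4}" by auto
  then show ?thesis using of_int(1) by auto
qed

instantiation gf5 :: idom
begin

lift_definition zero_gf5 :: gf5 is 0 .
lift_definition one_gf5 :: gf5 is 1 .
lift_definition plus_gf5 :: "gf5 \<Rightarrow> gf5 \<Rightarrow> gf5" is "(+)" .
lift_definition minus_gf5 :: "gf5 \<Rightarrow> gf5 \<Rightarrow> gf5" is "(-)" .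
lift_definition times_gf5 :: "gf5 \<Rightarrow> gf5 \<Rightarrow> gf5" is "(*)" .
lift_definition uminus_gf5 :: "gf5 \<Rightarrow> gf5" is "uminus" .

instance
proof
  fix a b c :: gf5
  show "a \<noteq> 0 \<Longrightarrow> b \<noteq> 0 \<Longrightarrow> a * b \<noteq> 0"
  proof (transfer)
    fix a b :: 5
    show "a \<noteq> 0 \<Longrightarrow> b \<noteq> 0 \<Longrightarrow> a * b \<noteq> 0"
      using cases_5[of a] cases_5[of b] by auto
  qed
qed (transfer; simp add: algebra_simps)+

end

lemma Rep_gf5_of_int: "Rep_gf5 (of_int z) = of_int z"
proof -
  have "Rep_gf5 (of_nat n) = of_nat n" for n
    by (induction n) (simp_all add: zero_gf5.rep_eq one_gf5.rep_eq plus_gf5.rep_eq)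
  then show ?thesis
    by (cases z rule: int_cases2) (simp_all add: uminus_gf5.rep_eq)
qed

lemma gf5_of_int_eq_0_iff: "(of_int z :: gf5) = 0 \<longleftrightarrow> 5 dvd z"
proof -
  have "(of_int z :: gf5) = 0 \<longleftrightarrow> Rep_gf5 (of_int z) = Rep_gf5 0"
    by (simp only: Rep_gf5_inject)
  also have "\<dots> \<longleftrightarrow> (of_int z :: 5) = 0" by (simp add: Rep_gf5_of_int zero_gf5.rep_eq)
  also have "\<dots> \<longleftrightarrow> 5 dvd z" by (simp add: of_int_eq_0_iff_char_dvd)
  finally show ?thesis .
qed

lemma gf5_of_int_eq_iff: "(of_int x :: gf5) = of_int y \<longleftrightarrow> x mod 5 = y mod 5"
  using gf5_of_int_eq_0_iff[of "x - y"] by (simp add: mod_eq_dvd_iff)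

lemma gf5_cases:
  fixes x :: gf5
  obtains z :: int where "x = of_int z" "z \<in> {0, 1, 2, 3, 4}"
proof -
  obtain z where z: "Rep_gf5 x = of_int z" "0 \<le> z" "z < 5"
    by (cases "Rep_gf5 x" rule: bit1_cases) auto
  then have "x = of_int z" by (metis Rep_gf5_inject Rep_gf5_of_int)
  moreover have "z \<in> {0, 1, 2, 3, 4}" using z(2,3) by auto
  ultimately show ?thesis using that by blast
qed

lemma gf5_six: "(6 :: gf5) = 1"
  using gf5_of_int_eq_iff[of 6 1] by simp

section \<open>The derivation q d/dq, the substitution of q^5, and the section at exponents 5n +
  4\<close>

definition theta_deriv :: "'a :: comm_ring_1 fps \<Rightarrow> 'a fps" where
  "theta_deriv f = fps_X * fps_deriv f"

lemma theta_deriv_nth: "theta_deriv f $ n = of_nat n * f $ n"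
  by (cases n) (simp_all add: theta_deriv_def)

lemma theta_deriv_simps:
  "theta_deriv (f + g) = theta_deriv f + theta_deriv g"
  "theta_deriv (f - g) = theta_deriv f - theta_deriv g"
  "theta_deriv (f * g) = theta_deriv f * g + f * theta_deriv g"
  "theta_deriv (f ^ n) = of_nat n * f ^ (n - 1) * theta_deriv f"
  "theta_deriv (numeral k) = 0" "theta_deriv 0 = 0" "theta_deriv 1 = 0"
  "theta_deriv (- f) = - theta_deriv f" "theta_deriv fps_X = fps_X"
  by (simp_all add: theta_deriv_def algebra_simps fps_deriv_power')

lemma fps_unit_cancel:
  fixes f :: "'a :: comm_ring_1 fps"
  assumes "f $ 0 * y = 1" "f * x = 0" shows "x = 0"
proof -
  have "f * fps_right_inverse f y = 1" by (rule fps_right_inverse[OF assms(1)])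
  then have "x = (f * fps_right_inverse f y) * x" by (simp only: mult_1_left)
  also have "\<dots> = fps_right_inverse f y * (f * x)" by (simp only: mult_ac)
  finally show ?thesis using assms(2) by simp
qed

definition subst5 :: "'a :: comm_ring_1 fps \<Rightarrow> 'a fps" where
  "subst5 f = Abs_fps (\<lambda>n. if 5 dvd n then f $ (n div 5) else 0)"

definition sect5 :: "'a :: comm_ring_1 fps \<Rightarrow> 'a fps" where
  "sect5 f = Abs_fps (\<lambda>n. f $ (5 * n + 4))"

lemma sect5_simps:
  "sect5 (f + g) = sect5 f + sect5 g" "sect5 (f - g) = sect5 f - sect5 g" "sect5 (- f) = - sect5 f"
  by (simp_all add: sect5_def fps_eq_iff)

lemma sect5_mult_subst5: "sect5 (f * subst5 g) = sect5 f * g"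
proof (rule fps_ext)
  fix n
  have "(subst5 g * f) $ (5 * n + 4) = (\<Sum>i=0..5*n+4. subst5 g $ i * f $ (5 * n + 4 - i))"
    by (rule fps_mult_nth)
  also have "\<dots> = (\<Sum>i\<in>(*) 5 ` {0..n}. subst5 g $ i * f $ (5 * n + 4 - i))"
  proof (rule sum.mono_neutral_right)
    show "\<forall>i\<in>{0..5 * n + 4} - (*) 5 ` {0..n}. subst5 g $ i * f $ (5 * n + 4 - i) = 0"
      by (auto simp: subst5_def)
  qed auto
  also have "\<dots> = (\<Sum>l=0..n. g $ l * f $ (5 * (n - l) + 4))"
    by (subst sum.reindex) (auto simp: inj_on_def subst5_def diff_mult_distrib2 intro!: sum.cong arg_cong[of _ _ "fps_nth f"])
  also have "\<dots> = (g * sect5 f) $ n"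
    by (simp add: fps_mult_nth sect5_def)
  finally show "sect5 (f * subst5 g) $ n = (sect5 f * g) $ n"
    by (simp add: sect5_def mult.commute)
qed

lemma five_eq_0: "(5 :: gf5 fps) = 0"
proof -
  have "(5 :: gf5) = 0" using gf5_of_int_eq_0_iff[of 5] by simp
  then show ?thesis by (metis fps_const_0_eq_0 numeral_fps_const)
qed

lemma pow5_eq: "(x :: gf5) ^ 5 = x"
proof (cases x rule: gf5_cases)
  case (1 z)
  then have "z ^ 5 mod 5 = z mod 5" by auto
  then show ?thesis unfolding 1(1) by (simp only: of_int_power[symmetric] gf5_of_int_eq_iff)
qed

text \<open>The unit group has order 4, which is prime to 3.\<close>

lemma cube_eq_1:
  assumes "(x :: gf5) ^ 3 = 1" shows "x = 1"
proof (cases x rule: gf5_cases)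
  case (1 z)
  then have "z ^ 3 mod 5 = 1 mod 5"
    using assms gf5_of_int_eq_iff[of "z ^ 3" 1] by simp
  then have "z mod 5 = 1 mod 5" using 1(2) by auto
  then show ?thesis unfolding 1(1) using gf5_of_int_eq_iff[of z 1] by simp
qed

text \<open>Splitting off the constant term leaves a series whose fifth power is needed five places
  lower, so the induction runs on the coefficient index. The constant is its own fifth power by
  \<open>pow5_eq\<close>.\<close>

lemma frobenius: "(f :: gf5 fps) ^ 5 = subst5 f"
proof (rule fps_ext)
  fix n show "(f ^ 5) $ n = subst5 f $ n"
  proof (induction n arbitrary: f rule: less_induct)
    case (less n)
    define c h where "c = fps_const (f $ 0)" and "h = fps_shift 1 f"
    have "f = c + fps_X * h"
      by (rule fps_ext) (auto simp: c_def h_def)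
    then have "f ^ 5 = (c + fps_X * h) ^ 5" by simp
    also have "\<dots> = c ^ 5 + fps_X ^ 5 * h ^ 5 + 5 * (c ^ 4 * (fps_X * h) + 2 * c ^ 3 * (fps_X * h) ^ 2
       + 2 * c ^ 2 * (fps_X * h) ^ 3 + c * (fps_X * h) ^ 4)" by algebra
    also have "\<dots> = c + fps_X ^ 5 * h ^ 5" by (simp add: five_eq_0 c_def pow5_eq fps_const_power)
    finally have e: "(f ^ 5) $ n = (if n = 0 then f $ 0 else 0) + (if n < 5 then 0 else (h ^ 5) $ (n - 5))"
      by (simp add: c_def fps_X_power_mult_nth)
    show ?case
    proof (cases "n < 5")
      case True
      then show ?thesis unfolding e by (auto simp: subst5_def dest: dvd_imp_le)
    next
      case False
      then have "(h ^ 5) $ (n - 5) = subst5 h $ (n - 5)" by (intro less) auto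
      also have "\<dots> = subst5 f $ n" using False
        by (auto simp: subst5_def h_def le_div_geq dvd_minus_self)
      finally show ?thesis unfolding e using False by simp
    qed
  qed
qed

text \<open>At exponent 5n + 4 the operator multiplies the coefficient by 5n + 5.\<close>

lemma sect5_shifted_deriv: "sect5 (theta_deriv f + f) = (0 :: gf5 fps)"
proof (rule fps_ext)
  fix n
  have "sect5 (theta_deriv f + f) $ n = (of_nat (5 * n + 4) + 1) * f $ (5 * n + 4)"
    by (simp add: sect5_def theta_deriv_nth algebra_simps)
  also have "of_nat (5 * n + 4) + 1 = (of_int (5 * (int n + 1)) :: gf5)" by simp
  also have "\<dots> = 0" unfolding gf5_of_int_eq_0_iff by simp
  finally show "sect5 (theta_deriv f + f) $ n = (0 :: gf5 fps) $ n" by simp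
qed

text \<open>In characteristic 5 the constants of the derivation are the series in q^5, and these
  pass through the section.\<close>

lemma sect5_mult_const:
  fixes f k :: "gf5 fps"
  assumes "theta_deriv k = 0" "sect5 f = 0"
  shows "sect5 (f * k) = 0"
proof -
  have "k $ n = 0" if "\<not> 5 dvd n" for n
  proof -
    have 1: "(of_nat n :: gf5) * k $ n = 0"
      using assms(1) theta_deriv_nth[of k n] by simp
    have "(of_nat n :: gf5) \<noteq> 0"
      using that gf5_of_int_eq_0_iff[of "int n"] by (simp add: int_dvd_int_iff[symmetric])
    then show ?thesis using 1 by simp
  qed
  then have "k = subst5 (Abs_fps (\<lambda>n. k $ (5 * n)))"
    by (auto simp: fps_eq_iff subst5_def)
  then have "sect5 (f * k) = sect5 f * Abs_fps (\<lambda>n. k $ (5 * n))"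
    by (metis sect5_mult_subst5)
  then show ?thesis using assms(2) by simp
qed

lemma zero5: "5 * (x :: gf5 fps) = 0"
  by (simp add: five_eq_0)

lemma cube_root_unique:
  fixes u v :: "gf5 fps"
  assumes "u ^ 3 = v ^ 3" "u $ 0 = 1" "v $ 0 = 1"
  shows "u = v"
proof -
  have "(u ^ 2 + u * v + v ^ 2) * (u - v) = 0"
    using assms(1) by algebra
  \<comment> \<open>The constant term is 3, with inverse 2 modulo 5.\<close>
  moreover have "(u ^ 2 + u * v + v ^ 2) $ 0 * 2 = 1"
    using assms(2,3) by (simp add: fps_power_zeroth gf5_six)
  ultimately show ?thesis using fps_unit_cancel[of "u ^ 2 + u * v + v ^ 2" 2 "u - v"] by simp
qed


text \<open>Here \<open>p\<close> and \<open>s\<close> are the series of \<open>theta4\<close> and \<open>psi\<close>. Exponents of theta series are squares up to scaling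
  and shifting, and fourth powers are 0 or 1 modulo 5: hence the differential equations. Eliminating
  from them the powers \<open>p ^ 24\<close> and \<open>s ^ 24\<close>, and differentiating once, gives a cubic relation between the
  logarithmic derivatives \<open>a\<close> of \<open>p\<close> and \<open>b\<close> of \<open>q powr (1/8) * s\<close> (as \<open>1/8 = 2\<close>), which is parametrised by
  the Eisenstein series \<open>e\<close>.\<close>

lemma theta_relation:
  fixes p s :: "gf5 fps"
  assumes p0: "p $ 0 = 1" and s0: "s $ 0 = 1"
    and Dp: "theta_deriv (theta_deriv p) = p - p ^ 25"
    and Ds: "theta_deriv (theta_deriv s) + 4 * theta_deriv s + 4 * s = - s + fps_X ^ 3 * s ^ 25"
    and Dj: "theta_deriv (theta_deriv (p ^ 2 * s)) + 4 * theta_deriv (p ^ 2 * s) + 4 * (p ^ 2 * s) = - (p ^ 2 * s)"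
    and Dk: "theta_deriv (theta_deriv (p * s ^ 2)) + 8 * theta_deriv (p * s ^ 2) + 16 * (p * s ^ 2) = p * s ^ 2"
  obtains e where "e $ 0 = 1" "theta_deriv e = 1 - e ^ 4" "theta_deriv p = (e ^ 3 - e) * p"
    "theta_deriv s = (e ^ 3 + e - 2) * s" "fps_X * (p * s) ^ 8 = - (1 - e ^ 4)"
proof -
  let ?D = theta_deriv
  have pc: "x = 0" if "p * x = 0" for x using fps_unit_cancel[of p 1 x] p0 that by simp
  have sc: "x = 0" if "s * x = 0" for x using fps_unit_cancel[of s 1 x] s0 that by simp
  define pi si where "pi = fps_right_inverse p 1" and "si = fps_right_inverse s 1"
  have pi: "p * pi = 1" and si: "s * si = 1"
    unfolding pi_def si_def using p0 s0 by (auto intro: fps_right_inverse)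
  define a b where "a = ?D p * pi" and "b = 2 + ?D s * si"
  have Dp1: "?D p = a * p" using pi unfolding a_def by (simp add: mult_ac)
  have Ds1: "?D s = (b - 2) * s" using si unfolding b_def by (simp add: mult_ac)
  \<comment> \<open>In terms of \<open>A\<close> and \<open>B\<close> the second-order equations
    become Riccati equations for the logarithmic derivatives.\<close>
  define A B where "A = p ^ 24" and "B = fps_X ^ 3 * s ^ 24"
  have p25: "p ^ 25 = p * A" "fps_X ^ 3 * s ^ 25 = s * B"
    unfolding A_def B_def by (simp_all add: eval_nat_numeral mult_ac)
  have Da: "?D a = 1 - A - a ^ 2"
  proof -
    have "?D (a * p) = p - p * A" using Dp unfolding Dp1 p25 .
    then have "p * (?D a - (1 - A - a ^ 2)) = 0" unfolding theta_deriv_simps Dp1 by algebra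
    from pc[OF this] show ?thesis by (simp only: right_minus_eq)
  qed
  have Db: "?D b = B - 1 - b ^ 2"
  proof -
    have "?D ((b - 2) * s) + 4 * ((b - 2) * s) + 4 * s = - s + s * B" using Ds unfolding Ds1 p25 .
    then have "s * (?D b - (B - 1 - b ^ 2)) = 0" unfolding theta_deriv_simps Ds1 by algebra
    from sc[OF this] show ?thesis by (simp only: right_minus_eq)
  qed
  \<comment> \<open>The shifted logarithmic derivative of p^2 s is 2a + b. Its Riccati equation has
    constant right-hand side, so inserting those of a and b leaves an algebraic relation;
    \<open>R2\<close> uses a + 2b in the same way.\<close>
  have R1: "2 * a ^ 2 + 4 * a * b + 2 - 2 * A + B = 0"
  proof -
    have 1: "?D (p ^ 2 * s) = (2 * a + b - 2) * (p ^ 2 * s)"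
      unfolding theta_deriv_simps Dp1 Ds1 by (simp add: algebra_simps power2_eq_square)
    have "?D ((2 * a + b - 2) * (p ^ 2 * s)) = (2 * ?D a + ?D b) * (p ^ 2 * s) + (2 * a + b - 2) * ((2 * a + b - 2) * (p ^ 2 * s))"
      unfolding theta_deriv_simps(3)[of "2 * a + b - 2"] 1 by (simp add: theta_deriv_simps)
    then have "p * (p * (s * (2 * a ^ 2 + 4 * a * b + 2 - 2 * A + B))) = 0"
      using Dj unfolding 1 Da Db by algebra
    from sc[OF pc[OF pc[OF this]]] show ?thesis .
  qed
  have R2: "4 * a * b + 2 * b ^ 2 - 2 - A + 2 * B = 0"
  proof -
    have 1: "?D (p * s ^ 2) = (a + 2 * b - 4) * (p * s ^ 2)"
      unfolding theta_deriv_simps Dp1 Ds1 by (simp add: algebra_simps power2_eq_square)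
    have "?D ((a + 2 * b - 4) * (p * s ^ 2)) = (?D a + 2 * ?D b) * (p * s ^ 2) + (a + 2 * b - 4) * ((a + 2 * b - 4) * (p * s ^ 2))"
      unfolding theta_deriv_simps(3)[of "a + 2 * b - 4"] 1 by (simp add: theta_deriv_simps)
    then have "p * (s * (s * (4 * a * b + 2 * b ^ 2 - 2 - A + 2 * B))) = 0"
      using Dk unfolding 1 Da Db by algebra
    from sc[OF sc[OF pc[OF this]]] show ?thesis .
  qed
  \<comment> \<open>\<open>R1\<close> and \<open>R2\<close> are linear in \<open>A\<close> and
    \<open>B\<close> with determinant -3, which is invertible modulo 5.\<close>
  have A: "A = 3 * a ^ 2 + 3 * a * b + b ^ 2 + 2"
  proof -
    have "A = 3 * a ^ 2 + 3 * a * b + b ^ 2 + 2 + 5 * (a ^ 2 + a * b - b ^ 2 + 2 - A)"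
      using R1 R2 by algebra
    then show ?thesis by (simp only: zero5 add_0_right)
  qed
  have B: "B = 4 * a ^ 2 + 2 * a * b + 2 * b ^ 2 + 2"
    using R1 A by algebra
  have DA: "?D A = 24 * a * A"
    unfolding A_def theta_deriv_simps Dp1 by (simp add: eval_nat_numeral mult_ac)
  \<comment> \<open>The formula for \<open>A\<close> is differentiated: 6a + 3b and 3a + 2b are its
    partial derivatives. Directly, \<open>?D A\<close> is 24aA, which is -aA modulo 5.\<close>
  have "(6 * a + 3 * b) * (1 - A - a ^ 2) + (3 * a + 2 * b) * (B - 1 - b ^ 2) + a * A = 25 * a * A"
    using DA[unfolded arg_cong[OF A, of ?D]] unfolding theta_deriv_simps Da Db by simp algebra
  moreover have "(6 * a + 3 * b) * (1 - A - a ^ 2) + (3 * a + 2 * b) * (B - 1 - b ^ 2) + a * A =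
     4 * (a + b + (b - a) ^ 3) + 5 * (- b - b^3 - a + a*b^2 - 5*a^2*b - a^3)"
    unfolding A B by algebra
  moreover have "25 * a * A = 5 * (5 * a * A)" by simp
  ultimately have "4 * (a + b + (b - a) ^ 3) = 0" by (simp only: zero5 add_0_right)
  moreover have "a + b + (b - a) ^ 3 = 4 * (4 * (a + b + (b - a) ^ 3)) + 5 * (- 3 * (a + b + (b - a) ^ 3))"
    by algebra
  ultimately have C: "a + b + (b - a) ^ 3 = 0" by (simp only: zero5 mult_zero_right add_0_right)
  \<comment> \<open>As 3 is 1/2 modulo 5, b - a = 2e; then \<open>C\<close> reads a + b = -8e^3 =
    2e^3, which gives a and b as polynomials in e.\<close>
  define e where "e = 3 * (b - a)"
  have ae: "a = e ^ 3 - e"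
  proof -
    have "a = e ^ 3 - e + 5 * (5 * a + 6 * b)" using C unfolding e_def by algebra
    then show ?thesis by (simp only: zero5 add_0_right)
  qed
  have be: "b = e ^ 3 + e"
  proof -
    have "b = e ^ 3 + e + 5 * (6 * a + 5 * b)" using C unfolding e_def by algebra
    then show ?thesis by (simp only: zero5 add_0_right)
  qed
  have De: "?D e = 1 - e ^ 4"
  proof -
    have "?D e = 3 * (B + A - 2 - b ^ 2 + a ^ 2)"
      unfolding e_def theta_deriv_simps Da Db by algebra
    also have "\<dots> = 1 - e ^ 4 + 5 * (1 + 3*e^2 - 7*e^4 + 9*e^6)"
      unfolding A B ae be by algebra
    finally show ?thesis by (simp only: zero5 add_0_right)
  qed
  have a0: "a $ 0 = 0" and b0: "b $ 0 = 2" by (simp_all add: a_def b_def theta_deriv_def)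
  then have e0: "e $ 0 = 1" by (simp add: e_def gf5_six)
  have A3: "A = (3 * (1 + e ^ 2)) ^ 3"
  proof -
    have "A = (3 * (1 + e ^ 2)) ^ 3 + 5 * (- 5 - 16*e^2 - 17*e^4 - 4*e^6)"
      unfolding A ae be by algebra
    then show ?thesis by (simp only: zero5 add_0_right)
  qed
  have B3: "B = (3 * (1 - e ^ 2)) ^ 3"
  proof -
    have "B = (3 * (1 - e ^ 2)) ^ 3 + 5 * (- 5 + 17*e^2 - 17*e^4 + 7*e^6)"
      unfolding B ae be by algebra
    then show ?thesis by (simp only: zero5 add_0_right)
  qed
  have X: "p ^ 8 = 3 * (1 + e ^ 2)"
  proof (rule cube_root_unique)
    show "(p ^ 8) ^ 3 = (3 * (1 + e ^ 2)) ^ 3"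
      unfolding A3[symmetric] A_def by (simp flip: power_mult)
  qed (use p0 e0 in \<open>simp_all add: fps_power_zeroth gf5_six\<close>)
  \<comment> \<open>Since e has constant term 1, 1 - e^2 is divisible by the variable; z is the
    quotient, and its cube can be compared with s^24.\<close>
  define z where "z = fps_shift 1 (3 * (1 - e ^ 2))"
  have z: "3 * (1 - e ^ 2) = fps_X * z"
  proof (rule fps_ext)
    fix n show "(3 * (1 - e ^ 2)) $ n = (fps_X * z) $ n"
      using e0 by (cases n) (simp_all add: z_def fps_power_zeroth)
  qed
  have s24: "(s ^ 8) ^ 3 = z ^ 3"
  proof -
    have "fps_X ^ 3 * (s ^ 8) ^ 3 = fps_X ^ 3 * z ^ 3"
      using B3 unfolding B_def z by (simp add: power_mult_distrib flip: power_mult)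
    then have "(fps_X ^ 3 * (s ^ 8) ^ 3) $ (n + 3) = (fps_X ^ 3 * z ^ 3) $ (n + 3)" for n by simp
    then show ?thesis by (simp add: fps_eq_iff fps_X_power_mult_nth)
  qed
  have "(z $ 0) ^ 3 = (s $ 0) ^ 24"
    using arg_cong[OF s24, of "\<lambda>f. f $ 0"] by (simp add: fps_power_zeroth)
  then have "z $ 0 = 1" using s0 cube_eq_1 by simp
  then have "s ^ 8 = z"
    using cube_root_unique[OF s24] s0 by (simp add: fps_power_zeroth)
  then have Y: "fps_X * s ^ 8 = 3 * (1 - e ^ 2)" unfolding z by simp
  have "fps_X * (p * s) ^ 8 = p ^ 8 * (fps_X * s ^ 8)" by (simp add: power_mult_distrib mult_ac)
  also have "\<dots> = - (1 - e ^ 4) + 5 * (2 * (1 - e ^ 4))" unfolding X Y by algebra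
  finally have XY: "fps_X * (p * s) ^ 8 = - (1 - e ^ 4)" by (simp only: zero5 add_0_right)
  show ?thesis
    using that[OF e0 De] Dp1 Ds1 XY unfolding ae be by blast
qed

text \<open>The operator \<open>f \<mapsto> q f' + f\<close> is annihilated by \<open>sect5\<close> and maps \<open>h * e ^ k\<close>, where \<open>h = p ^ 3 * s ^ 3\<close>, to
  \<open>h * ((1 - k) * e ^ (k + 3) + k * e ^ (k - 1))\<close>. Modulo its image only \<open>h * e ^ 4\<close> survives among the terms of
  \<open>h * C\<close>, and it may be replaced by \<open>h * (1 - e ^ 4) ^ 4\<close>, a fifth power times \<open>q ^ 4\<close>; \<open>g\<close> is the
  corresponding witness.\<close>

lemma section_identity:
  fixes p s w e :: "gf5 fps"
  assumes p0: "p $ 0 = 1"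
    and De: "theta_deriv e = 1 - e ^ 4"
    and Dp: "theta_deriv p = (e ^ 3 - e) * p" and Ds: "theta_deriv s = (e ^ 3 + e - 2) * s"
    and XY: "fps_X * (p * s) ^ 8 = - (1 - e ^ 4)"
    and Dw: "theta_deriv w = p ^ 4 * theta_deriv p - (theta_deriv p) ^ 5"
    and U0: "sect5 (p ^ 3 * s ^ 3) = 0"
  shows "sect5 (p ^ 3 * s ^ 3 * w) = - (p * (p * s) ^ 7)"
proof -
  let ?D = theta_deriv
  define pi where "pi = fps_right_inverse p 1"
  have pi: "p * pi = 1" unfolding pi_def using p0 by (auto intro: fps_right_inverse)
  define h where "h = p ^ 3 * s ^ 3"
  have Dh: "?D h + h = e ^ 3 * h"
  proof -
    have "?D h = 3 * (2 * e ^ 3 - 2) * h" unfolding h_def theta_deriv_simps Dp Ds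
      by (simp add: eval_nat_numeral) algebra
    then have "?D h + h = e ^ 3 * h + 5 * ((e ^ 3 - 1) * h)" by algebra
    then show ?thesis by (simp only: zero5 add_0_right)
  qed
  \<comment> \<open>Fifth powers are constants of the derivation, so dividing w by p^5 normalises
    its derivative to a - a^5 with a = e^3 - e.\<close>
  define C where "C = w * pi ^ 5"
  have wC: "w = C * p ^ 5"
  proof -
    have "C * p ^ 5 = w * (p * pi) ^ 5" unfolding C_def by (simp add: power_mult_distrib mult_ac)
    then show ?thesis by (simp add: pi)
  qed
  have D5: "?D (f ^ 5) = 0" for f :: "gf5 fps"
    by (simp add: theta_deriv_simps five_eq_0)
  have DC: "?D C = (e ^ 3 - e) - (e ^ 3 - e) ^ 5"
  proof -
    have "?D C = ?D w * pi ^ 5" unfolding C_def theta_deriv_simps(3) D5 by simp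
    also have "\<dots> = ((e ^ 3 - e) - (e ^ 3 - e) ^ 5) * (p * pi) ^ 5"
      unfolding Dw Dp by algebra
    finally show ?thesis unfolding pi by simp
  qed
  \<comment> \<open>The polynomial is an antiderivative of a - a^5: its derivative in e, multiplied
    by 1 - e^4, agrees with it modulo 5. So k is a constant of the derivation.\<close>
  define k where "k = C - (2 * e ^ 2 - e ^ 4 + 2 * e ^ 8 + 3 * e ^ 12)"
  have "?D k = 0"
  proof -
    have "?D k = (e ^ 3 - e) - (e ^ 3 - e) ^ 5 - (4 * e - 4 * e ^ 3 + 16 * e ^ 7 + 36 * e ^ 11) * (1 - e ^ 4)"
      unfolding k_def theta_deriv_simps DC De by simp algebra
    also have "\<dots> = 5 * (- (e - e^3 - e^5 + 5*e^7 - 2*e^9 + 6*e^11 - e^13 - 7*e^15))"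
      by algebra
    finally show ?thesis by (simp only: zero5)
  qed
  then have hk: "sect5 (h * k) = 0"
    using sect5_mult_const U0 h_def by blast
  define g where "g = e + 4*e^3 + 2*e^5 + 4*e^7 + 4*e^9 + 4*e^11 + 2*e^13"
  have Dg: "?D g = (1 + 12*e^2 + 10*e^4 + 28*e^6 + 36*e^8 + 44*e^10 + 26*e^12) * (1 - e ^ 4)"
    unfolding g_def theta_deriv_simps De by simp algebra
  have "?D (h * g) + h * g = h * (e ^ 3 * g + ?D g)"
    unfolding theta_deriv_simps(3) using Dh by algebra
  also have "\<dots> = h * (2 * e ^ 2 - e ^ 4 + 2 * e ^ 8 + 3 * e ^ 12) + h * (1 - e ^ 4) ^ 4
      + 5 * (h * (2*e^2 + 3*e^4 + 4*e^6 + 4*e^8 + 4*e^10 - e^12 - 8*e^14 - 5*e^16))"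
    unfolding Dg unfolding g_def by algebra
  finally have 1: "h * (2 * e ^ 2 - e ^ 4 + 2 * e ^ 8 + 3 * e ^ 12) = (?D (h * g) + h * g) - h * (1 - e ^ 4) ^ 4"
    by (simp only: zero5 add_0_right eq_diff_eq)
  have 2: "h * C = h * k + h * (2 * e ^ 2 - e ^ 4 + 2 * e ^ 8 + 3 * e ^ 12)"
    unfolding k_def by algebra
  \<comment> \<open>By \<open>XY\<close> the exponent of p s becomes 3 + 4 * 8 = 35, a multiple of
    5.\<close>
  have 3: "h * (1 - e ^ 4) ^ 4 = fps_X ^ 4 * subst5 ((p * s) ^ 7)"
  proof -
    have "(1 - e ^ 4) ^ 4 = (fps_X * (p * s) ^ 8) ^ 4" unfolding XY by algebra
    then have "h * (1 - e ^ 4) ^ 4 = fps_X ^ 4 * ((p * s) ^ 7) ^ 5"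
      unfolding h_def by (simp add: power_mult_distrib mult_ac flip: power_mult power_add)
    then show ?thesis unfolding frobenius .
  qed
  have 4: "sect5 (fps_X ^ 4 * subst5 ((p * s) ^ 7)) = (p * s) ^ 7"
  proof -
    have "sect5 (fps_X ^ 4 :: gf5 fps) = 1"
      by (rule fps_ext) (simp add: sect5_def)
    then show ?thesis unfolding sect5_mult_subst5 by simp
  qed
  have "sect5 (h * C) = sect5 (h * k) + (sect5 (?D (h * g) + h * g) - (p * s) ^ 7)"
    unfolding 2 1 3 unfolding sect5_simps(1)[of "h * k"] sect5_simps(2) 4 ..
  then have hC: "sect5 (h * C) = - ((p * s) ^ 7)"
    unfolding hk sect5_shifted_deriv by simp
  have "sect5 (h * w) = sect5 (h * C * subst5 p)" unfolding wC frobenius[symmetric] by (simp add: mult.assoc)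
  also have "\<dots> = - (p * (p * s) ^ 7)" unfolding sect5_mult_subst5 hC by (simp add: mult.commute)
  finally show ?thesis unfolding h_def .
qed

subsection \<open>Theta series modulo 5\<close>

definition map_fps :: "int fps \<Rightarrow> 'a :: comm_ring_1 fps" where
  "map_fps f = Abs_fps (\<lambda>n. of_int (f $ n))"

lemma map_fps_nth [simp]: "map_fps f $ n = of_int (f $ n)"
  by (simp add: map_fps_def)

lemma map_fps_mult: "map_fps (f * g) = map_fps f * map_fps g"
  by (simp add: fps_eq_iff fps_mult_nth)

lemma map_fps_power: "map_fps (f ^ n) = map_fps f ^ n"
proof (induction n)
  case 0
  show ?case by (simp add: fps_eq_iff)
qed (simp add: map_fps_mult)

lemma map_fps_simps: "map_fps (f + g) = map_fps f + map_fps g" "map_fps (f - g) = map_fps f - map_fps g"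
  "map_fps (theta_deriv f) = theta_deriv (map_fps f)" "map_fps (subst5 f) = subst5 (map_fps f)"
  "map_fps (sect5 f) = sect5 (map_fps f)" "map_fps (- f) = - map_fps f"
  by (simp_all add: fps_eq_iff theta_deriv_nth subst5_def sect5_def)

lemma map_fps_gf5_eq_0: "(map_fps f :: gf5 fps) = 0 \<longleftrightarrow> (\<forall>n. 5 dvd f $ n)"
  by (simp add: fps_eq_iff gf5_of_int_eq_0_iff)

text \<open>The formal series of c n q^(e n) over all integers n. It has this meaning only if the
  fibres of e are finite, as a sum over an infinite set is 0 by default; hence
  \<open>finite_fibres\<close>.\<close>

definition theta_series :: "(int \<Rightarrow> int) \<Rightarrow> (int \<Rightarrow> int) \<Rightarrow> int fps" where
  "theta_series e c = Abs_fps (\<lambda>m. \<Sum>n | e n = int m. c n)"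

text \<open>These four are the expansions of \<open>theta4\<close>, \<open>psi\<close>,
  \<open>jac\<close>, and \<open>jac\<close> at the square of the variable.\<close>

definition P_fps :: "int fps" where "P_fps = theta_series (\<lambda>n. n * n) (\<lambda>n. if even n then 1 else - 1)"
definition S_fps :: "int fps" where "S_fps = theta_series (\<lambda>n. 2 * (n * n) + n) (\<lambda>_. 1)"
definition J_fps :: "int fps" where "J_fps = theta_series (\<lambda>n. 2 * (n * n) + n) (\<lambda>n. 4 * n + 1)"
definition K_fps :: "int fps" where "K_fps = theta_series (\<lambda>n. 2 * (2 * (n * n) + n)) (\<lambda>n. 4 * n + 1)"

lemma theta_series_nth: "map_fps (theta_series e c) $ m = (\<Sum>n | e n = int m. of_int (c n))"
  by (simp add: theta_series_def)

lemma abs_le_quadratic: "\<bar>n\<bar> \<le> n * n" "\<bar>n\<bar> \<le> 2 * (n * n) + n" for n :: int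
proof -
  have 1: "\<bar>n\<bar> * 1 \<le> \<bar>n\<bar> * \<bar>n\<bar>" if "n \<noteq> 0"
    using that by (intro mult_left_mono) auto
  then show *: "\<bar>n\<bar> \<le> n * n" by (cases "n = 0") (simp_all add: abs_mult[symmetric])
  then show "\<bar>n\<bar> \<le> 2 * (n * n) + n" by linarith
qed

lemma finite_fibres:
  "finite {n::int. n * n = int m}" "finite {n::int. 2 * (n * n) + n = int m}" "finite {n::int. 2 * (2 * (n * n) + n) = int m}"
proof -
  have "{n::int. n * n = int m} \<subseteq> {- int m..int m}" "{n::int. 2 * (n * n) + n = int m} \<subseteq> {- int m..int m}"
      "{n::int. 2 * (2 * (n * n) + n) = int m} \<subseteq> {- int m..int m}"
    using abs_le_quadratic by (auto simp: abs_le_iff) (smt (verit) abs_le_quadratic)+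
  then show "finite {n::int. n * n = int m}" "finite {n::int. 2 * (n * n) + n = int m}" "finite {n::int. 2 * (2 * (n * n) + n) = int m}"
    using finite_subset by blast+
qed

section \<open>Differential equations of the theta series modulo 5\<close>

lemma operator_nth:
  "(theta_deriv (theta_deriv f) + of_nat x * theta_deriv f + of_nat y * f) $ m = of_nat (m * m + x * m + y) * f $ m"
  for f :: "'a :: comm_ring_1 fps"
  by (simp add: theta_deriv_nth fps_of_nat[symmetric] algebra_simps)

lemma gf5_power25: "(f :: gf5 fps) ^ 25 = subst5 (subst5 f)"
proof -
  have "f ^ 25 = (f ^ 5) ^ 5" by (simp flip: power_mult)
  then show ?thesis by (simp only: frobenius)
qed

lemma subst25_nth: "subst5 (subst5 f) $ m = (if 25 dvd m then f $ (m div 25) else 0)"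
proof -
  have "5 dvd m \<and> 5 dvd m div 5 \<longleftrightarrow> 25 dvd m" by presburger
  moreover have "m div 5 div 5 = m div 25" by (simp add: div_mult2_eq[symmetric])
  ultimately show ?thesis by (auto simp: subst5_def)
qed

text \<open>Modulo 5, 2n^2 + n + 2 is 2(4n + 1)^2, so the second expression is 4(4n + 1)^4 + 1. It
  vanishes by Fermat unless 5 divides 4n + 1, that is, unless n is 1 modulo 5.\<close>

lemma theta_mod5:
  "n * n * (n * n) mod 5 = (if 5 dvd n then 0 else 1) mod 5"
  "((2 * (n * n) + n + 2) * (2 * (n * n) + n + 2) + 1) mod 5 = (if n mod 5 = 1 then 1 else 0)" for n :: int
proof -
  have n: "n mod 5 = 0 \<or> n mod 5 = 1 \<or> n mod 5 = 2 \<or> n mod 5 = 3 \<or> n mod 5 = 4" by presburger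
  have "n * n * (n * n) mod 5 = ((n mod 5) * (n mod 5) * ((n mod 5) * (n mod 5))) mod 5"
    by (intro mod_mult_cong) simp_all
  moreover have "5 dvd n \<longleftrightarrow> n mod 5 = 0" by presburger
  ultimately show "n * n * (n * n) mod 5 = (if 5 dvd n then 0 else 1) mod 5"
    using n by (elim disjE) simp_all
  have "((2 * (n * n) + n + 2) * (2 * (n * n) + n + 2) + 1) mod 5 =
     ((2 * ((n mod 5) * (n mod 5)) + n mod 5 + 2) * (2 * ((n mod 5) * (n mod 5)) + n mod 5 + 2) + 1) mod 5"
    by (intro mod_mult_cong mod_add_cong) simp_all
  then show "((2 * (n * n) + n + 2) * (2 * (n * n) + n + 2) + 1) mod 5 = (if n mod 5 = 1 then 1 else 0)"
    using n by (elim disjE) simp_all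
qed

lemma mod5_shift: "(y + 1) mod 5 = d mod 5 \<Longrightarrow> y mod 5 = (- 1 + d) mod 5" for y d :: int
  using mod_diff_cong[of "y + 1" 5 d 1 1] by simp

lemma gf5_weighted_theta:
  assumes "finite {n. e n = int m}"
    and "\<And>n. e n = int m \<Longrightarrow> (int w * c n) mod 5 = d n mod 5"
  shows "of_nat w * (map_fps (theta_series e c) $ m :: gf5) = (\<Sum>n | e n = int m. of_int (d n))"
proof -
  have "of_nat w * (map_fps (theta_series e c) $ m :: gf5) = (\<Sum>n | e n = int m. of_int (int w * c n))"
    unfolding theta_series_nth by (simp add: sum_distrib_left)
  also have "\<dots> = (\<Sum>n | e n = int m. of_int (d n))"
    by (rule sum.cong) (auto simp: gf5_of_int_eq_iff assms(2) simp del: of_int_mult)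
  finally show ?thesis .
qed

text \<open>Twofold differentiation multiplies the term of n by n^4. It loses only the terms n = 5k;
  these have the same signs as k and form p(q^25) = p^25.\<close>

lemma P_ode: "theta_deriv (theta_deriv (map_fps P_fps)) = map_fps P_fps - (map_fps P_fps :: gf5 fps) ^ 25"
proof (rule fps_ext)
  fix m
  let ?p = "map_fps P_fps :: gf5 fps" and ?c = "\<lambda>n::int. if even n then 1 else - 1 :: int"
  have "of_nat (m * m) * ?p $ m = (\<Sum>n | n * n = int m. of_int (?c n - (if 5 dvd n then ?c n else 0)))"
    unfolding P_fps_def
  proof (rule gf5_weighted_theta[where c = ?c and d = "\<lambda>n. ?c n - (if 5 dvd n then ?c n else 0)", OF finite_fibres(1)], goal_cases)
    case (1 n)
    note n = this
    have "(n * n * (n * n)) * ?c n mod 5 = (if 5 dvd n then 0 else 1) * ?c n mod 5"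
      by (intro mod_mult_cong theta_mod5 refl)
    moreover have "(if 5 dvd n then 0 else 1) * ?c n = ?c n - (if 5 dvd n then ?c n else 0)" by simp
    ultimately show ?case unfolding n by (simp only: of_nat_mult)
  qed
  also have "\<dots> = ?p $ m - (\<Sum>n | n * n = int m. if 5 dvd n then of_int (?c n) else 0)"
    unfolding P_fps_def theta_series_nth sum_subtractf[symmetric] by (rule sum.cong) auto
  also have "(\<Sum>n | n * n = int m. if 5 dvd n then of_int (?c n) else 0) = (?p ^ 25) $ m"
  proof -
    have "(\<Sum>n | n * n = int m. if 5 dvd n then of_int (?c n) else 0) = (\<Sum>n\<in>{n. n * n = int m \<and> 5 dvd n}. of_int (?c n) :: gf5)"
      by (rule sum.mono_neutral_cong_right[OF finite_fibres(1)]) auto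
    also have "\<dots> = (if 25 dvd m then \<Sum>k | k * k = int (m div 25). of_int (?c k) else 0)"
    proof (cases "25 dvd m")
      case True
      then obtain l where l: "m = 25 * l" by auto
      have "(\<Sum>n\<in>{n. n * n = int m \<and> 5 dvd n}. of_int (?c n) :: gf5) = (\<Sum>k | k * k = int (m div 25). of_int (?c k))"
        by (rule sum.reindex_bij_witness[of _ "\<lambda>k. 5 * k" "\<lambda>n. n div 5"]) (auto simp: l)
      then show ?thesis using True by simp
    next
      case False
      have "{n. n * n = int m \<and> 5 dvd n} = {}"
      proof -
        have False if "n * n = int m" "5 dvd n" for n
        proof -
          from that obtain k where "(5 * k) * (5 * k) = int m" by auto
          then have "int 25 dvd int m" by (intro dvdI[of _ _ "k * k"]) simp
          then show False using False by (simp only: int_dvd_int_iff)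
        qed
        then show ?thesis by blast
      qed
      then show ?thesis using False by (simp only: sum.empty if_False)
    qed
    also have "\<dots> = (?p ^ 25) $ m"
      unfolding gf5_power25 subst25_nth P_fps_def theta_series_nth ..
    finally show ?thesis .
  qed
  finally show "theta_deriv (theta_deriv ?p) $ m = (?p - ?p ^ 25) $ m"
    by (simp add: theta_deriv_nth mult.assoc)
qed

text \<open>The operator is the square of q d/dq + 2. The exceptional indices n = 5k + 1 have
  exponent 25(2k^2 + k) + 3, whence the shift by 3 and the power 25.\<close>

lemma S_ode: "theta_deriv (theta_deriv (map_fps S_fps)) + 4 * theta_deriv (map_fps S_fps) + 4 * map_fps S_fps =
   - map_fps S_fps + fps_X ^ 3 * (map_fps S_fps :: gf5 fps) ^ 25"
proof (rule fps_ext)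
  fix m
  let ?s = "map_fps S_fps :: gf5 fps"
  have "of_nat (m * m + 4 * m + 4) * ?s $ m = (\<Sum>n | 2 * (n * n) + n = int m. of_int (- 1 + (if n mod 5 = 1 then 1 else 0)))"
    unfolding S_fps_def
  proof (rule gf5_weighted_theta[OF finite_fibres(2)])
    fix n :: int assume n: "2 * (n * n) + n = int m"
    have "int (m * m + 4 * m + 4) * 1 = (2 * (n * n) + n + 2) * (2 * (n * n) + n + 2)"
      unfolding n by (simp add: algebra_simps)
    then show "int (m * m + 4 * m + 4) * 1 mod 5 = (- 1 + (if n mod 5 = 1 then 1 else 0)) mod 5"
      by (simp only:) (rule mod5_shift, simp only: theta_mod5, simp)
  qed
  also have "\<dots> = - (?s $ m) + (\<Sum>n | 2 * (n * n) + n = int m. if n mod 5 = 1 then 1 else 0)"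
    unfolding S_fps_def theta_series_nth sum_negf[symmetric] sum.distrib[symmetric] by (rule sum.cong) auto
  also have "(\<Sum>n | 2 * (n * n) + n = int m. if n mod 5 = 1 then 1 else 0) = (fps_X ^ 3 * ?s ^ 25) $ m"
  proof -
    have "(\<Sum>n | 2 * (n * n) + n = int m. if n mod 5 = 1 then 1 else 0) = (\<Sum>n\<in>{n. 2 * (n * n) + n = int m \<and> n mod 5 = 1}. 1 :: gf5)"
      by (rule sum.mono_neutral_cong_right[OF finite_fibres(2)]) auto
    also have "\<dots> = (if m \<ge> 3 \<and> 25 dvd (m - 3) then \<Sum>k | 2 * (k * k) + k = int ((m - 3) div 25). 1 else 0)"
    proof (cases "m \<ge> 3 \<and> 25 dvd (m - 3)")
      case True
      then obtain l where l: "m = 25 * l + 3" by (metis dvdE le_add_diff_inverse2)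
      have "(\<Sum>n\<in>{n. 2 * (n * n) + n = int m \<and> n mod 5 = 1}. 1 :: gf5) = (\<Sum>k | 2 * (k * k) + k = int ((m - 3) div 25). 1)"
      proof (rule sum.reindex_bij_witness[of _ "\<lambda>k. 5 * k + 1" "\<lambda>n. n div 5"])
        fix n assume n: "n \<in> {n. 2 * (n * n) + n = int m \<and> n mod 5 = 1}"
        then have "n mod 5 = 1" by simp
        then have n5: "5 * (n div 5) + 1 = n" by presburger
        show "5 * (n div 5) + 1 = n" by (rule n5)
        define k where "k = n div 5"
        have "n = 5 * k + 1" using n5 by (simp add: k_def)
        then have "2 * (k * k) + k = int l" using n by (simp add: l algebra_simps)
        then show "n div 5 \<in> {k. 2 * (k * k) + k = int ((m - 3) div 25)}"
          by (simp add: l k_def)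
      qed (auto simp: l algebra_simps)
      then show ?thesis using True by simp
    next
      case False
      have "{n. 2 * (n * n) + n = int m \<and> n mod 5 = 1} = {}"
      proof -
       have False if n: "2 * (n * n) + n = int m" "n mod 5 = 1" for n
       proof -
        define k where "k = n div 5"
        have "n = 5 * k + 1" using n(2) unfolding k_def by presburger
        then have e: "int m = 3 + 25 * (2 * (k * k) + k)" using n(1) by (simp add: algebra_simps)
        moreover have "2 * (k * k) + k \<ge> 0" using abs_le_quadratic(2)[of k] by simp
        ultimately obtain x where x: "int m = 3 + 25 * x" "x \<ge> 0" by blast
        then have "m \<ge> 3" by linarith
        then have "int (m - 3) = 25 * x" using x \<open>m \<ge> 3\<close> by (simp add: of_nat_diff)
        then have "int 25 dvd int (m - 3)" by simp
        then show False using False \<open>m \<ge> 3\<close> by (simp only: int_dvd_int_iff) blast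
       qed
       then show ?thesis by blast
      qed
      then show ?thesis unfolding if_not_P[OF False] by (simp only: sum.empty)
    qed
    also have "\<dots> = (fps_X ^ 3 * ?s ^ 25) $ m"
      unfolding gf5_power25 fps_X_power_mult_nth subst25_nth S_fps_def theta_series_nth by simp
    finally show ?thesis .
  qed
  finally have "of_nat (m * m + 4 * m + 4) * ?s $ m = - (?s $ m) + (fps_X ^ 3 * ?s ^ 25) $ m" .
  then show "(theta_deriv (theta_deriv ?s) + 4 * theta_deriv ?s + 4 * ?s) $ m = (- ?s + fps_X ^ 3 * ?s ^ 25) $ m"
    using operator_nth[of ?s 4 4 m] by simp
qed

text \<open>At the exceptional indices the coefficient 4n + 1 is itself divisible by 5, so the
  equation for Jacobi's series has no 25th power.\<close>

lemma J_weight: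
  assumes "2 * (n * n) + n = int m"
  shows "int (m * m + 4 * m + 4) * (4 * n + 1) mod 5 = (- (4 * n + 1)) mod 5"
proof -
  have "int (m * m + 4 * m + 4) = (2 * (n * n) + n + 2) * (2 * (n * n) + n + 2)"
    unfolding assms by (simp add: algebra_simps)
  then have "(int (m * m + 4 * m + 4) + 1) mod 5 = (if n mod 5 = 1 then 1 else 0)"
    using theta_mod5(2)[of n] by simp
  then have "5 dvd (int (m * m + 4 * m + 4) + 1) \<or> 5 dvd (4 * n + 1)"
    by (auto split: if_splits) presburger+
  then have "5 dvd (int (m * m + 4 * m + 4) + 1) * (4 * n + 1)" by auto
  then show ?thesis unfolding mod_eq_dvd_iff by (simp add: algebra_simps)
qed

lemma J_ode: "theta_deriv (theta_deriv (map_fps J_fps)) + 4 * theta_deriv (map_fps J_fps) + 4 * map_fps J_fps =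
   - (map_fps J_fps :: gf5 fps)"
proof (rule fps_ext)
  fix m
  let ?j = "map_fps J_fps :: gf5 fps"
  have "of_nat (m * m + 4 * m + 4) * ?j $ m = (\<Sum>n | 2 * (n * n) + n = int m. of_int (- (4 * n + 1)))"
    unfolding J_fps_def by (rule gf5_weighted_theta[OF finite_fibres(2) J_weight])
  also have "\<dots> = - (?j $ m)"
    unfolding J_fps_def theta_series_nth sum_negf[symmetric] by simp
  finally show "(theta_deriv (theta_deriv ?j) + 4 * theta_deriv ?j + 4 * ?j) $ m = (- ?j) $ m"
    using operator_nth[of ?j 4 4 m] by simp
qed

text \<open>For an exponent m = 2l one has (m + 4)^2 = 4(l + 2)^2, so the eigenvalue -1 of
  \<open>J_ode\<close> becomes -4 = 1.\<close>

lemma K_ode: "theta_deriv (theta_deriv (map_fps K_fps)) + 8 * theta_deriv (map_fps K_fps) + 16 * map_fps K_fps =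
   (map_fps K_fps :: gf5 fps)"
proof (rule fps_ext)
  fix m
  let ?k = "map_fps K_fps :: gf5 fps"
  have "of_nat (m * m + 8 * m + 16) * ?k $ m = (\<Sum>n | 2 * (2 * (n * n) + n) = int m. of_int (4 * n + 1))"
    unfolding K_fps_def
  proof (rule gf5_weighted_theta[OF finite_fibres(3)])
    fix n assume n: "2 * (2 * (n * n) + n) = int m"
    have "even (int m)" unfolding n[symmetric] by simp
    then obtain l where "m = 2 * l" by auto
    then have l: "int m = 2 * int l" by simp
    then have l2: "2 * (n * n) + n = int l" using n by simp
    have X: "int (m * m + 8 * m + 16) = 4 * int (l * l + 4 * l + 4)" using l by (simp add: algebra_simps)
    have gen: "4 * y * x - x = 4 * (y * x - (- x)) - 5 * x" for x y :: int by (simp add: algebra_simps)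
    have "5 dvd int (l * l + 4 * l + 4) * (4 * n + 1) - (- (4 * n + 1))"
      using J_weight[OF l2] by (simp only: mod_eq_dvd_iff)
    then show "int (m * m + 8 * m + 16) * (4 * n + 1) mod 5 = (4 * n + 1) mod 5"
      unfolding mod_eq_dvd_iff X gen by (rule dvd_diff[OF dvd_mult dvd_triv_left])
  qed
  also have "\<dots> = ?k $ m"
    unfolding K_fps_def theta_series_nth by simp
  finally show "(theta_deriv (theta_deriv ?k) + 8 * theta_deriv ?k + 16 * ?k) $ m = ?k $ m"
    using operator_nth[of ?k 8 16 m] by simp
qed

text \<open>Modulo 5, 2n^2 + n takes the values 0 and 1, and the value 3 only for n = 1, where 5
  divides 4n + 1. Doubling turns 0, 1, 3 into 0, 2, 1.\<close>

lemma J_nth_mod5: "m mod 5 \<in> {2, 4} \<Longrightarrow> J_fps $ m = 0" "m mod 5 = 3 \<Longrightarrow> 5 dvd J_fps $ m"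
  and K_nth_mod5: "m mod 5 \<in> {3, 4} \<Longrightarrow> K_fps $ m = 0" "m mod 5 = 1 \<Longrightarrow> 5 dvd K_fps $ m"
proof -
  have r: "(2 * (n * n) + n) mod 5 = (2 * ((n mod 5) * (n mod 5)) + n mod 5) mod 5" for n :: int
    by (intro mod_mult_cong mod_add_cong) simp_all
  have e: "n mod 5 = 1 \<and> (2 * (n * n) + n) mod 5 = 3 \<or> (2 * (n * n) + n) mod 5 \<in> {0, 1}" for n :: int
  proof -
    have "n mod 5 = 0 \<or> n mod 5 = 1 \<or> n mod 5 = 2 \<or> n mod 5 = 3 \<or> n mod 5 = 4" by presburger
    then show ?thesis using r[of n] by (elim disjE) simp_all
  qed
  have d: "5 dvd 4 * n + 1" if "n mod 5 = 1" for n :: int using that by presburger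
  have im: "int m mod 5 = int (m mod 5)" by (simp add: zmod_int)
  show "J_fps $ m = 0" if "m mod 5 \<in> {2, 4}"
  proof -
    have "2 * (n * n) + n \<noteq> int m" for n
    proof
      assume "2 * (n * n) + n = int m"
      then have "(2 * (n * n) + n) mod 5 = int (m mod 5)" using im by simp
      then show False using e[of n] that by auto
    qed
    then show ?thesis by (simp add: J_fps_def theta_series_def)
  qed
  show "5 dvd J_fps $ m" if "m mod 5 = 3"
    unfolding J_fps_def theta_series_def fps_nth_Abs_fps
  proof (rule dvd_sum, clarify)
    fix n :: int assume "2 * (n * n) + n = int m"
    then have "(2 * (n * n) + n) mod 5 = int (m mod 5)" using im by simp
    then have "n mod 5 = 1" using e[of n] that by auto
    then show "5 dvd 4 * n + 1" by (rule d)
  qed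
  have dbl: "(2 * x) mod 5 = (2 * (x mod 5)) mod 5" for x :: int
    by (intro mod_mult_cong) simp_all
  show "K_fps $ m = 0" if "m mod 5 \<in> {3, 4}"
  proof -
    have "2 * (2 * (n * n) + n) \<noteq> int m" for n
    proof
      assume "2 * (2 * (n * n) + n) = int m"
      then have "(2 * ((2 * (n * n) + n) mod 5)) mod 5 = int (m mod 5)" using im dbl[of "2 * (n * n) + n"] by simp
      then show False using e[of n] that by auto
    qed
    then show ?thesis by (simp add: K_fps_def theta_series_def)
  qed
  show "5 dvd K_fps $ m" if "m mod 5 = 1"
    unfolding K_fps_def theta_series_def fps_nth_Abs_fps
  proof (rule dvd_sum, clarify)
    fix n :: int assume "2 * (2 * (n * n) + n) = int m"
    then have "(2 * ((2 * (n * n) + n) mod 5)) mod 5 = int (m mod 5)" using im dbl[of "2 * (n * n) + n"] by simp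
    then have "n mod 5 = 1" using e[of n] that by auto
    then show "5 dvd 4 * n + 1" by (rule d)
  qed
qed

text \<open>An exponent \<open>4\<close> modulo 5 means \<open>(4 * i + 1)\<^sup>2 + 2 * (4 * j + 1)\<^sup>2\<close> is divisible by 5; as \<open>-2\<close> is a
  non-residue, both coefficients \<open>4 * i + 1\<close> and \<open>4 * j + 1\<close> are.\<close>

lemma JK_section: "25 dvd sect5 (J_fps * K_fps) $ n"
proof -
  have "25 dvd J_fps $ i * K_fps $ (5 * n + 4 - i)" if "i \<le> 5 * n + 4" for i
  proof -
    define l where "l = 5 * n + 4 - i"
    have l: "(i + l) mod 5 = 4" using that by (simp add: l_def)
    have "i mod 5 \<in> {0,1,2,3,4}" by auto
    then consider "i mod 5 = 0" | "i mod 5 = 1" | "i mod 5 \<in> {2,4}" | "i mod 5 = 3" by auto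
    then show ?thesis
    proof cases
      case 1
      then have "l mod 5 = 4" using l by presburger
      then show ?thesis unfolding l_def[symmetric] using K_nth_mod5(1) by simp
    next
      case 2
      then have "l mod 5 = 3" using l by presburger
      then show ?thesis unfolding l_def[symmetric] using K_nth_mod5(1) by simp
    next
      case 3
      then show ?thesis unfolding l_def[symmetric] using J_nth_mod5(1) by simp
    next
      case 4
      then have "l mod 5 = 1" using l by presburger
      then have "5 * 5 dvd J_fps $ i * K_fps $ l"
        by (intro mult_dvd_mono J_nth_mod5(2) K_nth_mod5(2) 4)
      then show ?thesis unfolding l_def[symmetric] by simp
    qed
  qed
  then show ?thesis by (auto simp: sect5_def fps_mult_nth intro!: dvd_sum)
qed

section \<open>Divisibility by 25 of the coefficients of the theta quotient\<close>

lemma P_0: "P_fps $ 0 = 1" and S_0: "S_fps $ 0 = 1"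
proof -
  have 1: "{n::int. n * n = 0} = {0}" by auto
  have 2: "{n::int. 2 * (n * n) + n = 0} = {0}"
    using abs_le_quadratic(1) by (auto) (smt (verit) abs_le_quadratic(1))
  show "P_fps $ 0 = 1" "S_fps $ 0 = 1"
    by (simp_all add: P_fps_def S_fps_def theta_series_def 1 2)
qed

theorem coefficients_divisible:
  assumes F: "F * P_fps ^ 2 = S_fps ^ 3" and J: "J_fps = P_fps ^ 2 * S_fps" and K: "K_fps = P_fps * S_fps ^ 2"
    and n: "n mod 5 \<in> {1, 3, 4}"
  shows "25 dvd F $ (5 * n + 4)"
proof -
  let ?P = P_fps and ?S = S_fps
  define p s f where "p = (map_fps ?P :: gf5 fps)" and "s = (map_fps ?S :: gf5 fps)" and "f = (map_fps F :: gf5 fps)"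
  have p0: "p $ 0 = 1" and s0: "s $ 0 = 1" by (simp_all add: p_def s_def P_0 S_0)
  have j: "map_fps J_fps = p ^ 2 * s" and k: "map_fps K_fps = p * s ^ 2" and fp: "f * p ^ 2 = s ^ 3"
    unfolding p_def s_def f_def J K map_fps_power[symmetric] map_fps_mult[symmetric] F by simp_all
  \<comment> \<open>The division is exact because both series agree modulo 5 by
    \<open>frobenius\<close>.\<close>
  define W where "W = Abs_fps (\<lambda>n. (?P ^ 5 - subst5 ?P) $ n div 5)"
  define w where "w = (map_fps W :: gf5 fps)"
  have W: "?P ^ 5 = subst5 ?P + 5 * W"
  proof -
    have "(map_fps (?P ^ 5 - subst5 ?P) :: gf5 fps) = 0"
      by (simp add: map_fps_simps map_fps_power frobenius)
    then have "5 dvd (?P ^ 5 - subst5 ?P) $ n" for n unfolding map_fps_gf5_eq_0 by blast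
    then have "(?P ^ 5 - subst5 ?P) $ n = (5 * W) $ n" for n
      by (simp add: W_def numeral_fps_const)
    then have "?P ^ 5 - subst5 ?P = 5 * W" by (rule fps_ext)
    then show ?thesis by (simp add: algebra_simps)
  qed
  have cancel5: "x = y" if "5 * x = 5 * y" for x y :: "int fps"
  proof (rule fps_ext)
    fix n
    have "(5 * x) $ n = (5 * y) $ n" using that by simp
    then show "x $ n = y $ n" by (simp add: numeral_fps_const)
  qed
  \<comment> \<open>The derivative of a fifth power and that of a series in q^5 both contain an
    explicit factor 5. Cancelling it over the integers yields the derivative of W, which is then
    reduced modulo 5.\<close>
  have "theta_deriv (subst5 ?P) = 5 * subst5 (theta_deriv ?P)"
    by (rule fps_ext) (auto simp: theta_deriv_nth subst5_def numeral_fps_const)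
  then have "5 * (?P ^ 4 * theta_deriv ?P) = 5 * (subst5 (theta_deriv ?P) + theta_deriv W)"
    using arg_cong[OF W, of theta_deriv] by (simp add: theta_deriv_simps algebra_simps)
  then have "?P ^ 4 * theta_deriv ?P = subst5 (theta_deriv ?P) + theta_deriv W"
    by (rule cancel5)
  then have "map_fps (?P ^ 4 * theta_deriv ?P) = (map_fps (subst5 (theta_deriv ?P) + theta_deriv W) :: gf5 fps)" by simp
  then have Dw: "theta_deriv w = p ^ 4 * theta_deriv p - (theta_deriv p) ^ 5"
    unfolding frobenius w_def p_def map_fps_simps map_fps_mult map_fps_power by (simp add: algebra_simps)
  have JK: "J_fps * K_fps = ?P ^ 3 * ?S ^ 3" unfolding J K by algebra
  have U0: "sect5 (p ^ 3 * s ^ 3) = 0"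
  proof -
    have "sect5 (p ^ 3 * s ^ 3) = map_fps (sect5 (J_fps * K_fps))"
      unfolding JK map_fps_simps map_fps_mult map_fps_power p_def s_def ..
    also have "\<dots> = 0" unfolding map_fps_gf5_eq_0 using JK_section dvd_trans[of 5 "25 :: int"] by auto
    finally show ?thesis .
  qed
  obtain e where e: "theta_deriv e = 1 - e ^ 4" "theta_deriv p = (e ^ 3 - e) * p"
    "theta_deriv s = (e ^ 3 + e - 2) * s" "fps_X * (p * s) ^ 8 = - (1 - e ^ 4)"
    using theta_relation[OF p0 s0, of thesis] P_ode S_ode J_ode K_ode
    unfolding j k p_def[symmetric] s_def[symmetric] by blast
  have main: "sect5 (p ^ 3 * s ^ 3 * w) = - (p * (p * s) ^ 7)"
    by (rule section_identity[OF p0 e Dw U0])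
  have FP5: "F * ?P ^ 5 = J_fps * K_fps"
  proof -
    have "F * ?P ^ 5 = (F * ?P ^ 2) * ?P ^ 3" by (simp flip: power_add add: mult.assoc)
    then show ?thesis unfolding F JK by (simp add: mult.commute)
  qed
  define Z where "Z = Abs_fps (\<lambda>n. sect5 (J_fps * K_fps) $ n div 25)"
  have Z: "sect5 (J_fps * K_fps) = 25 * Z"
    using JK_section by (intro fps_ext) (simp add: Z_def numeral_fps_const)
  \<comment> \<open>The section passes through \<open>subst5 ?P\<close> exactly; only the correction
    5W stays under it.\<close>
  have sF: "sect5 F * ?P + 5 * sect5 (F * W) = 25 * Z"
  proof -
    have "F * ?P ^ 5 = F * subst5 ?P + 5 * (F * W)" unfolding W by algebra
    moreover have "sect5 (5 * g) = 5 * sect5 g" for g :: "int fps"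
      by (rule fps_ext) (simp add: sect5_def numeral_fps_const)
    ultimately have "sect5 (F * ?P ^ 5) = sect5 F * ?P + 5 * sect5 (F * W)"
      by (simp add: sect5_simps sect5_mult_subst5)
    then show ?thesis unfolding FP5 Z by simp
  qed
  define Pi where "Pi = fps_right_inverse ?P 1"
  have Pi: "?P * Pi = 1" unfolding Pi_def using P_0 by (auto intro: fps_right_inverse)
  \<comment> \<open>Because \<open>?P\<close> is invertible over the integers, \<open>sF\<close>
    shows \<open>sect5 F\<close> to be 5 times this series; it remains to find it modulo 5.\<close>
  define G where "G = (5 * Z - sect5 (F * W)) * Pi"
  have GP: "G * ?P = 5 * Z - sect5 (F * W)" using Pi unfolding G_def by algebra
  have sG: "sect5 F = 5 * G"
    using sF Pi unfolding G_def by algebra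
  have Z0: "map_fps (5 * Z) = (0 :: gf5 fps)"
    unfolding map_fps_gf5_eq_0 by (simp add: numeral_fps_const)
  have "map_fps (G * ?P) = - sect5 (f * w)"
    unfolding GP f_def w_def map_fps_simps map_fps_mult[of F W] Z0 by simp
  then have gp: "map_fps G * p = - sect5 (f * w)" unfolding map_fps_mult p_def .
  have fw: "f * w * subst5 p = p ^ 3 * s ^ 3 * w" unfolding frobenius[symmetric] using fp by algebra
  have "sect5 (f * w) * p = - (p * (p * s) ^ 7)"
    unfolding sect5_mult_subst5[symmetric] fw by (rule main)
  \<comment> \<open>Together the two relations say that G p^2 = p (p s)^7 modulo 5. Cancelling p^2
    leaves p s^2, the series of \<open>K_fps\<close>, times the fifth power of p s.\<close>
  with gp have "p * (p * (map_fps G - s ^ 2 * p * (p * s) ^ 5)) = 0" by algebra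
  then have "map_fps G - s ^ 2 * p * (p * s) ^ 5 = 0"
    using fps_unit_cancel[of p 1] p0 by (metis mult.right_neutral)
  then have "map_fps G = map_fps K_fps * subst5 (p * s)"
    unfolding k frobenius[symmetric] by (simp add: mult_ac)
  also have "(map_fps K_fps * subst5 (p * s)) $ n = 0"
  proof -
    have "(map_fps K_fps $ (n - i) :: gf5) * subst5 (p * s) $ i = 0" if "i \<le> n" for i
    proof (cases "5 dvd i")
      case True
      then have "(n - i) mod 5 = n mod 5" using that by (metis dvdE mod_mult_self4 le_add_diff_inverse mod_add_right_eq mod_mult_self1_is_0 add.right_neutral add.commute)
      then have "5 dvd K_fps $ (n - i)" using n K_nth_mod5[of "n - i"] by auto
      then show ?thesis by (simp add: gf5_of_int_eq_0_iff)
    next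
      case False
      then show ?thesis by (simp add: subst5_def)
    qed
    then have "(subst5 (p * s) * map_fps K_fps) $ n = 0"
      unfolding fps_mult_nth by (intro sum.neutral) (simp add: mult.commute)
    then show ?thesis by (simp only: mult.commute)
  qed
  finally have "5 dvd G $ n" by (simp add: gf5_of_int_eq_0_iff)
  then have "5 * 5 dvd 5 * G $ n" by (intro mult_dvd_mono) auto
  moreover have "F $ (5 * n + 4) = 5 * G $ n"
    using arg_cong[OF sG, of "\<lambda>f. f $ n"] by (simp add: sect5_def numeral_fps_const)
  ultimately show ?thesis by simp
qed

subsection \<open>Power series of the theta functions\<close>

text \<open>An absolutely convergent sum over the integers is regrouped by the value of the
  exponent.\<close>

lemma theta_series_sums:
  fixes z :: complex
  assumes z: "z \<noteq> 0" and e: "\<And>n. e n \<ge> 0" and fin: "\<And>m. finite {n. e n = int m}"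
    and s: "(\<lambda>n. norm (of_int (c n) * z powi (e n))) summable_on UNIV"
  shows "(\<lambda>m. map_fps (theta_series e c) $ m * z ^ m) sums (\<Sum>\<^sub>\<infinity>n. of_int (c n) * z powi (e n))"
proof -
  let ?f = "\<lambda>n. of_int (c n) * z powi (e n)"
  have "(?f has_sum infsum ?f UNIV) UNIV"
    by (rule has_sum_infsum[OF abs_summable_summable[OF s]])
  also have "?this \<longleftrightarrow> ((\<lambda>(m, n). ?f n) has_sum infsum ?f UNIV) (SIGMA m:UNIV. {n. e n = int m})"
    by (rule has_sum_reindex_bij_witness[of _ snd "\<lambda>n. (nat (e n), n)"]) (auto simp: e)
  finally have "((\<lambda>m. \<Sum>n | e n = int m. ?f n) has_sum infsum ?f UNIV) UNIV"
  proof (rule has_sum_SigmaD)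
    show "((\<lambda>n. case (m, n) of (m, n) \<Rightarrow> ?f n) has_sum (\<Sum>n | e n = int m. ?f n)) {n. e n = int m}" for m
      unfolding prod.case by (rule has_sum_finite[OF fin])
  qed
  also have "(\<lambda>m. \<Sum>n | e n = int m. ?f n) = (\<lambda>m. map_fps (theta_series e c) $ m * z ^ m)"
    unfolding theta_series_nth by (intro ext) (auto simp: sum_distrib_right intro!: sum.cong)
  finally show ?thesis by (rule has_sum_imp_sums)
qed

text \<open>The origin is excluded because the theta functions are built from \<open>powi\<close>, which is not meant for base 0.\<close>

definition represents :: "complex fps \<Rightarrow> (complex \<Rightarrow> complex) \<Rightarrow> bool" where
  "represents f X \<longleftrightarrow> (\<forall>z. z \<noteq> 0 \<and> norm z < 1 \<longrightarrow> (\<lambda>m. f $ m * z ^ m) sums X z)"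

lemma represents_radius: "represents f X \<Longrightarrow> fps_conv_radius f \<ge> 1"
  unfolding fps_conv_radius_def
proof (rule conv_radius_geI_ex)
  fix r :: real assume "represents f X" "0 < r" "ereal r < 1"
  then show "\<exists>z. norm z = r \<and> summable (\<lambda>n. f $ n * z ^ n)"
    by (intro exI[of _ "of_real r"]) (auto simp: represents_def sums_iff)
qed

lemma represents_eval: "represents f X \<Longrightarrow> z \<noteq> 0 \<Longrightarrow> norm z < 1 \<Longrightarrow> eval_fps f z = X z"
  unfolding represents_def eval_fps_def by (auto simp: sums_iff)

lemma representsI:
  assumes "fps_conv_radius f \<ge> 1" "\<And>z. z \<noteq> 0 \<Longrightarrow> norm z < 1 \<Longrightarrow> eval_fps f z = X z"
  shows "represents f X"
  unfolding represents_def
proof safe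
  fix z :: complex assume z: "z \<noteq> 0" "norm z < 1"
  then have "ereal (norm z) < fps_conv_radius f" using assms(1) by (intro less_le_trans[OF _ assms(1)]) simp
  then have "(\<lambda>m. f $ m * z ^ m) sums eval_fps f z" by (rule sums_eval_fps)
  then show "(\<lambda>m. f $ m * z ^ m) sums X z" using assms(2)[OF z] by simp
qed

lemma represents_mult:
  assumes "represents f X" "represents g Y"
  shows "represents (f * g) (\<lambda>z. X z * Y z)"
proof (rule representsI)
  have r: "fps_conv_radius f \<ge> 1" "fps_conv_radius g \<ge> 1" using assms represents_radius by blast+
  then show "fps_conv_radius (f * g) \<ge> 1"
    using fps_conv_radius_mult[of f g] by (meson min.boundedI order_trans)
  fix z :: complex assume z: "z \<noteq> 0" "norm z < 1"
  then have "ereal (norm z) < 1" by simp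
  then have "ereal (norm z) < fps_conv_radius f" "ereal (norm z) < fps_conv_radius g"
    using r less_le_trans by blast+
  then show "eval_fps (f * g) z = X z * Y z"
    using represents_eval[OF assms(1) z] represents_eval[OF assms(2) z] by (simp add: eval_fps_mult)
qed

lemma represents_unique:
  assumes "represents f X" "represents g Y" "\<And>z. z \<noteq> 0 \<Longrightarrow> norm z < 1 \<Longrightarrow> X z = Y z"
  shows "f = g"
proof -
  have r: "fps_conv_radius f \<ge> 1" "fps_conv_radius g \<ge> 1" using assms represents_radius by blast+
  \<comment> \<open>Nothing is assumed at the origin. The extra factor makes both functions vanish
    there, so that they agree on a full neighbourhood of 0.\<close>
  have "fps_X * f = fps_X * g"
  proof (rule eval_fps_eqD)
    have "fps_conv_radius (fps_X * f) \<ge> 1" "fps_conv_radius (fps_X * g) \<ge> 1"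
      using r fps_conv_radius_mult[of fps_X f] fps_conv_radius_mult[of fps_X g] by (auto intro: order_trans)
    then show "fps_conv_radius (fps_X * f) > 0" "fps_conv_radius (fps_X * g) > 0"
      by (auto intro: less_le_trans[of 0 "1 :: ereal"])
    have "eventually (\<lambda>z. z \<in> ball (0 :: complex) 1) (nhds 0)"
      by (intro eventually_nhds_in_open) auto
    then show "\<forall>\<^sub>F z in nhds 0. eval_fps (fps_X * f) z = eval_fps (fps_X * g) z"
    proof eventually_elim
      case (elim z)
      then have "ereal (norm z) < 1" by simp
      then have *: "ereal (norm z) < fps_conv_radius f" "ereal (norm z) < fps_conv_radius g"
        using r less_le_trans by blast+
      have "z = 0 \<or> eval_fps f z = eval_fps g z"
      proof (cases "z = 0")
        case False
        then have "norm z < 1" using elim by simp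
        then show ?thesis
          using represents_eval[OF assms(1) False] represents_eval[OF assms(2) False] assms(3)[OF False] by simp
      qed simp
      then show ?case using * by (auto simp: eval_fps_mult)
    qed
  qed
  then show ?thesis by simp
qed

lemma map_fps_inject: "(map_fps f :: complex fps) = map_fps g \<Longrightarrow> f = g"
  by (simp add: fps_eq_iff)

lemma quadratic_nonneg: "n * n \<ge> 0" "2 * (n * n) + n \<ge> 0" for n :: int
  using abs_le_quadratic[of n] abs_ge_zero[of n] by linarith+

lemma nomeI: "z \<noteq> 0 \<Longrightarrow> norm z < 1 \<Longrightarrow> nome z"
  by standard

lemma represents_theta4: "represents (map_fps P_fps) theta4"
  unfolding represents_def
proof safe
  fix z :: complex assume z: "z \<noteq> 0" "norm z < 1"
  interpret nome z using z by (rule nomeI)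
  have *: "of_int (if even n then 1 else - 1) * z powi (n * n) = (-1) powi n * z powi (n * n)" for n
    by (simp add: power_int_minus_left)
  have "(\<lambda>n. norm ((-1) powi n * z powi (n * n))) summable_on UNIV"
    by (rule summable_gauss_0(2)[of "\<lambda>n. (-1) powi n" 1]) simp
  then have "(\<lambda>n. norm (of_int (if even n then 1 else - 1) * z powi (n * n))) summable_on UNIV"
    unfolding * .
  from theta_series_sums[OF z(1) quadratic_nonneg(1) finite_fibres(1) this]
  show "(\<lambda>m. map_fps P_fps $ m * z ^ m) sums theta4 z"
    unfolding * P_fps_def theta4_def .
qed

lemma represents_psi: "represents (map_fps S_fps) psi"
  unfolding represents_def
proof safe
  fix z :: complex assume z: "z \<noteq> 0" "norm z < 1"
  interpret nome z using z by (rule nomeI)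
  have "(\<lambda>n. norm (of_int 1 * z powi (2 * (n * n) + n))) summable_on UNIV"
    using summable_gauss_psi(1) by simp
  from theta_series_sums[OF z(1) quadratic_nonneg(2) finite_fibres(2) this]
  show "(\<lambda>m. map_fps S_fps $ m * z ^ m) sums psi z"
    unfolding S_fps_def psi_def by simp
qed

lemma represents_jac: "represents (map_fps J_fps) jac"
  unfolding represents_def
proof safe
  fix z :: complex assume z: "z \<noteq> 0" "norm z < 1"
  interpret nome z using z by (rule nomeI)
  from theta_series_sums[OF z(1) quadratic_nonneg(2) finite_fibres(2) summable_gauss_psi(2)]
  show "(\<lambda>m. map_fps J_fps $ m * z ^ m) sums jac z"
    unfolding J_fps_def jac_def .
qed

lemma represents_jac_square: "represents (map_fps K_fps) (\<lambda>z. jac (z\<^sup>2))"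
  unfolding represents_def
proof safe
  fix z :: complex assume z: "z \<noteq> 0" "norm z < 1"
  interpret nome z using z by (rule nomeI)
  interpret sq: nome "z\<^sup>2" by (rule nome_sq)
  have *: "z powi (2 * (2 * (n * n) + n)) = (z\<^sup>2) powi (2 * (n * n) + n)" for n
    by (simp only: power_int_mult power_int_numeral)
  have e: "2 * (2 * (n * n) + n) \<ge> 0" for n :: int by (intro mult_nonneg_nonneg quadratic_nonneg) simp
  have "(\<lambda>n. norm (of_int (4 * n + 1) * z powi (2 * (2 * (n * n) + n)))) summable_on UNIV"
    unfolding * by (rule sq.summable_gauss_psi(2))
  from theta_series_sums[OF z(1) e finite_fibres(3) this]
  show "(\<lambda>m. map_fps K_fps $ m * z ^ m) sums jac (z\<^sup>2)"
    unfolding * K_fps_def jac_def .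
qed

text \<open>Several identities above have the square of the nome as their argument; to use them at z
  the nome must be a square root of z.\<close>

lemma nome_csqrt:
  assumes "z \<noteq> 0" "norm z < 1"
  shows "nome (csqrt z)"
proof (rule nomeI)
  have "(norm (csqrt z))\<^sup>2 < 1" using assms(2) by (simp flip: norm_power)
  then show "norm (csqrt z) < 1" by (simp add: abs_square_less_1)
qed (use assms in auto)

lemma J_fps_eq: "J_fps = P_fps ^ 2 * S_fps"
proof (rule map_fps_inject, rule represents_unique[OF represents_jac])
  show "represents (map_fps (P_fps ^ 2 * S_fps)) (\<lambda>z. theta4 z * theta4 z * psi z)"
    unfolding map_fps_mult power2_eq_square by (intro represents_mult represents_theta4 represents_psi)
  fix z :: complex assume "z \<noteq> 0" "norm z < 1"
  then show "jac z = theta4 z * theta4 z * psi z"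
    using nome.jac_square(2)[OF nome_csqrt] by (simp add: power2_eq_square[of "theta4 z"])
qed

lemma K_fps_eq: "K_fps = P_fps * S_fps ^ 2"
proof (rule map_fps_inject, rule represents_unique[OF represents_jac_square])
  show "represents (map_fps (P_fps * S_fps ^ 2)) (\<lambda>z. theta4 z * (psi z * psi z))"
    unfolding map_fps_mult power2_eq_square by (intro represents_mult represents_theta4 represents_psi)
  fix z :: complex assume "z \<noteq> 0" "norm z < 1"
  then show "jac (z\<^sup>2) = theta4 z * (psi z * psi z)"
    using nome.jac_square(1)[OF nomeI] by (simp add: power2_eq_square[of "psi z"])
qed

lemma odd_part_fps:
  fixes a :: "nat \<Rightarrow> int"
  assumes a_def: "\<And>q :: complex. norm q < 1 \<Longrightarrow> (\<lambda>n. of_int (a (Suc n)) * q ^ Suc n) sums phi q"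
  shows "Abs_fps (\<lambda>n. a (2 * n + 1)) * P_fps ^ 2 = S_fps ^ 3"
proof -
  let ?F = "Abs_fps (\<lambda>n. a (2 * n + 1))"
  have key: "(\<lambda>k. of_int (a (2 * k + 1)) * (q\<^sup>2) ^ k) sums ((phi q - phi (- q)) / (2 * q))" if q: "nome q" for q
  proof -
    have n: "norm q < 1" "norm (- q) < 1" "q \<noteq> 0" using q by (simp_all add: nome_def)
    let ?f = "\<lambda>n. of_int (a (Suc n)) * q ^ Suc n - of_int (a (Suc n)) * (- q) ^ Suc n"
    have "?f sums (phi q - phi (- q))" by (intro sums_diff a_def n)
    \<comment> \<open>At odd n the exponent \<open>Suc n\<close> is even, and the two terms of the
      difference cancel.\<close>
    moreover have "(\<lambda>k. ?f (2 * k)) sums s \<longleftrightarrow> ?f sums s" for s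
    proof (rule sums_mono_reindex)
      show "strict_mono ((*) (2 :: nat))" by (auto simp: strict_mono_def)
      fix n :: nat assume "n \<notin> range ((*) 2)"
      then have "odd n" by (auto elim: evenE)
      then show "?f n = 0" by simp
    qed
    ultimately have "(\<lambda>k. ?f (2 * k) / (2 * q)) sums ((phi q - phi (- q)) / (2 * q))"
      by (intro sums_divide) blast
    moreover have "?f (2 * k) / (2 * q) = of_int (a (2 * k + 1)) * (q\<^sup>2) ^ k" for k
    proof -
      have "q ^ Suc (2 * k) = q * (q\<^sup>2) ^ k" "(- q) ^ Suc (2 * k) = - (q * (q\<^sup>2) ^ k)"
        by (simp_all add: power_mult)
      then show ?thesis using n(3) by simp
    qed
    ultimately show ?thesis by (simp only:)
  qed
  \<comment> \<open>The quotient is an even function of the square root, so the choice of branch is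
    immaterial.\<close>
  define Y where "Y = (\<lambda>z. (phi (csqrt z) - phi (- csqrt z)) / (2 * csqrt z))"
  have F: "represents (map_fps ?F) Y"
    unfolding represents_def
  proof safe
    fix z :: complex assume "z \<noteq> 0" "norm z < 1"
    from key[OF nome_csqrt[OF this]] show "(\<lambda>m. map_fps ?F $ m * z ^ m) sums Y z"
      by (simp add: Y_def)
  qed
  show ?thesis
  proof (rule map_fps_inject, rule represents_unique)
    show "represents (map_fps (?F * P_fps ^ 2)) (\<lambda>z. Y z * (theta4 z * theta4 z))"
      unfolding map_fps_mult power2_eq_square by (intro represents_mult F represents_theta4)
    show "represents (map_fps (S_fps ^ 3)) (\<lambda>z. psi z * (psi z * psi z))"
      unfolding map_fps_mult power3_eq_cube mult.assoc by (intro represents_mult represents_psi)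
    fix z :: complex assume z: "z \<noteq> 0" "norm z < 1"
    then have "csqrt z \<noteq> 0" by simp
    with nome.phi_odd_part[OF nome_csqrt[OF z]] show "Y z * (theta4 z * theta4 z) = psi z * (psi z * psi z)"
      by (simp add: Y_def field_simps power2_eq_square[of "theta4 z"] power3_eq_cube)
  qed
qed

theorem corollary3p3:
  fixes a :: "nat \<Rightarrow> int"
  assumes a_def: "\<And>q :: complex. norm q < 1 \<Longrightarrow>
                    (\<lambda>n. of_int (a (Suc n)) * q ^ Suc n) sums phi q"
  fixes n :: nat
  shows "[a (50 * n + 19) = 0] (mod 25) \<and>
         [a (50 * n + 39) = 0] (mod 25) \<and>
         [a (50 * n + 49) = 0] (mod 25)"
proof -
  have "25 dvd a (2 * (5 * k + 4) + 1)" if "k mod 5 \<in> {1, 3, 4}" for k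
    using coefficients_divisible[OF odd_part_fps[OF a_def] J_fps_eq K_fps_eq that] by simp
  moreover have "(5 * n + 1) mod 5 = 1" "(5 * n + 3) mod 5 = 3" "(5 * n + 4) mod 5 = 4" by presburger+
  ultimately have "25 dvd a (2 * (5 * (5 * n + 1) + 4) + 1)" "25 dvd a (2 * (5 * (5 * n + 3) + 4) + 1)"
    "25 dvd a (2 * (5 * (5 * n + 4) + 4) + 1)" by blast+
  moreover have "2 * (5 * (5 * n + 1) + 4) + 1 = 50 * n + 19" "2 * (5 * (5 * n + 3) + 4) + 1 = 50 * n + 39"
    "2 * (5 * (5 * n + 4) + 4) + 1 = 50 * n + 49" by simp_all
  ultimately show ?thesis by (simp only: cong_0_iff)
qed

end
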